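(* The set of all volumes of hyperbolic $4$-manifolds contains the even multiples of $4\pi^2/3$; that is, for every positive integer $n$ there exists a complete hyperbolic $4$-manifold $M$ of finite volume with $\operatorname{Vol}(M)=2n\cdot\frac{4\pi^2}{3}$.
   Context: A complete hyperbolic $4$-manifold is a quotient $\mathbb H^4/G$ with $G\subset\operatorname{Isom}(\mathbb H^4)$ discrete and torsion-free; volume is with respect to the hyperbolic metric of constant curvature $-1$. *)

theory Defs
  imports "HOL-Analysis.Analysis" "HOL-Algebra.Bij"
begin

text \<open>
  Hyperbolic 4-space is the upper sheet of the hyperboloid in Lorentzian 5-space, whose points
  are written \<open>(x, t)\<close> with \<open>x\<close> the space part and \<open>t\<close> the time part.
\<close>

definition lorentz :: "(real^4) \<times> real \<Rightarrow> (real^4) \<times> real \<Rightarrow> real" where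
  "lorentz p q = fst p \<bullet> fst q - snd p * snd q"

definition H4 :: "((real^4) \<times> real) set" where
  "H4 = {p. lorentz p p = -1 \<and> 0 < snd p}"

definition hdist :: "(real^4) \<times> real \<Rightarrow> (real^4) \<times> real \<Rightarrow> real" where
  "hdist p q = arcosh (- lorentz p q)"

text \<open>
  The Riemannian volume measure of \<open>H4\<close>. In the global chart \<open>x \<mapsto> (x, t)\<close>, where
  \<open>t = sqrt (1 + |x|^2)\<close>, the Lorentz form induces on \<open>H4\<close> the metric tensor
  \<open>g = I - x x^T / t^2\<close> of curvature -1; its determinant is \<open>1 / t^2\<close>, so the volume element
  is \<open>dx / t\<close>.
\<close>

definition hyp_measure :: "((real^4) \<times> real) measure" where
  "hyp_measure =
     distr (density lborel (\<lambda>x. ennreal (1 / sqrt (1 + (norm x)\<^sup>2)))) borel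
       (\<lambda>x. (x, sqrt (1 + (norm x)\<^sup>2)))"

text \<open>
  As in \<open>BijGroup\<close>, isometries are functions that are \<open>undefined\<close> outside \<open>H4\<close>, so that equality
  of functions is equality on \<open>H4\<close>.
\<close>

definition Isom_H4 :: "((real^4) \<times> real \<Rightarrow> (real^4) \<times> real) monoid" where
  "Isom_H4 = (BijGroup H4)
     \<lparr>carrier := {f \<in> Bij H4. \<forall>p\<in>H4. \<forall>q\<in>H4. hdist (f p) (f q) = hdist p q}\<rparr>"

text \<open>
  The topology on the isometry group is that of pointwise convergence on \<open>H4\<close>; on isometries
  it coincides with the compact-open topology. The Euclidean subspace topology on \<open>H4\<close> is the
  topology of \<open>hdist\<close>.
\<close>

definition Isom_H4_topology :: "((real^4) \<times> real \<Rightarrow> (real^4) \<times> real) topology" where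
  "Isom_H4_topology =
     subtopology (product_topology (\<lambda>_. top_of_set H4) H4) (carrier Isom_H4)"

definition discrete_subgroup :: "((real^4) \<times> real \<Rightarrow> (real^4) \<times> real) set \<Rightarrow> bool" where
  "discrete_subgroup G \<longleftrightarrow>
     subgroup G Isom_H4 \<and> subtopology Isom_H4_topology G = discrete_topology G"

definition torsion_free :: "((real^4) \<times> real \<Rightarrow> (real^4) \<times> real) set \<Rightarrow> bool" where
  "torsion_free G \<longleftrightarrow>
     (\<forall>g\<in>G. \<forall>k::nat. 0 < k \<longrightarrow> g [^]\<^bsub>Isom_H4\<^esub> k = \<one>\<^bsub>Isom_H4\<^esub> \<longrightarrow> g = \<one>\<^bsub>Isom_H4\<^esub>)"

definition orbit_space ::
    "((real^4) \<times> real \<Rightarrow> (real^4) \<times> real) set \<Rightarrow> ((real^4) \<times> real) set set" where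
  "orbit_space G = (\<lambda>p. (\<lambda>g. g p) ` G) ` H4"

definition complete_hyperbolic_4_manifold :: "((real^4) \<times> real) set set \<Rightarrow> bool" where
  "complete_hyperbolic_4_manifold M \<longleftrightarrow>
     (\<exists>G. discrete_subgroup G \<and> torsion_free G \<and> M = orbit_space G)"

text \<open>
  The projection \<open>H4 \<rightarrow> M\<close> is a local isometry, so the Riemannian measure of \<open>M\<close> gives the image of
  a Borel set \<open>A\<close> that meets every orbit at most once the volume of \<open>A\<close>. The whole of \<open>M\<close> is such
  an image, because a discrete group has a Borel set of orbit representatives; hence the
  supremum below is attained there and is the total Riemannian volume of \<open>M\<close>.
\<close>

definition hyp_volume :: "((real^4) \<times> real) set set \<Rightarrow> ennreal" where
  "hyp_volume M =
     (SUP A \<in> {A \<in> sets borel. A \<subseteq> H4 \<and> (\<forall>S\<in>M. \<forall>p\<in>A \<inter> S. \<forall>q\<in>A \<inter> S. p = q)}.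
        emeasure hyp_measure A)"

end

theory Submission
  imports Defs "HOL-Probability.Distributions"
begin

text \<open>
  The reflections in the ten integral vectors \<open>e\<^sub>i\<close> and \<open>-e\<^sub>i - e\<^sub>j - e\<^sub>0\<close> of norm 1 generate a
  right-angled Coxeter group whose chamber \<open>P\<close> has volume \<open>pi\<^sup>2 / 12\<close> (sixteen copies of \<open>P\<close> form the
  ideal regular 24-cell). If the group acts transitively on a finite set of labels such that no
  nonempty product of pairwise commuting walls fixes a label, then the stabilizer of a label is
  torsion-free, because a finite subgroup is conjugate into the stabilizer of a point of \<open>P\<close>, and
  its covolume is the number of labels times the volume of \<open>P\<close>. The walls are the edges of the
  complete graph \<open>K\<^sub>5\<close>, and two of them commute if the edges share a vertex. Letting an edge and
  a disjoint triangle act as the two generating reflections of a dihedral group on a cycle of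
  length \<open>4 n\<close>, and all edges suitably on three further bits, gives \<open>32 n\<close> labels.

  The volume of \<open>P\<close> is an integral over 72 congruent simplices. Its integrand splits off a radial
  part, which is compared with the Gaussian integral over the same cones; the rest is an arctangent
  integral that becomes elementary as a double integral.
\<close>

section \<open>Reflections of the hyperboloid\<close>

text \<open>By Gauss-Bonnet the volume of a finite-volume hyperbolic 4-manifold is
  \<open>4 * pi^2 / 3\<close> times its Euler characteristic; \<open>P\<close> contributes 1/16, so
  \<open>32 n\<close> labels mean characteristic \<open>2 n\<close>. The divisor 16 is forced: the
  four walls through the origin generate a group of order 16 that must act freely on the labels. No
  abstract Coxeter group occurs. A word in the walls acts on the hyperboloid and on the labels,
  rewriting preserves both actions, and signs of products with the roots show that the action on
  labels depends only on the isometry. The obstacle in the volume is that three integrations are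
  elementary, but the fourth contains \<open>arctan (k / sqrt 3) / (k * (1 + \<tau>^2))\<close> with
  \<open>k = sqrt ((3 + \<tau>^2) / 2)\<close>, which has no evident antiderivative. The Gaussian
  weight produces the same term, and its total is known because it factors over the four
  coordinates. Eliminating the term between the two integrals leaves an arctangent without the
  \<open>sqrt 3\<close>, for which the double integral works.\<close>

definition reflect :: "(real^4) \<times> real \<Rightarrow> (real^4) \<times> real \<Rightarrow> (real^4) \<times> real" where
  "reflect v p = p - (2 * lorentz p v) *\<^sub>R v"

lemma lorentz_commute: "lorentz p q = lorentz q p"
  by (simp add: lorentz_def inner_commute)

lemma lorentz_simps:
  "lorentz (p + q) v = lorentz p v + lorentz q v"
  "lorentz (p - q) v = lorentz p v - lorentz q v"
  "lorentz (c *\<^sub>R p) v = c * lorentz p v"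
  "lorentz v (p + q) = lorentz v p + lorentz v q"
  "lorentz v (p - q) = lorentz v p - lorentz v q"
  "lorentz v (c *\<^sub>R p) = c * lorentz v p"
  by (simp_all add: lorentz_def inner_simps algebra_simps)

lemma lorentz_reflect:
  assumes "lorentz v v = 1"
  shows "lorentz (reflect v p) (reflect v q) = lorentz p q"
  using assms lorentz_commute[of v p] lorentz_commute[of v q] by (simp add: reflect_def lorentz_simps algebra_simps)

lemma reflect_reflect:
  assumes "lorentz v v = 1"
  shows "reflect v (reflect v p) = p"
  using assms by (simp add: reflect_def lorentz_simps algebra_simps flip: scaleR_left_distrib)

text \<open>Reversed Cauchy-Schwarz inequality for forward vectors: each time part bounds the length
  of the space part, strictly for \<open>q\<close>, so the product of the time parts dominates the
  Euclidean inner product.\<close>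

lemma lorentz_neg_timelike:
  assumes "lorentz p p \<le> 0" "0 < snd p" "lorentz q q < 0" "0 < snd q"
  shows "lorentz p q < 0"
proof -
  have "(norm (fst p))\<^sup>2 \<le> (snd p)\<^sup>2" "(norm (fst q))\<^sup>2 < (snd q)\<^sup>2"
    using assms by (simp_all add: lorentz_def power2_norm_eq_inner flip: power2_eq_square)
  then have "norm (fst p) \<le> snd p" "norm (fst q) < snd q"
    using assms by (auto intro: power2_le_imp_le power2_less_imp_less)
  then have "norm (fst p) * norm (fst q) < snd p * snd q"
    using assms by (smt (verit) mult_left_mono mult_strict_right_mono norm_ge_zero mult_le_less_imp_less mult_nonneg_nonneg mult_less_le_imp_less mult_left_less_imp_less)
  then show ?thesis
    using norm_cauchy_schwarz[of "fst p" "fst q"] by (simp add: lorentz_def)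
qed

lemma lorentz_H4_neg:
  assumes "p \<in> H4" "q \<in> H4"
  shows "lorentz p q < 0"
  using assms lorentz_neg_timelike[of p q] by (simp add: H4_def)

text \<open>Only the choice of sheet is at stake. Since
  \<open>lorentz p (reflect v p) = -1 - 2 * (lorentz p v)^2\<close> is negative, the image cannot be
  on the lower sheet: its negative would be a forward timelike vector with positive product with
  \<open>p\<close>.\<close>

lemma reflect_H4:
  assumes v: "lorentz v v = 1" and p: "p \<in> H4"
  shows "reflect v p \<in> H4"
proof -
  let ?q = "reflect v p"
  have qq: "lorentz ?q ?q = -1"
    using lorentz_reflect[OF v] p by (simp add: H4_def)
  have pq: "lorentz p ?q < 0"
    using p zero_le_square[of "lorentz p v"] unfolding reflect_def lorentz_simps H4_def
    by (simp add: mult.assoc del: zero_le_square)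
  have "snd ?q \<noteq> 0"
    using qq inner_ge_zero[of "fst ?q"] by (auto simp: lorentz_def simp del: inner_ge_zero)
  moreover have False if "snd ?q < 0"
  proof -
    have "lorentz p (- ?q) < 0"
      using lorentz_neg_timelike[of p "- ?q"] p qq that by (simp add: H4_def lorentz_def)
    then show False using pq by (simp add: lorentz_def)
  qed
  ultimately have "0 < snd ?q" by fastforce
  then show ?thesis using qq by (simp add: H4_def)
qed

section \<open>Right-angled reflection systems\<close>

text \<open>Two distinct walls are either orthogonal or tangent at infinity, with product -1. In the
  second case \<open>r s + r t\<close> is lightlike and positive on \<open>H4\<close>, so the
  negative sides of the two walls are disjoint; this is all the geometry that the word arguments
  use.\<close>

locale reflection_system =
  fixes r :: "'s \<Rightarrow> (real^4) \<times> real"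
  assumes norm1: "lorentz (r s) (r s) = 1"
    and disj: "\<lbrakk>s \<noteq> t; lorentz (r s) (r t) \<noteq> 0\<rbrakk> \<Longrightarrow>
      lorentz (r s) (r t) = -1 \<and> (\<forall>p\<in>H4. 0 < lorentz p (r s) + lorentz p (r t))"
begin

definition com :: "'s \<Rightarrow> 's \<Rightarrow> bool" where
  "com s t \<longleftrightarrow> lorentz (r s) (r t) = 0"

lemma com_sym: "com s t \<longleftrightarrow> com t s"
  by (simp add: com_def lorentz_commute)

lemma reflect_commute: "com s t \<Longrightarrow> reflect (r s) (reflect (r t) p) = reflect (r t) (reflect (r s) p)"
  by (simp add: com_def reflect_def lorentz_simps lorentz_commute[of "r t" "r s"] algebra_simps)

fun act :: "'s list \<Rightarrow> (real^4) \<times> real \<Rightarrow> (real^4) \<times> real" where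
  "act [] p = p"
| "act (s # w) p = reflect (r s) (act w p)"

lemma act_Nil: "act [] = id"
  by (simp add: fun_eq_iff)

lemma act_append: "act (u @ w) p = act u (act w p)"
  by (induction u) auto

lemma act_rev: "act (rev w) (act w p) = p" "act w (act (rev w) p) = p"
proof -
  show *: "act (rev w) (act w p) = p" for w p
    by (induction w arbitrary: p) (auto simp: act_append reflect_reflect norm1)
  show "act w (act (rev w) p) = p" using *[of "rev w" p] by simp
qed

lemma act_H4: "p \<in> H4 \<Longrightarrow> act w p \<in> H4"
  by (induction w) (auto intro: reflect_H4 norm1)

lemma lorentz_act: "lorentz (act w p) (act w q) = lorentz p q"
  by (induction w) (auto simp: lorentz_reflect norm1)

lemma act_linear: "linear (act w)"
proof (induction w)
  case (Cons s w)
  then interpret linear "act w" by simp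
  show ?case
    by (rule linearI) (simp_all add: reflect_def lorentz_simps add scale algebra_simps)
qed (auto intro: linearI)

text \<open>\<open>ldesc s w\<close> says that \<open>w\<close> can be rewritten by commutations into a word that starts with \<open>s\<close>.\<close>

fun ldesc :: "'s \<Rightarrow> 's list \<Rightarrow> bool" where
  "ldesc s [] \<longleftrightarrow> False"
| "ldesc s (t # w) \<longleftrightarrow> s = t \<or> com s t \<and> ldesc s w"

text \<open>The normal form for a right-angled Coxeter group: a letter is rejected if commutations
  can bring an equal letter next to it, where both would cancel.\<close>

fun reduced :: "'s list \<Rightarrow> bool" where
  "reduced [] \<longleftrightarrow> True"
| "reduced (s # w) \<longleftrightarrow> \<not> ldesc s w \<and> reduced w"

definition P :: "((real^4) \<times> real) set" where
  "P = {p \<in> H4. \<forall>s. 0 \<le> lorentz p (r s)}"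

definition P_int :: "((real^4) \<times> real) set" where
  "P_int = {p \<in> H4. \<forall>s. 0 < lorentz p (r s)}"

lemma P_int_subset: "P_int \<subseteq> P" "P \<subseteq> H4" "P_int \<subseteq> H4"
  by (auto simp: P_int_def P_def less_imp_le)

lemma lorentz_reflect_root:
  "lorentz (reflect (r s) p) (r t) = lorentz p (r t) - 2 * lorentz p (r s) * lorentz (r s) (r t)"
  by (simp add: reflect_def lorentz_simps)

text \<open>Induction on the word. Applying the wall \<open>t\<close> reverses the sign at
  \<open>s = t\<close> and leaves the product with an orthogonal root alone. For tangent walls it
  adds \<open>2 * lorentz ?q (r t)\<close>; that product is nonnegative because \<open>t # w\<close>
  is reduced, and adding it once already gives a positive value by \<open>disj\<close>. The
  parameter \<open>R\<close> serves the closed and the open chamber at once.\<close>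

lemma ldesc_sign_general:
  assumes R: "R = (\<le>) \<or> R = (<)" and w: "reduced w" and p: "p \<in> H4" "\<And>s. R 0 (lorentz p (r s))"
  shows "if ldesc s w then R (lorentz (act w p) (r s)) 0 else R 0 (lorentz (act w p) (r s))"
  using w
proof (induction w arbitrary: s)
  case Nil
  then show ?case using p by simp
next
  case (Cons t w)
  let ?q = "act w p"
  have q: "?q \<in> H4" using p by (simp add: act_H4)
  have t: "R 0 (lorentz ?q (r t))" using Cons.IH[of t] Cons.prems by simp
  consider "s = t" | "s \<noteq> t" "com s t" | "s \<noteq> t" "\<not> com s t" by blast
  then show ?case
  proof cases
    case 1
    then show ?thesis using t R by (auto simp: lorentz_reflect_root norm1)
  next
    case 2
    then have "lorentz (r t) (r s) = 0" by (simp add: com_def lorentz_commute)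
    then show ?thesis using 2 Cons.IH[of s] Cons.prems by (simp add: lorentz_reflect_root)
  next
    case 3
    then have "lorentz (r t) (r s) = -1 \<and> 0 < lorentz ?q (r t) + lorentz ?q (r s)"
      using disj[of t s] q com_sym[of s t] by (simp add: com_def)
    then show ?thesis using 3 t R by (auto simp: lorentz_reflect_root)
  qed
qed

lemma ldesc_sign:
  assumes "reduced w" "p \<in> P"
  shows "if ldesc s w then lorentz (act w p) (r s) \<le> 0 else 0 \<le> lorentz (act w p) (r s)"
  using ldesc_sign_general[of "(\<le>)"] assms by (simp add: P_def)

lemma ldesc_sign_strict:
  assumes "reduced w" "p \<in> P_int"
  shows "if ldesc s w then lorentz (act w p) (r s) < 0 else 0 < lorentz (act w p) (r s)"
  using ldesc_sign_general[of "(<)"] assms by (simp add: P_int_def)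

text \<open>A wall does not commute with itself, so the letter that \<open>ldesc\<close> brings to
  the front is the first occurrence of \<open>s\<close>, and that one is deleted.\<close>

fun del :: "'s \<Rightarrow> 's list \<Rightarrow> 's list" where
  "del s [] = []"
| "del s (t # w) = (if s = t then w else t # del s w)"

lemma ldesc_del: "com t s \<Longrightarrow> ldesc t (del s w) \<Longrightarrow> ldesc t w"
  by (induction w) (auto split: if_splits)

lemma reduced_del: "reduced w \<Longrightarrow> ldesc s w \<Longrightarrow> reduced (del s w)"
  by (induction w) (auto dest: ldesc_del simp: com_sym)

lemma act_del: "ldesc s w \<Longrightarrow> reflect (r s) (act w p) = act (del s w) p"
  by (induction w) (auto simp: reflect_reflect norm1 reflect_commute)

end

section \<open>Reflection systems acting on a finite set of labels\<close>

text \<open>\<open>cover\<close> and \<open>P_int_nonempty\<close> take the place of Poincare's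
  polyhedron theorem: that tiles do not overlap follows from the sign lemma, that they fill
  \<open>H4\<close> is assumed here and proved for the concrete roots by a descent.\<close>

locale labelled_reflection_system = reflection_system r for r :: "'s::finite \<Rightarrow> (real^4) \<times> real" +
  fixes \<sigma> :: "'s \<Rightarrow> 'x \<Rightarrow> 'x" and X :: "'x set" and x0 :: 'x
  assumes \<sigma>_invol: "x \<in> X \<Longrightarrow> \<sigma> s (\<sigma> s x) = x"
    and \<sigma>_com: "x \<in> X \<Longrightarrow> lorentz (r s) (r t) = 0 \<Longrightarrow> \<sigma> s (\<sigma> t x) = \<sigma> t (\<sigma> s x)"
    and \<sigma>_X: "x \<in> X \<Longrightarrow> \<sigma> s x \<in> X"
    and finite_X: "finite X" and x0: "x0 \<in> X"
    and \<sigma>_transitive: "x \<in> X \<Longrightarrow> \<exists>w. foldr \<sigma> w x0 = x"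
    and \<sigma>_free: "\<lbrakk>w \<noteq> []; distinct w; \<And>s t. s \<in> set w \<Longrightarrow> t \<in> set w \<Longrightarrow> s \<noteq> t \<Longrightarrow> lorentz (r s) (r t) = 0; x \<in> X\<rbrakk>
        \<Longrightarrow> foldr \<sigma> w x \<noteq> x"
    and cover: "q \<in> H4 \<Longrightarrow> \<exists>w. act w q \<in> P"
    and P_int_nonempty: "P_int \<noteq> {}"
begin

abbreviation sig :: "'s list \<Rightarrow> 'x \<Rightarrow> 'x" where "sig \<equiv> foldr \<sigma>"

lemma sig_X: "x \<in> X \<Longrightarrow> sig w x \<in> X"
  by (induction w) (auto simp: \<sigma>_X)

lemma sig_rev:
  assumes "x \<in> X"
  shows "sig (rev w) (sig w x) = x" "sig w (sig (rev w) x) = x"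
proof -
  have *: "sig (rev w) (sig w x) = x" if "x \<in> X" for w x
    using that by (induction w arbitrary: x) (auto simp: \<sigma>_invol sig_X)
  show "sig (rev w) (sig w x) = x" "sig w (sig (rev w) x) = x"
    using *[of x w] *[of x "rev w"] assms by simp_all
qed

lemma sig_del: "ldesc s w \<Longrightarrow> x \<in> X \<Longrightarrow> \<sigma> s (sig w x) = sig (del s w) x"
  by (induction w) (auto simp: \<sigma>_invol sig_X \<sigma>_com com_def)

text \<open>Each cancellation on the way to a reduced word follows from the involution and
  commutation relations, which hold for both actions; so the word can be shortened without losing
  track of either.\<close>

lemma exists_reduced:
  "\<exists>w'. reduced w' \<and> act w' = act w \<and> (\<forall>x\<in>X. sig w' x = sig w x)"
proof (induction w)
  case Nil
  then show ?case by (intro exI[of _ "[]"]) auto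
next
  case (Cons s w)
  then obtain w' where w': "reduced w'" "act w' = act w" "\<forall>x\<in>X. sig w' x = sig w x" by blast
  show ?case
  proof (cases "ldesc s w'")
    case True
    have "act (del s w') p = act (s # w) p" for p
      using act_del[OF True, of p] w'(2) by simp
    moreover have "sig (del s w') x = sig (s # w) x" if "x \<in> X" for x
      using sig_del[OF True that] w'(3) that by simp
    ultimately show ?thesis using reduced_del[OF w'(1) True] by blast
  next
    case False
    have "act (s # w') p = act (s # w) p" for p
      using w'(2) by simp
    then show ?thesis using False w' by (intro exI[of _ "s # w'"]) auto
  qed
qed

text \<open>The first letter \<open>s\<close> of a nonempty reduced word satisfies
  \<open>ldesc\<close>, so the word carries interior points to the negative side of
  \<open>s\<close>. In particular, words with equal action on \<open>H4\<close> act equally on the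
  labels.\<close>

lemma act_P_int_trivial:
  assumes "p \<in> P_int" "act w p \<in> P_int"
  shows "act w = id \<and> (\<forall>x\<in>X. sig w x = x)"
proof -
  obtain w' where w': "reduced w'" "act w' = act w" "\<forall>x\<in>X. sig w' x = sig w x"
    using exists_reduced by blast
  have "w' = []"
  proof (cases w')
    case (Cons s v)
    have "lorentz (act w p) (r s) < 0"
      using ldesc_sign_strict[OF w'(1) assms(1), of s] w'(2) unfolding Cons by (simp del: act.simps)
    moreover have "0 < lorentz (act w p) (r s)" using assms(2) by (simp add: P_int_def)
    ultimately show ?thesis by simp
  qed simp
  then show ?thesis using w' by (auto simp: act_Nil)
qed

text \<open>For the first letter \<open>s\<close>, \<open>ldesc_sign\<close> forces a value at most
  0 and membership in \<open>P\<close> a value at least 0. Hence the reflection applied last fixes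
  its argument and can be stripped off.\<close>

lemma reduced_stabilizer:
  assumes "reduced w" "p \<in> P" "act w p \<in> P"
  shows "act w p = p \<and> (\<forall>s\<in>set w. lorentz p (r s) = 0)"
  using assms
proof (induction w)
  case (Cons s w)
  let ?q = "act w p"
  have "lorentz (act (s # w) p) (r s) = 0"
    using ldesc_sign[OF Cons.prems(1,2), of s] Cons.prems(3) by (auto simp: P_def simp del: act.simps intro: antisym)
  then have s: "lorentz ?q (r s) = 0" by (simp add: lorentz_reflect_root norm1)
  then have "act (s # w) p = ?q" by (simp add: reflect_def)
  then show ?case using Cons s by auto
qed simp

text \<open>The walls of a reduced word for \<open>act w\<close> all pass through \<open>p\<close>,
  and walls that meet in \<open>H4\<close> are orthogonal. A reduced word in commuting letters
  repeats none, so \<open>\<sigma>_free\<close> leaves only the empty word.\<close>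

lemma act_fixed_trivial:
  assumes "p \<in> P" "act w p \<in> P" "x \<in> X" "sig w x = x"
  shows "act w = id"
proof -
  obtain w' where w': "reduced w'" "act w' = act w" "\<forall>x\<in>X. sig w' x = sig w x"
    using exists_reduced by blast
  have z: "lorentz p (r s) = 0" if "s \<in> set w'" for s
    using reduced_stabilizer[OF w'(1) assms(1)] w'(2) assms(2) that by simp
  have orth: "lorentz (r s) (r t) = 0" if "s \<in> set w'" "t \<in> set w'" "s \<noteq> t" for s t
  proof (rule ccontr)
    assume "lorentz (r s) (r t) \<noteq> 0"
    then have "0 < lorentz p (r s) + lorentz p (r t)"
      using disj that(3) assms(1) P_int_subset by blast
    then show False using z that by auto
  qed
  have ld: "set v \<subseteq> set w' \<Longrightarrow> s \<in> set v \<Longrightarrow> ldesc s v" for s v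
  proof (induction v)
    case (Cons t v)
    then show ?case using orth[of s t] by (auto simp: com_def)
  qed simp
  have "set v \<subseteq> set w' \<Longrightarrow> reduced v \<Longrightarrow> distinct v" for v
  proof (induction v)
    case (Cons t v)
    then show ?case using ld[of v t] by auto
  qed simp
  then have "distinct w'" using w'(1) by simp
  moreover have "sig w' x = x" using w'(3) assms(3,4) by simp
  ultimately have "w' = []" using \<sigma>_free[OF _ _ orth assms(3)] by blast
  then show ?thesis using w' by (auto simp: act_Nil)
qed

end

section \<open>Invariance of the hyperbolic measure\<close>

abbreviation lborel_integral :: "('a::euclidean_space \<Rightarrow> ennreal) \<Rightarrow> ennreal" (binder \<open>LI \<close> 10) where
  "lborel_integral f \<equiv> integral\<^sup>N lborel f"

lemma sets_hyp_measure [measurable_cong, simp]: "sets hyp_measure = sets borel"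
  by (simp add: hyp_measure_def)

lemma space_hyp_measure [simp]: "space hyp_measure = UNIV"
  by (simp add: hyp_measure_def)

abbreviation lift :: "real^4 \<Rightarrow> (real^4) \<times> real" where
  "lift x \<equiv> (x, sqrt (1 + (norm x)\<^sup>2))"

lemma measurable_lift [measurable]: "lift \<in> borel_measurable borel"
  by measurable

lemma borel_measurable_lorentz [measurable]: "(\<lambda>p. lorentz p v) \<in> borel_measurable borel"
  unfolding lorentz_def by (intro borel_measurable_continuous_onI continuous_intros)

lemma borel_measurable_lorentz_self [measurable]: "(\<lambda>p. lorentz p p) \<in> borel_measurable borel"
  unfolding lorentz_def by (intro borel_measurable_continuous_onI continuous_intros)

lemma H4_eq_lift: "H4 = range lift"
proof -
  have "p = lift (fst p)" if "p \<in> H4" for p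
  proof -
    have "(snd p)\<^sup>2 = 1 + (norm (fst p))\<^sup>2" "0 < snd p"
      using that unfolding power2_norm_eq_inner by (auto simp: H4_def lorentz_def power2_eq_square)
    then show ?thesis by (metis prod.collapse less_imp_le real_sqrt_unique)
  qed
  moreover have "lift x \<in> H4" for x
    by (auto simp: H4_def lorentz_def power2_norm_eq_inner add_pos_nonneg abs_of_nonneg)
  ultimately show ?thesis by blast
qed

lemma H4_measurable [measurable]: "H4 \<in> sets borel"
proof -
  have "closed {p. lorentz p p = -1 \<and> 0 \<le> snd p}"
    unfolding lorentz_def by (intro closed_Collect_conj closed_Collect_eq closed_Collect_le continuous_intros)
  moreover have "{p. lorentz p p = -1 \<and> 0 \<le> snd p} = H4"
    by (auto simp: H4_def lorentz_def less_le)
       (metis inner_ge_zero mult_zero_left diff_zero neg_0_le_iff_le not_one_le_zero order_trans)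
  ultimately show ?thesis by (metis borel_closed)
qed

lemma emeasure_hyp_measure:
  assumes [measurable]: "A \<in> sets borel"
  shows "emeasure hyp_measure A =
    (LI x. ennreal (1 / sqrt (1 + (norm x)\<^sup>2)) * indicator A (lift x))"
proof -
  have "emeasure hyp_measure A =
      emeasure (density lborel (\<lambda>x. ennreal (1 / sqrt (1 + (norm x)\<^sup>2)))) (lift -` A \<inter> UNIV)"
    unfolding hyp_measure_def by (subst emeasure_distr) simp_all
  also have "\<dots> = (LI x. ennreal (1 / sqrt (1 + (norm x)\<^sup>2)) * indicator (lift -` A \<inter> UNIV) x)"
  proof (rule emeasure_density)
    have "lift -` A \<inter> space borel \<in> sets borel" using measurable_lift assms by (rule measurable_sets)
    then show "lift -` A \<inter> UNIV \<in> sets lborel" by simp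
  qed measurable
  finally show ?thesis by (simp add: indicator_def)
qed

text \<open>The part of the cone over \<open>A\<close> between the origin and \<open>H4\<close>. Its
  Lebesgue measure in five-space determines the hyperbolic measure of \<open>A\<close>, so
  invariance under isometries becomes invariance of Lebesgue measure under linear maps.\<close>

definition open_cone :: "((real^4) \<times> real) set \<Rightarrow> ((real^4) \<times> real) set" where
  "open_cone A = {p. -1 < lorentz p p \<and> lorentz p p < 0 \<and> 0 < snd p \<and>
     (1 / sqrt (- lorentz p p)) *\<^sub>R p \<in> A}"

lemma open_cone_measurable [measurable]:
  assumes [measurable]: "A \<in> sets borel"
  shows "open_cone A \<in> sets borel"
proof -
  have [measurable]: "snd \<in> borel_measurable (borel :: ((real^4) \<times> real) measure)"
    by (intro borel_measurable_continuous_onI continuous_intros)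
  have [measurable]: "(\<lambda>p. (1 / sqrt (- lorentz p p)) *\<^sub>R p) \<in> borel_measurable borel"
    by (intro borel_measurable_scaleR) measurable
  show ?thesis unfolding open_cone_def by measurable
qed

lemma nn_integral_scaleR:
  fixes f :: "'a::euclidean_space \<Rightarrow> ennreal"
  assumes [measurable]: "f \<in> borel_measurable borel" and c: "c \<noteq> 0"
  shows "(LI x. f x) = ennreal (\<bar>c\<bar> ^ DIM('a)) * (LI x. f (c *\<^sub>R x))"
proof -
  have "(LI x. f x) = (\<integral>\<^sup>+x. f x \<partial>density (distr lborel borel (\<lambda>x. 0 + c *\<^sub>R x)) (\<lambda>_. \<bar>c\<bar>^DIM('a)))"
    using lborel_affine[OF c, of "0::'a"] by simp
  also have "\<dots> = (LI x. ennreal (\<bar>c\<bar>^DIM('a)) * f (c *\<^sub>R x))"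
    by (subst nn_integral_density) (auto simp: nn_integral_distr)
  finally show ?thesis by (simp add: nn_integral_cmult)
qed

text \<open>On each vertical line \<open>q = t^2 - |x|^2\<close> becomes the coordinate, with
  \<open>dt = dq / (2 * sqrt (q + |x|^2))\<close>. Rescaling \<open>x\<close> by
  \<open>sqrt q\<close> gives \<open>q^2\<close> from the volume in dimension 4 and
  \<open>q^(-1/2)\<close> from the density, and \<open>q^(3/2) / 2\<close> has integral 1/5 over the
  unit interval.\<close>

lemma emeasure_open_cone:
  assumes A[measurable]: "A \<in> sets borel" and "A \<subseteq> H4"
  shows "5 * emeasure lborel (open_cone A) = emeasure hyp_measure A"
proof -
  define I where "I x t = (indicator (open_cone A) (x, t) :: real)" for x :: "real^4" and t :: real
  define f where "f x q = indicator A ((1 / sqrt q) *\<^sub>R (x, sqrt (q + (norm x)\<^sup>2))) / (2 * sqrt (q + (norm x)\<^sup>2))"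
    for x :: "real^4" and q :: real
  have f_meas: "(\<lambda>(q, x). ennreal (f x q) * indicator {0<..<1} q) \<in> borel_measurable (lborel \<Otimes>\<^sub>M lborel)"
    unfolding f_def by measurable
  have inner: "(LI t. indicator (open_cone A) (x, t)) =
      (LI q. ennreal (f x q) * indicator {0<..<1} q)" for x
  proof -
    let ?n = "norm x"
    let ?g = "\<lambda>t. t\<^sup>2 - ?n\<^sup>2"
    let ?f = "\<lambda>q. f x q * indicator {0<..<1} q"
    have [measurable]: "f x \<in> borel_measurable borel" unfolding f_def by measurable
    have g: "?g ?n = 0" "?g (sqrt (1 + ?n\<^sup>2)) = 1" by (simp_all add: add_nonneg_nonneg)
    have "(LI q. ennreal (f x q) * indicator {0<..<1} q) =
        (LI q. ennreal (?f q * indicator {?g ?n..?g (sqrt (1 + ?n\<^sup>2))} q))"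
      unfolding g by (intro nn_integral_cong) (auto simp: indicator_def)
    also have "\<dots> = (LI t. ennreal (?f (?g t) * (2 * t) * indicator {?n..sqrt (1 + ?n\<^sup>2)} t))"
    proof (rule nn_integral_substitution[where f = ?f and g = ?g and g' = "\<lambda>t. 2 * t"])
      show "set_borel_measurable borel {?g ?n..?g (sqrt (1 + ?n\<^sup>2))} ?f"
        unfolding set_borel_measurable_def by measurable
      show "(?g has_real_derivative 2 * t) (at t)" for t
        by (auto intro!: derivative_eq_intros)
      show "?n \<le> sqrt (1 + ?n\<^sup>2)" by (rule real_le_rsqrt) simp
      show "0 \<le> 2 * t" if "t \<in> {?n..sqrt (1 + ?n\<^sup>2)}" for t
        using that order_trans[OF norm_ge_zero[of x], of t] by auto
    qed (auto intro!: continuous_intros)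
    also have "\<dots> = (LI t. indicator (open_cone A) (x, t))"
    proof (intro nn_integral_cong)
      fix t :: real
      have l: "lorentz (x, t) (x, t) = - ?g t"
        unfolding power2_norm_eq_inner by (simp add: lorentz_def power2_eq_square)
      have iff: "?n < t \<and> t < sqrt (1 + ?n\<^sup>2) \<longleftrightarrow> 0 < ?g t \<and> ?g t < 1 \<and> 0 < t"
      proof (intro iffI conjI)
        assume *: "?n < t \<and> t < sqrt (1 + ?n\<^sup>2)"
        then show t: "0 < t" using norm_ge_zero[of x] by linarith
        show "0 < ?g t" using * by (simp add: power_strict_mono)
        have "t\<^sup>2 < (sqrt (1 + ?n\<^sup>2))\<^sup>2" using * t by (intro power_strict_mono) auto
        then show "?g t < 1" by (simp add: add_nonneg_nonneg)
      next
        assume *: "0 < ?g t \<and> ?g t < 1 \<and> 0 < t"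
        then show "?n < t" by (intro power2_less_imp_less[of ?n t]) auto
        show "t < sqrt (1 + ?n\<^sup>2)" using * by (intro real_less_rsqrt) auto
      qed
      show "ennreal (?f (?g t) * (2 * t) * indicator {?n..sqrt (1 + ?n\<^sup>2)} t) = indicator (open_cone A) (x, t)"
      proof (cases "0 < ?g t \<and> ?g t < 1 \<and> 0 < t")
        case True
        then have "?f (?g t) * (2 * t) = indicator A ((1 / sqrt (?g t)) *\<^sub>R (x, t))"
          by (simp add: f_def)
        then show ?thesis using True iff l by (auto simp: open_cone_def indicator_def)
      next
        case False
        then have "indicator (open_cone A) (x, t) = (0 :: ennreal)" using l by (auto simp: open_cone_def indicator_def)
        moreover have "?f (?g t) * (2 * t) * indicator {?n..sqrt (1 + ?n\<^sup>2)} t = 0"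
        proof (cases "t \<le> 0")
          case True
          then have "t = 0 \<or> \<not> ?n \<le> t" using norm_ge_zero[of x] by linarith
          then show ?thesis by (auto simp: indicator_def)
        qed (use False in \<open>auto simp: indicator_def\<close>)
        ultimately show ?thesis by (simp only: ennreal_0)
      qed
    qed
    finally show ?thesis by simp
  qed
  have scal: "(LI x. ennreal (f x q)) = ennreal (q powr (3/2) / 2) * emeasure hyp_measure A"
    if q: "0 < q" for q
  proof -
    have [measurable]: "(\<lambda>x. f x q) \<in> borel_measurable borel" unfolding f_def by measurable
    have "sqrt q ^ 4 = ((sqrt q)\<^sup>2)\<^sup>2" by (simp flip: power_mult)
    then have q4: "sqrt q ^ 4 = q\<^sup>2" using q by simp
    have "(LI x. ennreal (f x q)) = ennreal (q\<^sup>2) * (LI x. ennreal (f (sqrt q *\<^sub>R x) q))"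
      using nn_integral_scaleR[of "\<lambda>x. ennreal (f x q)" "sqrt q"] q by (simp add: q4)
    also have "\<dots> = (LI x. ennreal (q\<^sup>2) * ennreal (f (sqrt q *\<^sub>R x) q))"
      by (rule nn_integral_cmult[symmetric]) measurable
    also have "\<dots> = (LI x. ennreal (q powr (3/2) / 2) *
        (ennreal (1 / sqrt (1 + (norm x)\<^sup>2)) * indicator A (lift x)))"
    proof (intro nn_integral_cong)
      fix x :: "real^4"
      have "q + (norm (sqrt q *\<^sub>R x))\<^sup>2 = q * (1 + (norm x)\<^sup>2)"
        using q by (simp add: power_mult_distrib algebra_simps)
      then have s: "sqrt (q + (norm (sqrt q *\<^sub>R x))\<^sup>2) = sqrt q * sqrt (1 + (norm x)\<^sup>2)"
        by (simp add: real_sqrt_mult)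
      have "(1 / sqrt q) *\<^sub>R (sqrt q *\<^sub>R x, sqrt q * sqrt (1 + (norm x)\<^sup>2)) = lift x"
        using q by simp
      then have f: "f (sqrt q *\<^sub>R x) q = indicator A (lift x) / (2 * (sqrt q * sqrt (1 + (norm x)\<^sup>2)))"
        unfolding f_def s by simp
      have pw: "q\<^sup>2 / sqrt q = q powr (3/2)"
        using q by (simp add: powr_half_sqrt[symmetric] powr_diff[symmetric] flip: powr_numeral)
      have "q\<^sup>2 * f (sqrt q *\<^sub>R x) q =
          q powr (3/2) / 2 * (1 / sqrt (1 + (norm x)\<^sup>2) * indicator A (lift x))"
        unfolding f pw[symmetric] by (simp add: mult_ac)
      then show "ennreal (q\<^sup>2) * ennreal (f (sqrt q *\<^sub>R x) q) = ennreal (q powr (3/2) / 2) *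
          (ennreal (1 / sqrt (1 + (norm x)\<^sup>2)) * indicator A (lift x))"
        by (simp add: ennreal_mult'[symmetric] flip: ennreal_indicator)
    qed
    also have "\<dots> = ennreal (q powr (3/2) / 2) * emeasure hyp_measure A"
      by (subst nn_integral_cmult) (auto simp: emeasure_hyp_measure)
    finally show ?thesis .
  qed
  have "emeasure lborel (open_cone A) = (\<integral>\<^sup>+p. indicator (open_cone A) p \<partial>(lborel \<Otimes>\<^sub>M lborel))"
    by (simp add: lborel_prod)
  also have "\<dots> = (LI x. LI t. indicator (open_cone A) (x, t))"
    by (rule lborel.nn_integral_fst[symmetric]) (simp add: lborel_prod)
  also have "\<dots> = (LI x. LI q. ennreal (f x q) * indicator {0<..<1} q)"
    by (simp add: inner)
  also have "\<dots> = (LI q. LI x. ennreal (f x q) * indicator {0<..<1} q)"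
    by (rule lborel_pair.Fubini'[OF f_meas])
  also have "\<dots> = (LI q. emeasure hyp_measure A * (ennreal (q powr (3/2) / 2) * indicator {0..1} q))"
  proof (rule nn_integral_cong_AE)
    have "AE q in lborel. q \<noteq> (0::real)" "AE q in lborel. q \<noteq> (1::real)"
      by (rule AE_lborel_singleton)+
    then show "AE q in lborel. (LI x. ennreal (f x q) * indicator {0<..<1} q) =
        emeasure hyp_measure A * (ennreal (q powr (3/2) / 2) * indicator {0..1} q)"
    proof eventually_elim
      case (elim q)
      then show ?case by (auto simp: indicator_def scal mult.commute)
    qed
  qed
  also have "\<dots> = emeasure hyp_measure A * (LI q. ennreal (q powr (3/2) / 2) * indicator {0..1} q)"
    by (rule nn_integral_cmult) measurable
  also have "(LI q. ennreal (q powr (3/2) / 2) * indicator {0..1} q) = ennreal (1 / 5)"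
  proof (rule nn_integral_has_integral_lebesgue')
    have "((\<lambda>q. q powr (3/2) / 2) has_integral (1 powr (5/2) / 5 - 0 powr (5/2) / 5)) {0..1::real}"
    proof (rule fundamental_theorem_of_calculus_interior)
      show "continuous_on {0..1} (\<lambda>q. q powr (5/2) / 5 :: real)"
        by (intro continuous_intros continuous_on_powr') auto
      show "((\<lambda>q. q powr (5/2) / 5) has_vector_derivative q powr (3/2) / 2) (at q)" if "q \<in> {0<..<1}" for q :: real
        using that unfolding has_real_derivative_iff_has_vector_derivative[symmetric]
        by (auto intro!: derivative_eq_intros)
    qed simp
    then show "((\<lambda>q. q powr (3/2) / 2) has_integral 1 / 5) {0..1::real}" by simp
  qed simp
  finally have "emeasure lborel (open_cone A) = emeasure hyp_measure A * ennreal (1 / 5)" .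
  then have "5 * emeasure lborel (open_cone A) = (5 * ennreal (1 / 5)) * emeasure hyp_measure A"
    by (simp only: ac_simps)
  also have "5 * ennreal (1 / 5) = 1"
    by (simp add: ennreal_mult'[symmetric] flip: ennreal_numeral)
  finally show ?thesis by simp
qed

section \<open>Invariance of Lebesgue measure and of the hyperbolic measure under
  reflections\<close>

lemma reflect_linear: "linear (reflect v)"
  by (rule linearI) (simp_all add: reflect_def lorentz_simps algebra_simps)

lemma reflect_measurable [measurable]: "reflect v \<in> borel_measurable borel"
  by (intro borel_measurable_continuous_onI linear_continuous_on linear_conv_bounded_linear[THEN iffD1] reflect_linear)

lemma nn_integral_lborel_prod_measurable:
  fixes f :: "'a::euclidean_space \<times> 'b::euclidean_space \<Rightarrow> ennreal"
  assumes [measurable]: "f \<in> borel_measurable borel"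
  shows "(LI p. f p) = (LI x. LI t. f (x, t))"
    and "(LI p. f p) = (LI t. LI x. f (x, t))"
proof -
  have f: "f \<in> borel_measurable (lborel \<Otimes>\<^sub>M lborel)" by (simp add: lborel_prod)
  show *: "(LI p. f p) = (LI x. LI t. f (x, t))"
    using lborel.nn_integral_fst[OF f] by (simp add: lborel_prod)
  show "(LI p. f p) = (LI t. LI x. f (x, t))"
    using lborel_pair.nn_integral_snd[OF f] by (simp add: lborel_prod)
qed

lemma nn_integral_translate:
  fixes f :: "'a::euclidean_space \<Rightarrow> ennreal"
  assumes [measurable]: "f \<in> borel_measurable borel"
  shows "(LI x. f (a + x)) = (LI x. f x)"
  by (subst (2) lborel_distr_plus[symmetric, of a]) (simp add: nn_integral_distr)

text \<open>For a root \<open>v\<close> with nonzero time part, the shear along \<open>v\<close> that straightens \<open>v\<close> to the time axis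
  conjugates the reflection into an affine reflection of each vertical line.\<close>

lemma nn_integral_reflect:
  fixes f :: "(real^4) \<times> real \<Rightarrow> ennreal"
  assumes f[measurable]: "f \<in> borel_measurable borel" and v: "lorentz v v = 1" and nz: "snd v \<noteq> 0"
  shows "(LI p. f (reflect v p)) = (LI p. f p)"
proof -
  define a where "a = (1 / snd v) *\<^sub>R fst v"
  define S where "S p = (fst p + snd p *\<^sub>R a, snd p)" for p :: "(real^4) \<times> real"
  define T where "T p = (fst p, - snd p - 2 * snd v * (fst p \<bullet> fst v))" for p :: "(real^4) \<times> real"
  have cont: "continuous_on UNIV S" "continuous_on UNIV T"
    unfolding S_def T_def by (intro continuous_intros)+
  then have [measurable]: "S \<in> borel_measurable borel" "T \<in> borel_measurable borel"
    by (auto intro: borel_measurable_continuous_onI)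
  have S: "(LI p. g (S p)) = (LI p. g p)"
    if [measurable]: "g \<in> borel_measurable borel" for g :: "_ \<Rightarrow> ennreal"
  proof -
    have [measurable]: "(\<lambda>x. g (x, t)) \<in> borel_measurable borel" for t
      by (rule measurable_compose[OF _ that]) (intro borel_measurable_continuous_onI continuous_intros)
    have [measurable]: "(\<lambda>p. g (S p)) \<in> borel_measurable borel" by measurable
    show ?thesis
      by (subst (1 2) nn_integral_lborel_prod_measurable(2))
         (measurable, simp add: S_def nn_integral_translate[of "\<lambda>x. g (x, _)" "_ *\<^sub>R a"] add.commute[of _ "_ *\<^sub>R a"])
  qed
  have T: "(LI p. g (T p)) = (LI p. g p)"
    if [measurable]: "g \<in> borel_measurable borel" for g :: "_ \<Rightarrow> ennreal"
  proof -
    have [measurable]: "(\<lambda>t. g (x, t)) \<in> borel_measurable borel" for x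
      by (rule measurable_compose[OF _ that]) (intro borel_measurable_continuous_onI continuous_intros)
    have "(LI t. g (x, t)) = (LI t. g (T (x, t)))" for x
      using nn_integral_real_affine[of "\<lambda>t. g (x, t)" "-1" "- 2 * snd v * (x \<bullet> fst v)"]
      by (simp add: T_def algebra_simps)
    then show ?thesis
      by (subst (1 2) nn_integral_lborel_prod_measurable(1)) simp_all
  qed
  have R: "reflect v (S p) = S (T p)" for p
  proof -
    have "lorentz (S p) v = fst p \<bullet> fst v + snd p * (fst v \<bullet> fst v - (snd v)\<^sup>2) / snd v"
      using nz by (simp add: S_def a_def lorentz_def inner_simps field_simps power2_eq_square)
    also have "\<dots> = fst p \<bullet> fst v + snd p / snd v"
      using v by (simp add: lorentz_def power2_eq_square)
    finally have l: "lorentz (S p) v = fst p \<bullet> fst v + snd p / snd v" .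
    note l' = l[unfolded S_def]
    have "snd (reflect v (S p)) = snd (S (T p))"
      using nz by (simp add: reflect_def l' S_def T_def field_simps)
    moreover have "fst (reflect v (S p)) = fst (S (T p))"
    proof -
      have "fst v = snd v *\<^sub>R a" using nz by (simp add: a_def)
      moreover have "2 * (fst p \<bullet> fst v + snd p / snd v) * snd v = 2 * snd v * (fst p \<bullet> fst v) + 2 * snd p"
        using nz by (simp add: field_simps)
      ultimately show ?thesis
        by (simp add: reflect_def l' S_def T_def algebra_simps flip: scaleR_left_distrib)
    qed
    ultimately show ?thesis by (rule prod_eqI[rotated])
  qed
  have "(LI p. f (reflect v p)) = (LI p. f (reflect v (S p)))"
    by (rule S[symmetric]) measurable
  also have "\<dots> = (LI p. f (S (T p)))" by (simp add: R)
  also have "\<dots> = (LI p. f (S p))" by (rule T) measurable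
  also have "\<dots> = (LI p. f p)" by (rule S) measurable
  finally show ?thesis .
qed

text \<open>Invariance of Lebesgue measure enters as a hypothesis because roots with and without
  time part obtain it in different ways.\<close>

lemma hyp_measure_reflect:
  assumes A[measurable]: "A \<in> sets borel" and "A \<subseteq> H4" and v: "lorentz v v = 1"
    and inv: "\<And>f::(real^4) \<times> real \<Rightarrow> ennreal. f \<in> borel_measurable borel \<Longrightarrow>
      (LI p. f (reflect v p)) = (LI p. f p)"
  shows "emeasure hyp_measure (reflect v ` A) = emeasure hyp_measure A" "reflect v ` A \<in> sets borel"
proof -
  have img: "reflect v ` A = reflect v -` A"
  proof
    show "reflect v ` A \<subseteq> reflect v -` A" using reflect_reflect[OF v] by auto
    show "reflect v -` A \<subseteq> reflect v ` A"
    proof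
      fix p assume "p \<in> reflect v -` A"
      then show "p \<in> reflect v ` A" using reflect_reflect[OF v, of p] by (metis imageI vimageD)
    qed
  qed
  then show B[measurable]: "reflect v ` A \<in> sets borel"
    using measurable_sets[OF reflect_measurable A] by simp
  have sub: "reflect v ` A \<subseteq> H4" using assms(2) reflect_H4[OF v] by auto
  have cone: "reflect v p \<in> open_cone A \<longleftrightarrow> p \<in> open_cone (reflect v ` A)" for p
  proof -
    let ?c = "1 / sqrt (- lorentz p p)"
    have r: "?c *\<^sub>R reflect v p = reflect v (?c *\<^sub>R p)"
      using reflect_linear[of v] by (simp add: linear_scale)
    \<comment> \<open>A linear map does not visibly preserve the sign of the time part; it is
      recovered here because both radial projections lie on \<open>H4\<close>.\<close>
    have s: "0 < snd (reflect v p) \<longleftrightarrow> 0 < snd p"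
      if "?c *\<^sub>R reflect v p \<in> A" "lorentz p p < 0"
    proof -
      have "?c *\<^sub>R p = reflect v (reflect v (?c *\<^sub>R p))" by (simp add: reflect_reflect[OF v])
      then have "?c *\<^sub>R p \<in> H4" "?c *\<^sub>R reflect v p \<in> H4"
        using that(1) sub assms(2) r by (metis image_eqI subsetD)+
      then show ?thesis using that(2) by (simp add: H4_def zero_less_divide_iff)
    qed
    show ?thesis
      using s r unfolding open_cone_def img by (auto simp: lorentz_reflect[OF v])
  qed
  have "emeasure lborel (open_cone (reflect v ` A)) = (LI p. indicator (open_cone A) (reflect v p))"
    using nn_integral_indicator[of "open_cone (reflect v ` A)" lborel] by (simp add: cone indicator_def)
  also have "\<dots> = emeasure lborel (open_cone A)"
    by (subst inv) auto
  finally show "emeasure hyp_measure (reflect v ` A) = emeasure hyp_measure A"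
    using emeasure_open_cone[OF A assms(2)] emeasure_open_cone[OF B sub] by metis
qed

text \<open>The shear used for the other roots would divide by a vanishing time part. These
  reflections only change the sign of one coordinate, so a diagonal scaling with factors of absolute
  value 1 suffices.\<close>

lemma nn_integral_reflect_axis:
  fixes f :: "(real^4) \<times> real \<Rightarrow> ennreal"
  assumes f[measurable]: "f \<in> borel_measurable borel"
  shows "(LI p. f (reflect (axis i 1, 0) p)) = (LI p. f p)"
proof -
  define c :: "real^4 \<Rightarrow> real" where "c j = (if j = axis i 1 then -1 else 1)" for j
  define T :: "real^4 \<Rightarrow> real^4" where "T x = 0 + (\<Sum>j\<in>Basis. (c j * (x \<bullet> j)) *\<^sub>R j)" for x
  have T: "T x = x - (2 * (x \<bullet> axis i 1)) *\<^sub>R axis i 1" for x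
  proof -
    have "T x = (\<Sum>j\<in>Basis. (x \<bullet> j) *\<^sub>R j) - (\<Sum>j\<in>Basis. if j = axis i 1 then (2 * (x \<bullet> j)) *\<^sub>R j else 0)"
      unfolding T_def sum_subtractf[symmetric]
      by (auto simp: c_def algebra_simps intro!: sum.cong simp flip: scaleR_left_distrib)
    also have "\<dots> = x - (2 * (x \<bullet> axis i 1)) *\<^sub>R axis i 1"
      by (simp add: euclidean_representation)
    finally show ?thesis .
  qed
  have [measurable]: "T \<in> borel_measurable borel"
    unfolding T_def by measurable
  have "(\<Prod>j\<in>Basis. \<bar>c j\<bar>) = 1" by (auto simp: c_def intro!: prod.neutral)
  then have "lborel = density (distr lborel borel T) (\<lambda>_. 1)"
    using lborel_affine_euclidean[of c 0] by (simp add: T_def[abs_def] c_def)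
  then have dT: "lborel = distr lborel borel T" by (simp add: density_1)
  have S: "(LI x. g (T x)) = (LI x. g x)"
    if [measurable]: "g \<in> borel_measurable borel" for g :: "_ \<Rightarrow> ennreal"
    by (subst (2) dT) (simp add: nn_integral_distr)
  have fx[measurable]: "(\<lambda>x. f (x, t)) \<in> borel_measurable borel" for t
    by (rule measurable_compose[OF _ f]) (intro borel_measurable_continuous_onI continuous_intros)
  have "reflect (axis i 1, 0) (x, t) = (T x, t)" for x t
    by (simp add: reflect_def lorentz_def T)
  then show ?thesis
    by (subst (1 2) nn_integral_lborel_prod_measurable(2)) (simp_all add: S[OF fx])
qed

text \<open>The cone over a hyperbolic hyperplane lies in a linear hyperplane of five-space.\<close>

lemma hyp_measure_hyperplane:
  assumes v: "v \<noteq> 0"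
  shows "emeasure hyp_measure {p \<in> H4. lorentz p v = 0} = 0"
proof -
  have [measurable]: "{p \<in> H4. lorentz p v = 0} \<in> sets borel" by measurable
  have "open_cone {p \<in> H4. lorentz p v = 0} \<subseteq> {p. (fst v, - snd v) \<bullet> p = 0}"
    by (auto simp: open_cone_def lorentz_simps) (auto simp: lorentz_def inner_prod_def inner_commute)
  moreover have "negligible {p. (fst v, - snd v) \<bullet> p = 0}"
    using v by (intro negligible_hyperplane) (auto simp: prod_eq_iff)
  ultimately have "negligible (open_cone {p \<in> H4. lorentz p v = 0})"
    by (rule negligible_subset[rotated])
  then have "emeasure lborel (open_cone {p \<in> H4. lorentz p v = 0}) = 0"
    by (simp add: negligible_iff_null_sets null_sets_def)
  then show ?thesis using emeasure_open_cone[of "{p \<in> H4. lorentz p v = 0}"] by (auto simp: mult_eq_0_iff)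
qed

section \<open>The group defined by a labelled reflection system\<close>

lemma group_Isom_H4: "subgroup (carrier Isom_H4) (BijGroup H4)"
proof (rule group.subgroupI[OF group_BijGroup])
  show "carrier Isom_H4 \<subseteq> carrier (BijGroup H4)"
    by (auto simp: Isom_H4_def BijGroup_def)
  have "(\<lambda>p\<in>H4. p) \<in> carrier Isom_H4" by (simp add: Isom_H4_def id_Bij)
  then show "carrier Isom_H4 \<noteq> {}" by blast
next
  fix f assume f: "f \<in> carrier Isom_H4"
  then have b: "f \<in> Bij H4" by (simp add: Isom_H4_def)
  have "hdist (inv_into H4 f p) (inv_into H4 f q) = hdist p q" if "p \<in> H4" "q \<in> H4" for p q
  proof -
    have "inv_into H4 f p \<in> H4" "inv_into H4 f q \<in> H4"
      using Bij_inv_into_mem[OF b] that by auto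
    moreover have "f (inv_into H4 f p) = p" "f (inv_into H4 f q) = q"
      using b that by (auto simp: Bij_def bij_betw_def intro!: f_inv_into_f)
    ultimately show ?thesis using f by (auto simp: Isom_H4_def) metis
  qed
  then show "inv\<^bsub>BijGroup H4\<^esub> f \<in> carrier Isom_H4"
    using b by (simp add: inv_BijGroup Isom_H4_def restrict_inv_into_Bij)
next
  fix f g assume f: "f \<in> carrier Isom_H4" and g: "g \<in> carrier Isom_H4"
  then have b: "f \<in> Bij H4" "g \<in> Bij H4" by (auto simp: Isom_H4_def)
  then have "g p \<in> H4" if "p \<in> H4" for p using that Bij_imp_funcset by blast
  then show "f \<otimes>\<^bsub>BijGroup H4\<^esub> g \<in> carrier Isom_H4"
    using f g b by (simp add: Isom_H4_def BijGroup_def compose_Bij compose_eq)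
qed

lemma group_Isom: "group Isom_H4"
  using subgroup.subgroup_is_group[OF group_Isom_H4 group_BijGroup] by (simp add: Isom_H4_def)

lemma mult_Isom_H4:
  "f \<in> Bij H4 \<Longrightarrow> g \<in> Bij H4 \<Longrightarrow> f \<otimes>\<^bsub>Isom_H4\<^esub> g = compose H4 f g"
  by (simp add: Isom_H4_def BijGroup_def)

lemma one_Isom_H4: "\<one>\<^bsub>Isom_H4\<^esub> = (\<lambda>p\<in>H4. p)"
  by (simp add: Isom_H4_def BijGroup_def)

text \<open>Stated with an integral over counting measure, so that the sum over the countable group
  can be interchanged with the finite sum over labels and compared with the formula for disjoint
  unions.\<close>

lemma emeasure_UN_le_count_space:
  assumes I: "countable I" and C: "\<And>i. i \<in> I \<Longrightarrow> C i \<in> sets M"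
  shows "emeasure M (\<Union>i\<in>I. C i) \<le> (\<integral>\<^sup>+i. emeasure M (C i) \<partial>count_space I)"
proof -
  let ?f = "to_nat_on I"
  define D where "D n = (if n \<in> ?f ` I then C (from_nat_into I n) else {})" for n
  have "(\<Union>i\<in>I. C i) = (\<Union>n. D n)" using I by (auto simp: D_def split: if_splits)
  also have "emeasure M \<dots> \<le> (\<Sum>n. emeasure M (D n))"
    using I C by (intro emeasure_subadditive_countably) (auto simp: D_def)
  also have "\<dots> = (\<integral>\<^sup>+n. emeasure M (D n) \<partial>count_space UNIV)"
    by (simp add: nn_integral_count_space_nat)
  also have "\<dots> = (\<integral>\<^sup>+n. emeasure M (C (from_nat_into I n)) * indicator (?f ` I) n \<partial>count_space UNIV)"
    by (intro nn_integral_cong) (auto simp: D_def indicator_def)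
  also have "\<dots> = (\<integral>\<^sup>+n. emeasure M (C (from_nat_into I n)) \<partial>count_space (?f ` I))"
    by (subst nn_integral_count_space_indicator) auto
  also have "\<dots> = (\<integral>\<^sup>+i. emeasure M (C (from_nat_into I (?f i))) \<partial>count_space I)"
    using inj_on_to_nat_on[OF I] by (intro nn_integral_bij_count_space[symmetric]) (auto simp: bij_betw_def)
  also have "\<dots> = (\<integral>\<^sup>+i. emeasure M (C i) \<partial>count_space I)"
    using I by (intro nn_integral_cong) auto
  finally show ?thesis .
qed

locale measured_reflection_system = labelled_reflection_system r \<sigma> X x0
  for r :: "'s::finite \<Rightarrow> (real^4) \<times> real" and \<sigma> :: "'s \<Rightarrow> 'x \<Rightarrow> 'x" and X x0 +
  assumes lebesgue_preserving: "f \<in> borel_measurable borel \<Longrightarrow>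
      (LI p. f (reflect (r s) p)) = (LI p. f p)"
begin

abbreviation ract :: "'s list \<Rightarrow> (real^4) \<times> real \<Rightarrow> (real^4) \<times> real" where
  "ract w \<equiv> restrict (act w) H4"

text \<open>One word fixing \<open>x0\<close> is enough: by \<open>act_P_int_trivial\<close> all
  words with the same action on \<open>H4\<close> act alike on the labels.\<close>

definition G :: "((real^4) \<times> real \<Rightarrow> (real^4) \<times> real) set" where
  "G = {ract w |w. sig w x0 = x0}"

lemma act_image_H4: "act w ` H4 = H4"
  using act_H4 act_rev(2) by (metis image_eqI image_subsetI subsetI subset_antisym)

lemma act_image_subset: "A \<subseteq> H4 \<Longrightarrow> act w ` A \<subseteq> H4"
  using act_image_H4 by blast

lemma inj_act: "inj (act w)"
  by (metis act_rev(1) injI)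

lemma ract_Bij: "ract w \<in> Bij H4"
proof -
  have "bij_betw (act w) H4 H4"
    using inj_act[of w] act_image_H4 by (auto simp: bij_betw_def inj_on_def)
  then show ?thesis by (simp add: Bij_def bij_betw_restrict_eq)
qed

lemma ract_Isom: "ract w \<in> carrier Isom_H4"
  using ract_Bij by (simp add: Isom_H4_def hdist_def lorentz_act)

lemma ract_mult: "ract u \<otimes>\<^bsub>Isom_H4\<^esub> ract w = ract (u @ w)"
  by (simp add: mult_Isom_H4 ract_Bij) (auto simp: compose_def act_append act_H4 fun_eq_iff)

lemma ract_inv: "inv\<^bsub>Isom_H4\<^esub> (ract w) = ract (rev w)"
proof -
  interpret group Isom_H4 by (rule group_Isom)
  show ?thesis
  proof (rule inv_equality)
    show "ract (rev w) \<otimes>\<^bsub>Isom_H4\<^esub> ract w = \<one>\<^bsub>Isom_H4\<^esub>"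
      unfolding ract_mult one_Isom_H4 by (auto simp: act_append act_rev)
  qed (rule ract_Isom)+
qed

lemma subgroup_G: "subgroup G Isom_H4"
proof (rule group.subgroupI[OF group_Isom])
  show "G \<subseteq> carrier Isom_H4" by (auto simp: G_def ract_Isom)
  have "ract [] \<in> G" by (force simp: G_def)
  then show "G \<noteq> {}" by blast
next
  fix g assume "g \<in> G"
  then obtain w where w: "g = ract w" "sig w x0 = x0" by (auto simp: G_def)
  then have "sig (rev w) x0 = x0" using sig_rev(1)[OF x0, of w] by simp
  then show "inv\<^bsub>Isom_H4\<^esub> g \<in> G" using w ract_inv by (auto simp: G_def)
next
  fix g h assume "g \<in> G" "h \<in> G"
  then obtain u w where "g = ract u" "sig u x0 = x0" "h = ract w" "sig w x0 = x0" by (auto simp: G_def)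
  then show "g \<otimes>\<^bsub>Isom_H4\<^esub> h \<in> G" using ract_mult by (auto simp: G_def intro!: exI[of _ "u @ w"])
qed

text \<open>Conjugation by a word \<open>u\<close> that brings \<open>q\<close> into
  \<open>P\<close> moves the fixed label from \<open>x0\<close> to \<open>sig u x0\<close>; this is
  why \<open>act_fixed_trivial\<close> treats every label.\<close>

lemma G_free:
  assumes "sig w x0 = x0" "q \<in> H4" "act w q = q"
  shows "act w = id"
proof -
  obtain u where u: "act u q \<in> P" using cover[OF assms(2)] by blast
  let ?v = "u @ w @ rev u"
  have "act ?v (act u q) = act u q" by (simp add: act_append act_rev assms(3))
  moreover have "sig ?v (sig u x0) = sig u x0" by (simp add: sig_rev x0 assms(1))
  ultimately have "act ?v = id" using act_fixed_trivial[OF u, of ?v "sig u x0"] u sig_X[OF x0] by simp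
  then have "act (rev u) (act ?v (act u p)) = p" for p by (simp add: act_rev)
  then have "act w p = p" for p by (simp add: act_append act_rev)
  then show ?thesis by auto
qed

text \<open>The sum of the points of a finite orbit, taken in the ambient linear space, is fixed. It
  is forward timelike because any two points of \<open>H4\<close> have negative product, so a
  multiple of it is a fixed point in \<open>H4\<close> and \<open>G_free\<close> applies.\<close>

lemma torsion_free_G: "torsion_free G"
  unfolding torsion_free_def
proof (intro ballI allI impI)
  fix g and k :: nat assume "g \<in> G" and k: "0 < k" and gk: "g [^]\<^bsub>Isom_H4\<^esub> k = \<one>\<^bsub>Isom_H4\<^esub>"
  then obtain w where w: "g = ract w" "sig w x0 = x0" by (auto simp: G_def)
  interpret group Isom_H4 by (rule group_Isom)
  have pow: "(g [^]\<^bsub>Isom_H4\<^esub> j) p = (act w ^^ j) p" if "p \<in> H4" for j :: nat and p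
  proof -
    have "\<exists>v. g [^]\<^bsub>Isom_H4\<^esub> j = ract v \<and> act v = act w ^^ j" for j :: nat
    proof (induction j)
      case 0
      then show ?case by (intro exI[of _ "[]"]) (auto simp: one_Isom_H4 act_Nil)
    next
      case (Suc j)
      then obtain v where v: "g [^]\<^bsub>Isom_H4\<^esub> j = ract v" "act v = act w ^^ j" by blast
      have "g [^]\<^bsub>Isom_H4\<^esub> Suc j = ract (v @ w)"
        using ract_mult[of v w] by (simp only: nat_pow_Suc v(1)) (simp only: w(1))
      moreover have "act (v @ w) = act v \<circ> act w" by (rule ext) (simp add: act_append)
      ultimately show ?case unfolding funpow_Suc_right v(2) by blast
    qed
    then show ?thesis using that by (metis restrict_apply')
  qed
  obtain p where p: "p \<in> H4" using P_int_nonempty P_int_subset by blast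
  define q where "q j = (act w ^^ j) p" for j
  have qH: "q j \<in> H4" for j using p by (induction j) (auto simp: q_def act_H4)
  have qk: "q k = p" using pow[OF p, of k] gk p by (simp add: q_def one_Isom_H4)
  define S where "S = (\<Sum>j<k. q j)"
  have "act w S = (\<Sum>j<k. q (Suc j))"
    unfolding S_def q_def by (simp add: linear_sum[OF act_linear])
  also have "\<dots> = S"
    using qk sum.lessThan_Suc_shift[of q k] by (simp add: S_def q_def)
  finally have wS: "act w S = S" .
  have S: "snd S > 0" using k qH by (auto simp: S_def snd_sum H4_def intro!: sum_pos)
  have neg: "(\<Sum>j<k. f j) < 0" if "\<And>j. f j < 0" for f :: "nat \<Rightarrow> real"
    using sum_strict_mono[of "{..<k}" f "\<lambda>_. 0"] k that by auto
  have lin: "lorentz v (\<Sum>j<m. q j) = (\<Sum>j<m. lorentz v (q j))" for v m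
  proof (induction m)
    case 0
    then show ?case by (simp add: lorentz_def)
  qed (simp add: lorentz_simps)
  have "lorentz S (q i) < 0" for i
    using lin[of "q i" k] neg[of "\<lambda>j. lorentz (q i) (q j)"] lorentz_H4_neg qH
    by (simp add: S_def lorentz_commute[of _ "q i"])
  then have SS: "lorentz S S < 0" using neg lin[of S k] by (simp add: S_def)
  define c where "c = 1 / sqrt (- lorentz S S)"
  have c: "c > 0" "c\<^sup>2 * lorentz S S = -1" using SS by (simp_all add: c_def power_divide field_simps)
  then have "c *\<^sub>R S \<in> H4" using S by (simp add: H4_def lorentz_simps power2_eq_square)
  moreover have "act w (c *\<^sub>R S) = c *\<^sub>R S" using wS by (simp add: linear_scale[OF act_linear])
  ultimately have "act w = id" using G_free w(2) by blast
  then show "g = \<one>\<^bsub>Isom_H4\<^esub>" by (auto simp: w(1) one_Isom_H4)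
qed

lemma open_P_int: "openin (top_of_set H4) P_int"
proof -
  have "P_int = H4 \<inter> (\<Inter>s. {p. 0 < lorentz p (r s)})" by (auto simp: P_int_def)
  moreover have "open (\<Inter>s. {p. 0 < lorentz p (r s)})"
    unfolding lorentz_def by (intro open_INT ballI open_Collect_less continuous_intros) simp_all
  ultimately show ?thesis by (metis openin_open_Int)
qed

text \<open>For an interior point \<open>p\<close> of \<open>P\<close>, the only element of
  \<open>G\<close> that takes \<open>p\<close> into the open tile containing \<open>g p\<close> is
  \<open>g\<close>. Evaluation at \<open>p\<close> is continuous for pointwise convergence, so this
  condition is open.\<close>

lemma discrete_G: "subtopology Isom_H4_topology G = discrete_topology G"
proof -
  have sub: "G \<subseteq> carrier Isom_H4" using subgroup_G subgroup.subset by blast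
  have top: "topspace Isom_H4_topology = carrier Isom_H4"
    by (auto simp: Isom_H4_topology_def topspace_subtopology Isom_H4_def Bij_def bij_betw_def PiE_def Pi_def)
  have st: "openin (subtopology Isom_H4_topology G) {g}" if gG: "g \<in> G" for g
  proof -
    obtain w where w: "g = ract w" "sig w x0 = x0" using gG by (auto simp: G_def)
    obtain p where p: "p \<in> P_int" using P_int_nonempty by blast
    then have pH: "p \<in> H4" using P_int_subset by blast
    define N where "N = H4 \<inter> act (rev w) -` P_int"
    have N: "openin (top_of_set H4) N"
      unfolding N_def
    proof (rule continuous_openin_preimage[OF _ _ open_P_int])
      show "continuous_on H4 (act (rev w))"
        using act_linear by (simp add: linear_continuous_on linear_conv_bounded_linear)
    qed (simp add: act_H4)
    have cm: "continuous_map (product_topology (\<lambda>_. top_of_set H4) H4) (top_of_set H4) (\<lambda>f. f p)"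
      by (rule continuous_map_product_projection[OF pH])
    have "openin (product_topology (\<lambda>_. top_of_set H4) H4)
        {f \<in> topspace (product_topology (\<lambda>_. top_of_set H4) H4). f p \<in> N}"
      by (rule openin_continuous_map_preimage[OF cm N])
    then have "openin (subtopology Isom_H4_topology G)
        ({f \<in> topspace (product_topology (\<lambda>_. top_of_set H4) H4). f p \<in> N} \<inter> carrier Isom_H4 \<inter> G)"
      unfolding Isom_H4_topology_def by (auto simp: openin_subtopology)
    moreover have "{f \<in> topspace (product_topology (\<lambda>_. top_of_set H4) H4). f p \<in> N} \<inter> carrier Isom_H4 \<inter> G = {g}"
    proof (intro equalityI subsetI)
      fix f assume f: "f \<in> {f \<in> topspace (product_topology (\<lambda>_. top_of_set H4) H4). f p \<in> N} \<inter> carrier Isom_H4 \<inter> G"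
      then obtain u where u: "f = ract u" by (auto simp: G_def)
      have "act (rev w @ u) p \<in> P_int" using f pH by (simp add: u N_def act_append)
      then have "act (rev w @ u) = id" using act_P_int_trivial[OF p] by blast
      then have "act w (act (rev w) (act u q)) = act w q" for q by (metis act_append id_apply)
      then have "act u = act w" by (simp add: act_rev fun_eq_iff)
      then show "f \<in> {g}" by (simp add: u w(1))
    next
      fix f assume "f \<in> {g}"
      moreover have "g p \<in> N" using p pH w by (simp add: N_def act_H4 act_rev)
      moreover have "g \<in> topspace (product_topology (\<lambda>_. top_of_set H4) H4)"
        using w act_H4 by auto
      ultimately show "f \<in> {f \<in> topspace (product_topology (\<lambda>_. top_of_set H4) H4). f p \<in> N} \<inter> carrier Isom_H4 \<inter> G"
        using gG sub by auto
    qed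
    ultimately show ?thesis by simp
  qed
  have "discrete_topology G = subtopology Isom_H4_topology G"
    using st top sub by (subst discrete_topology_unique) (auto simp: topspace_subtopology)
  then show ?thesis by simp
qed

lemma complete_manifold: "complete_hyperbolic_4_manifold (orbit_space G)"
  unfolding complete_hyperbolic_4_manifold_def discrete_subgroup_def
  using subgroup_G discrete_G torsion_free_G by blast

section \<open>The covolume of the group\<close>

lemma P_measurable [measurable]: "P \<in> sets borel" "P_int \<in> sets borel"
  unfolding P_def P_int_def by measurable

lemma act_hyp_measure:
  assumes "A \<in> sets borel" "A \<subseteq> H4"
  shows "emeasure hyp_measure (act w ` A) = emeasure hyp_measure A \<and> act w ` A \<in> sets borel"
proof (induction w)
  case (Cons s w)
  have "act w ` A \<subseteq> H4" using assms(2) act_H4 by auto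
  moreover have "act (s # w) ` A = reflect (r s) ` act w ` A" by (auto simp: image_image)
  ultimately show ?case
    using hyp_measure_reflect[of "act w ` A" "r s"] lebesgue_preserving norm1 Cons by simp
qed (use assms in \<open>simp add: act_Nil\<close>)

lemma hyp_measure_P: "emeasure hyp_measure P = emeasure hyp_measure P_int"
proof (rule antisym)
  have "P \<subseteq> P_int \<union> (\<Union>s. {p \<in> H4. lorentz p (r s) = 0})"
    by (auto simp: P_def P_int_def less_le)
  then have "emeasure hyp_measure P \<le> emeasure hyp_measure (P_int \<union> (\<Union>s. {p \<in> H4. lorentz p (r s) = 0}))"
    by (intro emeasure_mono) (auto simp del: UN_simps)
  also have "\<dots> \<le> emeasure hyp_measure P_int + emeasure hyp_measure (\<Union>s. {p \<in> H4. lorentz p (r s) = 0})"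
    by (intro emeasure_subadditive) auto
  also have "emeasure hyp_measure (\<Union>s. {p \<in> H4. lorentz p (r s) = 0}) \<le>
      (\<Sum>s\<in>UNIV. emeasure hyp_measure {p \<in> H4. lorentz p (r s) = 0})"
    by (intro emeasure_subadditive_finite) auto
  also have "\<dots> = 0"
  proof (intro sum.neutral ballI hyp_measure_hyperplane)
    show "r s \<noteq> 0" for s using norm1[of s] by (auto simp: lorentz_def)
  qed
  finally show "emeasure hyp_measure P \<le> emeasure hyp_measure P_int" by (simp add: add_left_mono)
qed (intro emeasure_mono, simp_all add: P_int_subset)

definition rep :: "'x \<Rightarrow> 's list" where
  "rep x = (SOME w. sig w x0 = x)"

lemma sig_rep: "x \<in> X \<Longrightarrow> sig (rep x) x0 = x"
  unfolding rep_def by (rule someI_ex[OF \<sigma>_transitive])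

text \<open>The tiles \<open>act (rev (rep x)) P\<close>, one for each label \<open>x\<close>, form a fundamental domain of \<open>G\<close>.\<close>

lemma tile_overlap:
  assumes xy: "x \<in> X" "y \<in> X" and w: "sig w x0 = x0"
    and p: "p \<in> P_int" "p' \<in> P_int" "act w (act (rev (rep x)) p) = act (rev (rep y)) p'"
  shows "x = y \<and> act (rev (rep x)) p = act (rev (rep y)) p'"
proof -
  let ?v = "rep y @ w @ rev (rep x)"
  have "act ?v p = p'" using p(3) by (simp add: act_append act_rev)
  then have *: "act ?v = id" "sig ?v x = x" using act_P_int_trivial[OF p(1), of ?v] p(2) xy by auto
  have "sig (rev (rep x)) x = x0" using sig_rev(1)[OF x0, of "rep x"] sig_rep xy by simp
  then have "y = x" using *(2) w sig_rep xy by simp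
  moreover have "p' = p" using * \<open>act ?v p = p'\<close> by simp
  ultimately show ?thesis by simp
qed

text \<open>A set \<open>A\<close> meeting each orbit at most once is cut into pieces, each carried
  into \<open>P\<close> by an element of \<open>G\<close> followed by the word of a label. For a
  fixed label the images are disjoint, since a common point would come from two points of one orbit;
  so each label accounts for at most the volume of \<open>P\<close>.\<close>

lemma hyp_volume_le: "hyp_volume (orbit_space G) \<le> of_nat (card X) * emeasure hyp_measure P"
  unfolding hyp_volume_def
proof (rule SUP_least)
  fix A assume "A \<in> {A \<in> sets borel. A \<subseteq> H4 \<and> (\<forall>S\<in>orbit_space G. \<forall>p\<in>A \<inter> S. \<forall>q\<in>A \<inter> S. p = q)}"
  then have A[measurable]: "A \<in> sets borel" and AH: "A \<subseteq> H4"
    and uniq: "\<And>S p q. S \<in> orbit_space G \<Longrightarrow> p \<in> A \<inter> S \<Longrightarrow> q \<in> A \<inter> S \<Longrightarrow> p = q" by blast+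
  have countable_G: "countable G"
  proof -
    have "G \<subseteq> range ract" by (auto simp: G_def)
    then show ?thesis by (rule countable_subset) simp
  qed
  define wd where "wd g = (SOME w. g = ract w \<and> sig w x0 = x0)" for g
  have wd: "g = ract (wd g)" "sig (wd g) x0 = x0" if "g \<in> G" for g
    using someI_ex[of "\<lambda>w. g = ract w \<and> sig w x0 = x0"] that unfolding wd_def G_def by blast+
  define B where "B x g = act (rep x) ` act (wd g) ` A \<inter> P" for x g
  have wA: "act (rep x) ` act (wd g) ` A \<subseteq> H4" for x g using AH act_H4 by blast
  have Bm[measurable]: "B x g \<in> sets borel" for x g
    unfolding B_def using act_hyp_measure[OF A AH] act_hyp_measure[of "act (wd g) ` A" "rep x"]
      act_image_subset[OF AH] by (intro sets.Int) auto
  have tile: "A \<subseteq> (\<Union>g\<in>G. \<Union>x\<in>X. act (rev (wd g)) ` act (rev (rep x)) ` B x g)"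
  proof
    fix q assume q: "q \<in> A"
    then obtain u where u: "act u q \<in> P" using cover AH by blast
    \<comment> \<open>For this label the representative word, cancelled from \<open>u\<close>,
      leaves a word that fixes \<open>x0\<close>.\<close>
    define x where "x = sig u x0"
    have x: "x \<in> X" using sig_X[OF x0] by (simp add: x_def)
    let ?w = "rev (rep x) @ u"
    have "sig (rev (rep x)) x = x0" using sig_rev(1)[OF x0, of "rep x"] sig_rep x by simp
    then have "sig ?w x0 = x0" by (simp add: x_def)
    then have g: "ract ?w \<in> G" by (auto simp: G_def)
    define g where "g = ract ?w"
    have gG: "g \<in> G" using g by (simp add: g_def)
    have "ract (wd g) q = ract ?w q" using wd(1)[OF gG] by (simp add: g_def)
    then have eq: "act (wd g) q = act ?w q" using q AH by auto
    have "act (rep x) (act (wd g) q) = act u q" by (simp add: eq act_append act_rev)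
    then have "act (rep x) (act (wd g) q) \<in> B x g"
      using q u unfolding B_def by (metis IntI imageI)
    moreover have "act (rev (wd g)) (act (rev (rep x)) (act (rep x) (act (wd g) q))) = q" by (simp add: act_rev)
    ultimately have "q \<in> act (rev (wd g)) ` act (rev (rep x)) ` B x g" by (metis imageI)
    then show "q \<in> (\<Union>g\<in>G. \<Union>x\<in>X. act (rev (wd g)) ` act (rev (rep x)) ` B x g)" using gG x by blast
  qed
  have BH: "B x g \<subseteq> H4" for x g using P_int_subset by (auto simp: B_def)
  have m1: "act (rev (wd g)) ` act (rev (rep x)) ` B x g \<in> sets borel"
      "emeasure hyp_measure (act (rev (wd g)) ` act (rev (rep x)) ` B x g) = emeasure hyp_measure (B x g)" for x g
  proof -
    have H: "act (rev (rep x)) ` B x g \<subseteq> H4" using BH act_H4 by blast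
    note * = act_hyp_measure[OF Bm BH, of "rev (rep x)" x g]
    show "act (rev (wd g)) ` act (rev (rep x)) ` B x g \<in> sets borel"
      "emeasure hyp_measure (act (rev (wd g)) ` act (rev (rep x)) ` B x g) = emeasure hyp_measure (B x g)"
      using act_hyp_measure[OF _ H, of "rev (wd g)"] * by auto
  qed
  have disj: "disjoint_family_on (B x) G" for x
  unfolding disjoint_family_on_def
  proof (intro ballI impI)
    fix g h assume gh: "g \<in> G" "h \<in> G" "g \<noteq> h"
    show "B x g \<inter> B x h = {}"
    proof (rule ccontr)
      assume "B x g \<inter> B x h \<noteq> {}"
      then obtain z where "z \<in> B x g" "z \<in> B x h" by blast
      then obtain a b where ab': "a \<in> A" "b \<in> A" "z = act (rep x) (act (wd g) a)" "z = act (rep x) (act (wd h) b)"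
        unfolding B_def by blast
      then have ab: "a \<in> A" "b \<in> A" "act (rep x) (act (wd g) a) = act (rep x) (act (wd h) b)" by simp_all
      then have e: "act (wd g) a = act (wd h) b" by (metis act_rev(1))
      then have e': "act (rev (wd h) @ wd g) a = b" by (simp add: act_append act_rev)
      have sg: "sig (rev (wd h) @ wd g) x0 = x0"
        using wd(2) gh sig_rev(1)[OF x0, of "wd h"] by simp
      have "a = b"
      proof (rule uniq)
        show "(\<lambda>g. g a) ` G \<in> orbit_space G" using ab AH by (auto simp: orbit_space_def)
        have "ract [] \<in> G" by (force simp: G_def)
        moreover have "ract [] a = a" using ab AH by auto
        ultimately show "a \<in> A \<inter> (\<lambda>g. g a) ` G" using ab by (metis IntI image_eqI)
        have "ract (rev (wd h) @ wd g) \<in> G" using sg by (auto simp: G_def)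
        moreover have "ract (rev (wd h) @ wd g) a = b" using ab AH e' by auto
        ultimately show "b \<in> A \<inter> (\<lambda>g. g a) ` G" using ab by (metis (no_types, lifting) IntI image_eqI)
      qed
      \<comment> \<open>Once \<open>a = b\<close>, the word fixes a point of \<open>H4\<close>, and
        freeness of the action identifies \<open>g\<close> with \<open>h\<close>.\<close>
      then have "act (rev (wd h) @ wd g) = id" using G_free[OF sg] e' ab AH by blast
      then have "act (wd h) (act (rev (wd h)) (act (wd g) q)) = act (wd h) q" for q
        by (metis act_append id_apply)
      then have "act (wd g) = act (wd h)" by (auto simp: act_rev)
      then show False using wd(1) gh by metis
    qed
  qed
  have Bx: "(\<integral>\<^sup>+g. emeasure hyp_measure (B x g) \<partial>count_space G) \<le> emeasure hyp_measure P" for x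
  proof -
    have "(\<integral>\<^sup>+g. emeasure hyp_measure (B x g) \<partial>count_space G) = emeasure hyp_measure (\<Union>g\<in>G. B x g)"
      using emeasure_UN_countable[of G "B x" hyp_measure] countable_G disj by simp
    also have "\<dots> \<le> emeasure hyp_measure P"
      using countable_G by (intro emeasure_mono) (auto simp: B_def)
    finally show ?thesis .
  qed
  have "emeasure hyp_measure A \<le> emeasure hyp_measure (\<Union>g\<in>G. \<Union>x\<in>X. act (rev (wd g)) ` act (rev (rep x)) ` B x g)"
    using tile countable_G finite_X by (intro emeasure_mono) (auto intro!: sets.countable_UN'' m1 simp: countable_finite)
  also have "\<dots> \<le> (\<integral>\<^sup>+g. emeasure hyp_measure (\<Union>x\<in>X. act (rev (wd g)) ` act (rev (rep x)) ` B x g) \<partial>count_space G)"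
    using countable_G finite_X m1 by (intro emeasure_UN_le_count_space) auto
  also have "\<dots> \<le> (\<integral>\<^sup>+g. (\<Sum>x\<in>X. emeasure hyp_measure (B x g)) \<partial>count_space G)"
    using finite_X by (intro nn_integral_mono order_trans[OF emeasure_subadditive_finite]) (auto simp: m1)
  also have "\<dots> = (\<Sum>x\<in>X. \<integral>\<^sup>+g. emeasure hyp_measure (B x g) \<partial>count_space G)"
    by (intro nn_integral_sum) simp
  also have "\<dots> \<le> (\<Sum>x\<in>X. emeasure hyp_measure P)" by (intro sum_mono Bx)
  finally show "emeasure hyp_measure A \<le> of_nat (card X) * emeasure hyp_measure P" by simp
qed

text \<open>The union of the open tiles competes in the supremum. Closed tiles would not do, since
  boundary points of them may lie in a common orbit.\<close>

lemma hyp_volume_ge: "of_nat (card X) * emeasure hyp_measure P_int \<le> hyp_volume (orbit_space G)"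
proof -
  define T where "T x = act (rev (rep x)) ` P_int" for x
  have T: "T x \<in> sets borel" "emeasure hyp_measure (T x) = emeasure hyp_measure P_int" for x
    using act_hyp_measure[OF P_measurable(2) P_int_subset(3)] by (auto simp: T_def)
  have "disjoint_family_on T X"
  unfolding disjoint_family_on_def
  proof (intro ballI impI)
    fix x y assume "x \<in> X" "y \<in> X" "x \<noteq> y"
    moreover have False if "a \<in> P_int" "b \<in> P_int" "act (rev (rep x)) a = act (rev (rep y)) b" for a b
      using tile_overlap[of x y "[]" a b] that calculation by simp
    ultimately show "T x \<inter> T y = {}" unfolding T_def by blast
  qed
  then have "(\<Sum>x\<in>X. emeasure hyp_measure (T x)) = emeasure hyp_measure (\<Union>x\<in>X. T x)"
    using finite_X T by (intro sum_emeasure) auto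
  then have "of_nat (card X) * emeasure hyp_measure P_int = emeasure hyp_measure (\<Union>x\<in>X. T x)"
    by (simp add: T)
  also have "\<dots> \<le> hyp_volume (orbit_space G)"
    unfolding hyp_volume_def
  proof (rule SUP_upper, intro CollectI conjI ballI)
    show "(\<Union>x\<in>X. T x) \<in> sets borel" using finite_X T by auto
    show "(\<Union>x\<in>X. T x) \<subseteq> H4"
      unfolding T_def using act_image_subset[OF P_int_subset(3)] by blast
    fix S p q assume S: "S \<in> orbit_space G" and "p \<in> (\<Union>x\<in>X. T x) \<inter> S" "q \<in> (\<Union>x\<in>X. T x) \<inter> S"
    then obtain x y where pq: "x \<in> X" "y \<in> X" "p \<in> T x" "p \<in> S" "q \<in> T y" "q \<in> S" by blast
    from S pq obtain a u v where a: "a \<in> H4" "sig u x0 = x0" "sig v x0 = x0" "p = ract u a" "q = ract v a"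
      by (auto simp: orbit_space_def G_def)
    have "act (v @ rev u) p = q" using a by (simp add: act_append act_rev)
    moreover have "sig (v @ rev u) x0 = x0" using a sig_rev(1)[OF x0, of u] by simp
    moreover obtain b c where "b \<in> P_int" "p = act (rev (rep x)) b" "c \<in> P_int" "q = act (rev (rep y)) c"
      using pq unfolding T_def by blast
    ultimately show "p = q" using tile_overlap[of x y "v @ rev u" b c] pq by metis
  qed
  finally show ?thesis .
qed

theorem hyp_volume_eq: "hyp_volume (orbit_space G) = of_nat (card X) * emeasure hyp_measure P"
  using hyp_volume_le hyp_volume_ge by (simp add: hyp_measure_P antisym)

end

section \<open>The concrete reflection system\<close>

text \<open>As an edge of \<open>K\<^sub>5\<close>, the wall \<open>Xi\<close> is \<open>{i, 5}\<close> and the wall \<open>Yij\<close> is the complement of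
  \<open>{i, j}\<close> in \<open>{1, 2, 3, 4}\<close>.\<close>

datatype wall = X1 | X2 | X3 | X4 | Y12 | Y13 | Y14 | Y23 | Y24 | Y34

instance wall :: finite
proof
  have "UNIV = {X1, X2, X3, X4, Y12, Y13, Y14, Y23, Y24, Y34}"
    using wall.exhaust by blast
  then show "finite (UNIV :: wall set)" by (metis finite.emptyI finite.insertI)
qed

abbreviation vec4 :: "real \<Rightarrow> real \<Rightarrow> real \<Rightarrow> real \<Rightarrow> real^4" where
  "vec4 a b c d \<equiv> (\<chi> i. if i = 1 then a else if i = 2 then b else if i = 3 then c else d)"

fun pt :: "real \<Rightarrow> real \<Rightarrow> real \<Rightarrow> real \<Rightarrow> real \<Rightarrow> (real^4) \<times> real" where
  "pt a b c d t = (vec4 a b c d, t)"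

fun root :: "wall \<Rightarrow> (real^4) \<times> real" where
  "root X1 = pt 1 0 0 0 0"
| "root X2 = pt 0 1 0 0 0"
| "root X3 = pt 0 0 1 0 0"
| "root X4 = pt 0 0 0 1 0"
| "root Y12 = pt (-1) (-1) 0 0 (-1)"
| "root Y13 = pt (-1) 0 (-1) 0 (-1)"
| "root Y14 = pt (-1) 0 0 (-1) (-1)"
| "root Y23 = pt 0 (-1) (-1) 0 (-1)"
| "root Y24 = pt 0 (-1) 0 (-1) (-1)"
| "root Y34 = pt 0 0 (-1) (-1) (-1)"

lemma pt_cases: obtains a b c d t where "p = pt a b c d t"
proof
  show "p = pt (fst p $ 1) (fst p $ 2) (fst p $ 3) (fst p $ 4) (snd p)"
    by (simp add: prod_eq_iff vec_eq_iff forall_4)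
qed

lemma lorentz_pt: "lorentz (pt a b c d t) (pt a' b' c' d' t') = a*a' + b*b' + c*c' + d*d' - t*t'"
  by (simp add: lorentz_def inner_vec_def sum_4)

lemma pt_H4: "pt a b c d t \<in> H4 \<longleftrightarrow> a*a + b*b + c*c + d*d - t*t = -1 \<and> 0 < t"
  unfolding H4_def mem_Collect_eq lorentz_pt by simp

declare pt.simps [simp del]

lemma norm_root: "lorentz (root s) (root s) = 1"
  by (cases s) (simp_all add: lorentz_pt)

text \<open>These are the sums in \<open>disj\<close>: a root \<open>Xi\<close> and a root
  \<open>Yij\<close> give \<open>t\<close> minus one coordinate, and two complementary roots such as
  \<open>Y12\<close> and \<open>Y34\<close> give \<open>2 * t\<close> minus the sum of all
  coordinates.\<close>

lemma H4_coord_less: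
  assumes "pt a b c d t \<in> H4"
  shows "\<bar>a\<bar> < t" "\<bar>b\<bar> < t" "\<bar>c\<bar> < t" "\<bar>d\<bar> < t" "a + b + c + d < 2 * t"
proof -
  have e: "a\<^sup>2 + b\<^sup>2 + c\<^sup>2 + d\<^sup>2 + 1 = t\<^sup>2" "0 < t"
    using assms by (simp_all add: pt_H4 power2_eq_square)
  have sq: "0 \<le> a\<^sup>2" "0 \<le> b\<^sup>2" "0 \<le> c\<^sup>2" "0 \<le> d\<^sup>2" by simp_all
  have "a\<^sup>2 < t\<^sup>2" "b\<^sup>2 < t\<^sup>2" "c\<^sup>2 < t\<^sup>2" "d\<^sup>2 < t\<^sup>2" using e(1) sq by linarith+
  then show "\<bar>a\<bar> < t" "\<bar>b\<bar> < t" "\<bar>c\<bar> < t" "\<bar>d\<bar> < t"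
    using e(2) power2_less_imp_less[of "\<bar>_\<bar>" t] by simp_all
  \<comment> \<open>The defect in the Cauchy-Schwarz inequality for \<open>(a, b, c, d)\<close> and
    \<open>(1, 1, 1, 1)\<close>.\<close>
  define X where "X = (a-b)\<^sup>2 + (a-c)\<^sup>2 + (a-d)\<^sup>2 + (b-c)\<^sup>2 + (b-d)\<^sup>2 + (c-d)\<^sup>2"
  have "0 \<le> X" unfolding X_def by (intro add_nonneg_nonneg zero_le_power2)
  moreover have "(a + b + c + d)\<^sup>2 + X = 4 * (a\<^sup>2 + b\<^sup>2 + c\<^sup>2 + d\<^sup>2)"
    by (simp add: X_def power2_eq_square algebra_simps)
  ultimately have "(a + b + c + d)\<^sup>2 < 4 * t\<^sup>2" unfolding e(1)[symmetric] by simp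
  then have "(a + b + c + d)\<^sup>2 < (2 * t)\<^sup>2" by (simp add: power_mult_distrib)
  then show "a + b + c + d < 2 * t" using e(2) by (intro power2_less_imp_less[of _ "2 * t"]) auto
qed

lemma root_disj:
  assumes "s \<noteq> t" "lorentz (root s) (root t) \<noteq> 0"
  shows "lorentz (root s) (root t) = -1 \<and> (\<forall>p\<in>H4. 0 < lorentz p (root s) + lorentz p (root t))"
proof (intro conjI ballI)
  show "lorentz (root s) (root t) = -1"
    using assms by (cases s; cases t) (simp_all add: lorentz_pt)
  fix p assume "p \<in> H4"
  moreover obtain a b c d u where p: "p = pt a b c d u" by (rule pt_cases)
  ultimately have "pt a b c d u \<in> H4" by simp
  then have "a < u" "b < u" "c < u" "d < u" "a + b + c + d < 2 * u"
    using H4_coord_less[of a b c d u] by (simp_all add: abs_less_iff)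
  then show "0 < lorentz p (root s) + lorentz p (root t)"
    using assms unfolding p by (cases s; cases t) (simp_all add: lorentz_pt)
qed

text \<open>Labels are elements of a cycle of even length \<open>N\<close> together with three bits. The wall \<open>Y34\<close>
  and the walls \<open>Y12\<close>, \<open>X3\<close>, \<open>X4\<close> act on the cycle by the two reflections that generate the
  dihedral group; \<open>Y34\<close> commutes with none of the other three, so this respects all commutation
  relations.\<close>

type_synonym label = "int \<times> bool \<times> bool \<times> bool"

text \<open>\<open>flipA\<close> and \<open>flipB\<close> match each position with one or the other
  of its neighbours on the cycle. Each reverses parity when \<open>N\<close> is even, which makes
  the parity of the position a fourth bit.\<close>

definition flipA :: "int \<Rightarrow> int \<Rightarrow> int" where
  "flipA N j = (if even j then (j + 1) mod N else (j - 1) mod N)"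

definition flipB :: "int \<Rightarrow> int \<Rightarrow> int" where
  "flipB N j = (if even j then (j - 1) mod N else (j + 1) mod N)"

text \<open>With the parity of the position as first bit, each wall adds a fixed vector of
  \<open>(Z/2)^4\<close>. The vectors are chosen so that the four edges at each vertex of
  \<open>K5\<close>, and the three edges of each triangle, receive independent vectors;
  \<open>Y34\<close>, \<open>Y24\<close>, \<open>Y23\<close>, \<open>X1\<close> receive the standard
  basis.\<close>

fun step :: "int \<Rightarrow> wall \<Rightarrow> label \<Rightarrow> label" where
  "step N Y34 (j, x, y, z) = (flipA N j, x, y, z)"
| "step N Y12 (j, x, y, z) = (flipB N j, x, y, z)"
| "step N X3 (j, x, y, z) = (flipB N j, x, y, \<not> z)"
| "step N X4 (j, x, y, z) = (flipB N j, \<not> x, \<not> y, z)"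
| "step N Y24 (j, x, y, z) = (j, \<not> x, y, z)"
| "step N Y23 (j, x, y, z) = (j, x, \<not> y, z)"
| "step N X1 (j, x, y, z) = (j, x, y, \<not> z)"
| "step N Y14 (j, x, y, z) = (j, x, \<not> y, z)"
| "step N Y13 (j, x, y, z) = (j, x, y, \<not> z)"
| "step N X2 (j, x, y, z) = (j, \<not> x, y, z)"

definition labels :: "int \<Rightarrow> label set" where
  "labels N = {0..<N} \<times> UNIV"

lemma flip_flip:
  assumes "even N" "0 \<le> j" "j < N"
  shows "flipA N (flipA N j) = j" "flipB N (flipB N j) = j"
  using assms by (auto simp: flipA_def flipB_def mod_simps dvd_mod_iff)

lemma flip_parity:
  assumes "even N"
  shows "even (flipA N j) \<longleftrightarrow> odd j" "even (flipB N j) \<longleftrightarrow> odd j"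
  using assms by (auto simp: flipA_def flipB_def dvd_mod_iff)

lemma step_labels: "0 < N \<Longrightarrow> x \<in> labels N \<Longrightarrow> step N s x \<in> labels N"
  by (cases x; cases s) (auto simp: labels_def flipA_def flipB_def)

lemma step_invol: "even N \<Longrightarrow> x \<in> labels N \<Longrightarrow> step N s (step N s x) = x"
  by (cases x; cases s) (auto simp: labels_def flip_flip)

lemma step_com:
  assumes "lorentz (root s) (root t) = 0"
  shows "step N s (step N t x) = step N t (step N s x)"
  using assms by (cases x; cases s; cases t) (simp_all add: lorentz_pt)

definition lbit :: "nat \<Rightarrow> label \<Rightarrow> bool" where
  "lbit k x = (case x of (j, b1, b2, b3) \<Rightarrow> [odd j, b1, b2, b3] ! k)"

text \<open>The table of \<open>step\<close> transposed: the walls that change bit \<open>k\<close>,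
  with parity as bit 0.\<close>

definition code :: "nat \<Rightarrow> wall set" where
  "code k = [{Y34, Y12, X3, X4}, {X4, Y24, X2}, {X4, Y23, Y14}, {X3, X1, Y13}] ! k"

lemma less_4_cases: "k < 4 \<Longrightarrow> k = 0 \<or> k = 1 \<or> k = 2 \<or> k = (3::nat)"
  by linarith

lemma lbit_step:
  assumes "even N" "k < 4"
  shows "lbit k (step N s x) \<longleftrightarrow> (lbit k x \<longleftrightarrow> s \<notin> code k)"
  using assms(1) less_4_cases[OF assms(2)]
  by (cases x; cases s) (auto simp: lbit_def code_def flip_parity numeral_2_eq_2 numeral_3_eq_3)

lemma lbit_foldr:
  assumes "even N" "k < 4"
  shows "distinct w \<Longrightarrow> lbit k (foldr (step N) w x) \<longleftrightarrow>
    (lbit k x \<longleftrightarrow> even (\<Sum>s\<in>set w. (if s \<in> code k then 1 else 0) :: nat))"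
  by (induction w) (auto simp: lbit_step[OF assms])

lemma UNIV_wall: "UNIV = {X1, X2, X3, X4, Y12, Y13, Y14, Y23, Y24, Y34}"
  using wall.exhaust by blast

lemma even_if: "even (if b then 1 else 0 :: nat) \<longleftrightarrow> \<not> b"
  by simp

text \<open>Linear independence of the vectors of pairwise commuting walls, reduced to propositional
  logic in ten membership statements with four parity conditions.\<close>

lemma clique_code:
  assumes orth: "\<And>s t. s \<in> A \<Longrightarrow> t \<in> A \<Longrightarrow> s \<noteq> t \<Longrightarrow> lorentz (root s) (root t) = 0"
    and ev: "\<And>k. k < 4 \<Longrightarrow> even (\<Sum>s\<in>A. (if s \<in> code k then 1 else 0) :: nat)"
  shows "A = {}"
proof -
  have "(\<Sum>s\<in>A. (if s \<in> B then 1 else 0) :: nat) = (\<Sum>s\<in>UNIV. (if s \<in> A \<and> s \<in> B then 1 else 0))" for B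
    by (rule sum.mono_neutral_cong_left) auto
  then have E: "even (\<Sum>s\<in>UNIV. (if s \<in> A \<and> s \<in> code k then 1 else 0) :: nat)" if "k < 4" for k
    using ev[OF that] by simp
  have q0: "(\<Sum>s\<in>UNIV. (if s \<in> A \<and> s \<in> code 0 then 1 else 0) :: nat) = (if X3 \<in> A then 1 else 0) + (if X4 \<in> A then 1 else 0) + (if Y12 \<in> A then 1 else 0) + (if Y34 \<in> A then 1 else 0)"
    by (simp add: UNIV_wall code_def)
  have e0: "even ((if X3 \<in> A then 1 else 0) + (if X4 \<in> A then 1 else 0) + (if Y12 \<in> A then 1 else 0) + (if Y34 \<in> A then 1 else 0) :: nat)" by (subst q0[symmetric], rule E) simp
  have q1: "(\<Sum>s\<in>UNIV. (if s \<in> A \<and> s \<in> code 1 then 1 else 0) :: nat) = (if X2 \<in> A then 1 else 0) + (if X4 \<in> A then 1 else 0) + (if Y24 \<in> A then 1 else 0)"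
    by (simp add: UNIV_wall code_def)
  have e1: "even ((if X2 \<in> A then 1 else 0) + (if X4 \<in> A then 1 else 0) + (if Y24 \<in> A then 1 else 0) :: nat)" by (subst q1[symmetric], rule E) simp
  have q2: "(\<Sum>s\<in>UNIV. (if s \<in> A \<and> s \<in> code 2 then 1 else 0) :: nat) = (if X4 \<in> A then 1 else 0) + (if Y14 \<in> A then 1 else 0) + (if Y23 \<in> A then 1 else 0)"
    by (simp add: UNIV_wall code_def)
  have e2: "even ((if X4 \<in> A then 1 else 0) + (if Y14 \<in> A then 1 else 0) + (if Y23 \<in> A then 1 else 0) :: nat)" by (subst q2[symmetric], rule E) simp
  have q3: "(\<Sum>s\<in>UNIV. (if s \<in> A \<and> s \<in> code 3 then 1 else 0) :: nat) = (if X1 \<in> A then 1 else 0) + (if X3 \<in> A then 1 else 0) + (if Y13 \<in> A then 1 else 0)"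
    by (simp add: UNIV_wall code_def)
  have e3: "even ((if X1 \<in> A then 1 else 0) + (if X3 \<in> A then 1 else 0) + (if Y13 \<in> A then 1 else 0) :: nat)" by (subst q3[symmetric], rule E) simp
  have nn: "\<not> (s \<in> A \<and> t \<in> A)" if "lorentz (root s) (root t) \<noteq> 0" "s \<noteq> t" for s t
    using orth that by blast
  \<comment> \<open>The fifteen pairs of disjoint edges of \<open>K5\<close>.\<close>
  have n: "\<not> (X1 \<in> A \<and> Y12 \<in> A)" "\<not> (X1 \<in> A \<and> Y13 \<in> A)" "\<not> (X1 \<in> A \<and> Y14 \<in> A)"
    "\<not> (X2 \<in> A \<and> Y12 \<in> A)" "\<not> (X2 \<in> A \<and> Y23 \<in> A)" "\<not> (X2 \<in> A \<and> Y24 \<in> A)"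
    "\<not> (X3 \<in> A \<and> Y13 \<in> A)" "\<not> (X3 \<in> A \<and> Y23 \<in> A)" "\<not> (X3 \<in> A \<and> Y34 \<in> A)"
    "\<not> (X4 \<in> A \<and> Y14 \<in> A)" "\<not> (X4 \<in> A \<and> Y24 \<in> A)" "\<not> (X4 \<in> A \<and> Y34 \<in> A)"
    "\<not> (Y12 \<in> A \<and> Y34 \<in> A)" "\<not> (Y13 \<in> A \<and> Y24 \<in> A)" "\<not> (Y14 \<in> A \<and> Y23 \<in> A)"
    by (rule nn, simp add: lorentz_pt, simp)+
  have "X1 \<notin> A \<and> X2 \<notin> A \<and> X3 \<notin> A \<and> X4 \<notin> A \<and> Y12 \<notin> A \<and> Y13 \<notin> A \<and> Y14 \<notin> A \<and> Y23 \<notin> A \<and> Y24 \<notin> A \<and> Y34 \<notin> A"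
    using e0 e1 e2 e3 n unfolding even_add even_if by blast
  then have "s \<notin> A" for s by (cases s) simp_all
  then show ?thesis by blast
qed

lemma step_free:
  assumes N: "even N" and w: "w \<noteq> []" "distinct w"
    and orth: "\<And>s t. s \<in> set w \<Longrightarrow> t \<in> set w \<Longrightarrow> s \<noteq> t \<Longrightarrow> lorentz (root s) (root t) = 0"
  shows "foldr (step N) w x \<noteq> x"
proof
  assume "foldr (step N) w x = x"
  then have "even (\<Sum>s\<in>set w. (if s \<in> code k then 1 else 0) :: nat)" if "k < 4" for k
    using lbit_foldr[OF N that w(2), of x] by (cases "lbit k x") simp_all
  then have "set w = {}" using clique_code[OF orth] by blast
  then show False using w(1) by simp
qed

lemma step_transitive:
  assumes N: "even N" "0 < N" and x: "x \<in> labels N"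
  shows "\<exists>w. foldr (step N) w (0, False, False, False) = x"
proof -
  have j: "int m < N \<Longrightarrow> \<exists>w. foldr (step N) w (0, False, False, False) = (int m, False, False, False)" for m
  proof (induction m)
    case 0
    then show ?case by (intro exI[of _ "[]"]) simp
  next
    case (Suc m)
    then obtain w where "foldr (step N) w (0, False, False, False) = (int m, False, False, False)" by auto
    \<comment> \<open>From an even position \<open>flipA\<close> moves forward, from an odd one
      \<open>flipB\<close>; \<open>Y34\<close> and \<open>Y12\<close> leave the three bits
      alone.\<close>
    then have "foldr (step N) ((if even m then Y34 else Y12) # w) (0, False, False, False) = (int (Suc m), False, False, False)"
      using Suc.prems by (auto simp: flipA_def flipB_def)
    then show ?case by blast
  qed
  obtain j a b c where x': "x = (j, a, b, c)" by (cases x)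
  then have "0 \<le> j" "j < N" using x by (auto simp: labels_def)
  then obtain w where "foldr (step N) w (0, False, False, False) = (j, False, False, False)"
    using j[of "nat j"] by auto
  then have "foldr (step N) ((if a then [Y24] else []) @ (if b then [Y23] else []) @ (if c then [X1] else []) @ w)
      (0, False, False, False) = x"
    by (simp add: x')
  then show ?thesis by blast
qed

lemma card_labels: "0 < N \<Longrightarrow> card (labels N) = 8 * nat N"
  by (simp add: labels_def card_cartesian_product UNIV_Times_UNIV[symmetric] card_UNIV_bool del: UNIV_Times_UNIV)

section \<open>The chambers cover hyperbolic space\<close>

interpretation W: reflection_system root
  by unfold_locales (rule norm_root, rule root_disj)

definition int_pt :: "(real^4) \<times> real \<Rightarrow> bool" where
  "int_pt p \<longleftrightarrow> (\<forall>i. fst p $ i \<in> \<int>) \<and> snd p \<in> \<int>"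

lemma int_pt_pt: "int_pt (pt a b c d t) \<longleftrightarrow> a \<in> \<int> \<and> b \<in> \<int> \<and> c \<in> \<int> \<and> d \<in> \<int> \<and> t \<in> \<int>"
  by (auto simp: int_pt_def pt.simps forall_4)

lemma int_pt_root: "int_pt (root s)"
  by (cases s) (simp_all add: int_pt_pt)

lemma int_pt_reflect: "int_pt v \<Longrightarrow> int_pt p \<Longrightarrow> int_pt (reflect v p)"
  by (auto simp: int_pt_def reflect_def lorentz_def inner_vec_def intro!: Ints_diff Ints_mult Ints_sum)

lemma int_pt_act: "int_pt p \<Longrightarrow> int_pt (W.act w p)"
  by (induction w) (auto intro: int_pt_reflect int_pt_root)

text \<open>On \<open>H4\<close> the time part exceeds every space coordinate in absolute value, so
  a bound on it bounds all five integers.\<close>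

lemma finite_int_pt: "finite {v \<in> H4. int_pt v \<and> snd v \<le> C}"
proof (rule finite_subset)
  let ?F = "{k \<in> \<int>. \<bar>k\<bar> \<le> C}"
  show "{v \<in> H4. int_pt v \<and> snd v \<le> C} \<subseteq> (\<lambda>(a, b, c, d, t). pt a b c d t) ` (?F \<times> ?F \<times> ?F \<times> ?F \<times> ?F)"
  proof
    fix v assume v: "v \<in> {v \<in> H4. int_pt v \<and> snd v \<le> C}"
    obtain a b c d t where p: "v = pt a b c d t" by (rule pt_cases)
    have "\<bar>a\<bar> < t" "\<bar>b\<bar> < t" "\<bar>c\<bar> < t" "\<bar>d\<bar> < t" using v H4_coord_less by (auto simp: p)
    moreover have "t \<le> C" using v by (simp add: p pt.simps)
    moreover have "int_pt (pt a b c d t)" using v p by simp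
    ultimately have "(a, b, c, d, t) \<in> ?F \<times> ?F \<times> ?F \<times> ?F \<times> ?F" by (auto simp: int_pt_pt)
    then show "v \<in> (\<lambda>(a, b, c, d, t). pt a b c d t) ` (?F \<times> ?F \<times> ?F \<times> ?F \<times> ?F)"
      by (force simp: p)
  qed
  show "finite ((\<lambda>(a, b, c, d, t). pt a b c d t) ` (?F \<times> ?F \<times> ?F \<times> ?F \<times> ?F))"
    using finite_abs_int_segment[of C] by blast
qed

text \<open>The heights of the points of an orbit are inner products with integral points of the
  hyperboloid, so the least height is attained.\<close>

lemma exists_min_height:
  assumes q: "q \<in> H4"
  shows "\<exists>w. \<forall>u. snd (W.act w q) \<le> snd (W.act u q)"
proof -
  let ?e = "pt 0 0 0 0 1"
  \<comment> \<open>Positive because \<open>q\<close> lies strictly inside the light cone; it is the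
    factor by which \<open>- lorentz q v\<close> controls the height of \<open>v\<close>.\<close>
  define \<delta> where "\<delta> = snd q - norm (fst q)"
  have h: "(norm (fst q))\<^sup>2 < (snd q)\<^sup>2" "0 < snd q"
    using q unfolding power2_norm_eq_inner by (auto simp: H4_def lorentz_def power2_eq_square)
  then have "norm (fst q) < snd q" using power2_less_imp_less[OF h(1)] by simp
  then have \<delta>: "0 < \<delta>" by (simp add: \<delta>_def)
  have e: "?e \<in> H4" "int_pt ?e" by (simp_all add: pt_H4 int_pt_pt)
  have height: "snd (W.act w q) = - lorentz q (W.act (rev w) ?e)" for w
  proof -
    have "lorentz (W.act w q) ?e = lorentz q (W.act (rev w) ?e)"
      using W.lorentz_act[of w q "W.act (rev w) ?e"] by (simp add: W.act_rev)
    moreover have "lorentz p ?e = - snd p" for p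
      by (cases p rule: pt_cases) (simp add: lorentz_pt, simp add: pt.simps)
    ultimately show ?thesis by simp
  qed
  have bound: "\<delta> * snd v \<le> - lorentz q v" if "v \<in> H4" for v
  proof -
    have h: "(norm (fst v))\<^sup>2 \<le> (snd v)\<^sup>2" "0 < snd v"
      using that unfolding power2_norm_eq_inner by (auto simp: H4_def lorentz_def power2_eq_square)
    then have "norm (fst v) \<le> snd v" using power2_le_imp_le[OF h(1)] by simp
    then have "fst q \<bullet> fst v \<le> norm (fst q) * snd v"
      using norm_cauchy_schwarz[of "fst q" "fst v"] by (meson mult_left_mono norm_ge_zero order_trans)
    then show ?thesis by (simp add: \<delta>_def lorentz_def algebra_simps)
  qed
  define T where "T = {snd (W.act w q) |w. snd (W.act w q) \<le> snd q}"
  have "T \<subseteq> (\<lambda>v. - lorentz q v) ` {v \<in> H4. int_pt v \<and> snd v \<le> snd q / \<delta>}"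
  proof
    fix h assume "h \<in> T"
    then obtain w where w: "h = snd (W.act w q)" "h \<le> snd q" by (auto simp: T_def)
    let ?v = "W.act (rev w) ?e"
    have "?v \<in> H4" "int_pt ?v" using e by (auto intro: W.act_H4 int_pt_act)
    moreover have "\<delta> * snd ?v \<le> snd q" using bound[of ?v] height[of w] w calculation by simp
    then have "snd ?v \<le> snd q / \<delta>" using \<delta> by (simp add: field_simps)
    ultimately show "h \<in> (\<lambda>v. - lorentz q v) ` {v \<in> H4. int_pt v \<and> snd v \<le> snd q / \<delta>}"
      using height[of w] w by auto
  qed
  then have fin: "finite T" using finite_int_pt by (meson finite_imageI finite_subset)
  have "snd (W.act [] q) \<in> T" unfolding T_def by (intro CollectI exI[of _ "[]"]) simp
  then have "T \<noteq> {}" by blast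
  then have "Min T \<in> T" using Min_in fin by blast
  have le: "\<And>h. h \<in> T \<Longrightarrow> Min T \<le> h" using fin by simp
  from \<open>Min T \<in> T\<close> obtain w where w: "Min T = snd (W.act w q)" "Min T \<le> snd q" by (auto simp: T_def)
  have "snd (W.act w q) \<le> snd (W.act u q)" for u
  proof (cases "snd (W.act u q) \<le> snd q")
    case True
    then have "snd (W.act u q) \<in> T" by (auto simp: T_def)
    then show ?thesis using le w by simp
  qed (use w in simp)
  then show ?thesis by blast
qed

lemma pt_arith: "pt a b c d t - k *\<^sub>R pt a' b' c' d' t' = pt (a - k * a') (b - k * b') (c - k * c') (d - k * d') (t - k * t')"
  by (simp add: pt.simps vec_eq_iff)

text \<open>Descent to a lowest point of the orbit. The walls \<open>Xi\<close> make the space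
  coordinates nonnegative without changing the height; a wall \<open>Yij\<close> changes the height
  by twice the product with its root, so at minimal height that product is nonnegative.\<close>

lemma chambers_cover:
  assumes q: "q \<in> H4"
  shows "\<exists>w. W.act w q \<in> W.P"
proof -
  obtain w where w: "\<And>u. snd (W.act w q) \<le> snd (W.act u q)" using exists_min_height[OF q] by blast
  obtain a b c d t where p: "W.act w q = pt a b c d t" by (rule pt_cases)
  let ?v = "(if a < 0 then [X1] else []) @ (if b < 0 then [X2] else []) @ (if c < 0 then [X3] else []) @ (if d < 0 then [X4] else [])"
  have v: "W.act ?v (pt a b c d t) = pt \<bar>a\<bar> \<bar>b\<bar> \<bar>c\<bar> \<bar>d\<bar> t"
    by (simp add: reflect_def lorentz_pt pt_arith)
  have p': "W.act (?v @ w) q = pt \<bar>a\<bar> \<bar>b\<bar> \<bar>c\<bar> \<bar>d\<bar> t" using v p by (simp only: W.act_append)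
  have snd_pt: "snd (pt a b c d t) = t" for a b c d t by (simp add: pt.simps)
  have min: "t \<le> snd (W.act (s # ?v @ w) q)" for s using w[of "s # ?v @ w"] by (simp only: p snd_pt)
  have "0 \<le> lorentz (pt \<bar>a\<bar> \<bar>b\<bar> \<bar>c\<bar> \<bar>d\<bar> t) (root s)" for s
    using min[of s] unfolding W.act.simps(2) p'
    by (cases s) (simp_all add: reflect_def lorentz_pt pt_arith snd_pt)
  moreover have "pt \<bar>a\<bar> \<bar>b\<bar> \<bar>c\<bar> \<bar>d\<bar> t \<in> H4" using W.act_H4[OF q, of "?v @ w"] by (simp only: p')
  ultimately have "W.act (?v @ w) q \<in> W.P" by (simp only: p' W.P_def mem_Collect_eq) blast
  then show ?thesis by blast
qed

lemma P_int_nonempty: "W.P_int \<noteq> {}"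
proof -
  have s: "2 < sqrt 5" by (rule real_less_rsqrt) simp
  have "0 < lorentz (pt 1 1 1 1 (sqrt 5)) (root s)" for s
    using s by (cases s) (simp_all add: lorentz_pt)
  moreover have "pt 1 1 1 1 (sqrt 5) \<in> H4" using s by (simp add: pt_H4)
  ultimately have "pt 1 1 1 1 (sqrt 5) \<in> W.P_int" by (simp add: W.P_int_def)
  then show ?thesis by blast
qed

section \<open>One-dimensional integrals\<close>

text \<open>Limits at the ends replace continuity, because an antiderivative used later is built
  from \<open>\<tau> / sqrt (3 - \<tau>^2)\<close>, which is singular at an end.\<close>

lemma nn_integral_FTC_open:
  fixes f F :: "real \<Rightarrow> real"
  assumes ab: "a < b"
    and deriv: "\<And>x. a < x \<Longrightarrow> x < b \<Longrightarrow> (F has_real_derivative f x) (at x)"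
    and nonneg: "\<And>x. a < x \<Longrightarrow> x < b \<Longrightarrow> 0 \<le> f x"
    and lims: "(F \<longlongrightarrow> A) (at_right a)" "(F \<longlongrightarrow> B) (at_left b)"
  shows "(LI x. ennreal (f x) * indicator {a<..<b} x) = ennreal (B - A)" and "A \<le> B"
proof -
  define F' where "F' x = (if x \<le> a then A else if b \<le> x then B else F x)" for x
  define f' where "f' x = (if a < x \<and> x < b then f x else 0)" for x
  have eq: "F' y = F y" if "y \<in> {a<..<b}" for y using that by (simp add: F'_def)
  have D: "(F' has_real_derivative f' x) (at x)" if "x \<in> {a<..<b}" for x
  proof (rule has_field_derivative_transform_within_open[where S = "{a<..<b}"])
    show "(F has_real_derivative f' x) (at x)" using deriv[of x] that by (simp add: f'_def)
  qed (use that eq in auto)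
  have cont: "continuous_on {a..b} F'"
  proof (rule continuous_on_IccI)
    have "eventually (\<lambda>x. F x = F' x) (at_right a)"
      using eventually_at_right[OF ab] eq ab by force
    then show "(F' \<longlongrightarrow> F' a) (at_right a)"
      using lims(1) by (simp add: F'_def[of a] tendsto_cong)
    have "eventually (\<lambda>x. F x = F' x) (at_left b)"
      using eventually_at_left[OF ab] eq ab by force
    then show "(F' \<longlongrightarrow> F' b) (at_left b)"
      using lims(2) ab by (simp add: F'_def[of b] tendsto_cong)
    show "F' \<midarrow>x\<rightarrow> F' x" if "a < x" "x < b" for x
      using DERIV_isCont[OF D[of x]] that by (simp add: isCont_def)
  qed (rule ab)
  have int: "(f' has_integral (F' b - F' a)) {a..b}"
    using ab D by (intro fundamental_theorem_of_calculus_interior cont)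
      (auto simp: has_real_derivative_iff_has_vector_derivative[symmetric])
  have nn: "0 \<le> f' x" for x using nonneg by (simp add: f'_def)
  have F': "F' b = B" "F' a = A" using ab by (simp_all add: F'_def)
  have "(LI x. ennreal (f x) * indicator {a<..<b} x) = (LI x. ennreal (f' x) * indicator {a..b} x)"
    by (intro nn_integral_cong) (auto simp: f'_def indicator_def)
  also have "\<dots> = ennreal (B - A)"
    using nn_integral_has_integral_lebesgue'[OF nn int] by (simp add: F')
  finally show "(LI x. ennreal (f x) * indicator {a<..<b} x) = ennreal (B - A)" .
  show "A \<le> B" using has_integral_nonneg[OF int] nn by (simp add: F')
qed

lemma nn_integral_FTC_cont:
  fixes f F :: "real \<Rightarrow> real"
  assumes "a < b"
    and "\<And>x. a < x \<Longrightarrow> x < b \<Longrightarrow> (F has_real_derivative f x) (at x)"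
    and "\<And>x. a < x \<Longrightarrow> x < b \<Longrightarrow> 0 \<le> f x"
    and "isCont F a" "isCont F b"
  shows "(LI x. ennreal (f x) * indicator {a<..<b} x) = ennreal (F b - F a)" and "F a \<le> F b"
proof -
  have "(F \<longlongrightarrow> F a) (at_right a)" "(F \<longlongrightarrow> F b) (at_left b)"
    using assms(4,5) by (simp_all add: isCont_def filterlim_at_split)
  from nn_integral_FTC_open[OF assms(1-3) this]
  show "(LI x. ennreal (f x) * indicator {a<..<b} x) = ennreal (F b - F a)" and "F a \<le> F b"
    by simp_all
qed

section \<open>Antiderivatives for the radial integral and the two integrals after it\<close>

definition H_vol :: "real \<Rightarrow> real" where
  "H_vol s = (sqrt (2 / (1 - s)) ^ 3 / 3 - sqrt (2 / (1 - s)) + 2 / 3) / (1 + s)\<^sup>2"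

text \<open>The radial integral yields \<open>H_vol\<close>; \<open>G_vol\<close> is an
  antiderivative of \<open>H_vol / 2\<close> in \<open>s\<close>, and \<open>L_vol\<close> is one of
  \<open>G_vol (x^2)\<close> in \<open>x\<close>.\<close>

definition G_vol :: "real \<Rightarrow> real" where
  "G_vol s = (sqrt 2 / sqrt (1 - s) - 1) / (3 * (1 + s))"

lemma H_vol_nonneg: "0 \<le> s \<Longrightarrow> s < 1 \<Longrightarrow> 0 \<le> H_vol s"
proof -
  assume s: "0 \<le> s" "s < 1"
  define t where "t = sqrt (2 / (1 - s))"
  have "0 \<le> t" using s by (simp add: t_def)
  \<comment> \<open>The numerator of \<open>H_vol\<close> has a double zero at
    \<open>t = 1\<close>.\<close>
  then have "0 \<le> (t - 1)\<^sup>2 * (t + 2) / 3" by simp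
  also have "\<dots> = t ^ 3 / 3 - t + 2 / 3" by (simp add: power2_eq_square power3_eq_cube field_simps)
  finally show ?thesis by (simp add: H_vol_def t_def)
qed

text \<open>The upper limit solves \<open>sqrt 2 * x = sqrt (1 + (1 + s) * x^2)\<close>: there the
  ray leaves the polytope.\<close>

lemma nn_integral_radial_vol:
  assumes s: "0 \<le> s" "s < 1"
  shows "(LI x. ennreal (x ^ 3 / sqrt (1 + (1 + s) * x\<^sup>2)) * indicator {0<..<1 / sqrt (1 - s)} x) = ennreal (H_vol s)"
proof -
  define g where "g = 1 + s"
  define F where "F x = (sqrt (1 + g * x\<^sup>2) ^ 3 / 3 - sqrt (1 + g * x\<^sup>2)) / g\<^sup>2" for x
  have g: "0 < g" using s by (simp add: g_def)
  have p: "0 < 1 + g * x\<^sup>2" for x using g by (simp add: add_pos_nonneg)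
  have D: "(F has_real_derivative x ^ 3 / sqrt (1 + g * x\<^sup>2)) (at x)" for x
  proof -
    define r where "r = sqrt (1 + g * x\<^sup>2)"
    have r: "0 < r" "r\<^sup>2 = 1 + g * x\<^sup>2" using p[of x] by (simp_all add: r_def)
    have "(F has_real_derivative (3 * r\<^sup>2 * (g * (2 * x) / (2 * r)) / 3 - g * (2 * x) / (2 * r)) / g\<^sup>2) (at x)"
      unfolding F_def r_def using p[of x] g
      by (auto intro!: derivative_eq_intros simp: field_simps)
    also have "(3 * r\<^sup>2 * (g * (2 * x) / (2 * r)) / 3 - g * (2 * x) / (2 * r)) / g\<^sup>2 = x * (r\<^sup>2 - 1) / (r * g)"
      using r(1) g by (simp add: field_simps power2_eq_square)
    also have "\<dots> = x ^ 3 / r" using g r(1) unfolding r(2) by (simp add: field_simps power2_eq_square power3_eq_cube)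
    finally show ?thesis by (simp add: r_def)
  qed
  have pos: "0 < 1 / sqrt (1 - s)" using s by simp
  have e: "1 + g * (1 / sqrt (1 - s))\<^sup>2 = 2 / (1 - s)"
    using s by (simp add: g_def power_divide field_simps)
  have "(LI x. ennreal (x ^ 3 / sqrt (1 + g * x\<^sup>2)) * indicator {0<..<1 / sqrt (1 - s)} x)
      = ennreal (F (1 / sqrt (1 - s)) - F 0)"
  proof (rule nn_integral_FTC_cont(1)[OF pos D _ DERIV_isCont[OF D] DERIV_isCont[OF D]])
    show "0 \<le> x ^ 3 / sqrt (1 + g * x\<^sup>2)" if "0 < x" for x using that p[of x] by simp
  qed
  also have "F (1 / sqrt (1 - s)) - F 0 = H_vol s"
    unfolding F_def e H_vol_def by (simp add: g_def diff_divide_distrib add_divide_distrib)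
  finally show ?thesis by (simp add: g_def)
qed

lemma G_vol_deriv:
  assumes s: "-1 < s" "s < 1"
  shows "(G_vol has_real_derivative H_vol s / 2) (at s)"
proof -
  define q where "q = sqrt (1 - s)"
  have q: "0 < q" "q\<^sup>2 = 1 - s" using s by (simp_all add: q_def)
  have "(G_vol has_real_derivative
      ((sqrt 2 / (2 * q ^ 3)) * (3 * (1 + s)) - (sqrt 2 / q - 1) * 3) / (3 * (1 + s))\<^sup>2) (at s)"
  proof -
    have r: "((\<lambda>s. sqrt (1 - s)) has_real_derivative - 1 / (2 * q)) (at s)"
      unfolding q_def using s by (auto intro!: derivative_eq_intros simp: field_simps)
    have a: "((\<lambda>s. sqrt 2 / sqrt (1 - s)) has_real_derivative sqrt 2 / (2 * q ^ 3)) (at s)"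
      using DERIV_divide[OF DERIV_const[of "sqrt 2"] r] q(1) by (simp add: q_def[symmetric] power3_eq_cube mult.assoc)
    have b: "((\<lambda>s. 3 * (1 + s)) has_real_derivative 3) (at s)"
      by (auto intro!: derivative_eq_intros)
    show ?thesis
      using DERIV_divide[OF DERIV_diff[OF a DERIV_const[of 1]] b] s
      unfolding G_vol_def[abs_def] by (simp add: q_def[symmetric] power2_eq_square)
  qed
  also have "((sqrt 2 / (2 * q ^ 3)) * (3 * (1 + s)) - (sqrt 2 / q - 1) * 3) / (3 * (1 + s))\<^sup>2 = H_vol s / 2"
  proof -
    have t: "sqrt (2 / (1 - s)) = sqrt 2 / q" by (simp add: q_def real_sqrt_divide)
    have c: "sqrt 2 ^ 3 = 2 * sqrt 2" by (simp add: power3_eq_cube)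
    have s': "s = 1 - q\<^sup>2" using q by simp
    have eq: "(sqrt 2 / (2 * q ^ 3)) * (3 * (1 + s)) - (sqrt 2 / q - 1) * 3 = 9 / 2 * ((sqrt 2 / q) ^ 3 / 3 - sqrt 2 / q + 2 / 3)"
      unfolding s' using q(1) by (simp add: power_divide c field_simps power2_eq_square power3_eq_cube)
    have "9 / 2 * Y / (3\<^sup>2 * D) = Y / D / 2" for Y D :: real by simp
    then show ?thesis unfolding H_vol_def t eq power_mult_distrib by blast
  qed
  finally show ?thesis .
qed

text \<open>Substitution \<open>s = \<eta>^2 * (1 + x^2 * m)\<close> with
  \<open>ds = 2 * \<eta>^2 * x * m * dx\<close>, whence the factor 1/2 in the assumption.
  \<open>\<Phi>\<close> and \<open>\<Gamma>\<close> stay abstract so that the volume and the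
  Gaussian weight share the computation.\<close>

lemma nn_integral_alpha:
  fixes \<Phi> \<Gamma> :: "real \<Rightarrow> real"
  assumes D: "\<And>s. 0 \<le> s \<Longrightarrow> s < 1 \<Longrightarrow> (\<Gamma> has_real_derivative \<Phi> s / 2) (at s)"
    and nn: "\<And>s. 0 \<le> s \<Longrightarrow> s < 1 \<Longrightarrow> 0 \<le> \<Phi> s"
    and m: "0 < m" and less: "\<eta>\<^sup>2 * (1 + m / 2) < 1"
  shows "(LI x. ennreal (\<eta>\<^sup>2 * x * \<Phi> (\<eta>\<^sup>2 * (1 + x\<^sup>2 * m))) * indicator {0<..<1 / sqrt 2} x) =
      ennreal ((\<Gamma> (\<eta>\<^sup>2 * (1 + m / 2)) - \<Gamma> (\<eta>\<^sup>2)) / m)" (is "?L = ?R")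
    and "\<Gamma> (\<eta>\<^sup>2) \<le> \<Gamma> (\<eta>\<^sup>2 * (1 + m / 2))"
proof -
  let ?s = "\<lambda>x. \<eta>\<^sup>2 * (1 + x\<^sup>2 * m)"
  let ?F = "\<lambda>x. \<Gamma> (?s x) / m"
  have range: "0 \<le> ?s x" "?s x < 1" if "0 \<le> x" "x \<le> 1 / sqrt 2" for x
  proof -
    show "0 \<le> ?s x" using m by (simp add: add_nonneg_nonneg)
    have "x\<^sup>2 \<le> (1 / sqrt 2)\<^sup>2" using that by (intro power_mono) auto
    then have "x\<^sup>2 * m \<le> m / 2" using m by (simp add: power_divide field_simps)
    then have "?s x \<le> \<eta>\<^sup>2 * (1 + m / 2)" by (intro mult_left_mono) auto
    then show "?s x < 1" using less by simp
  qed
  have D': "(?F has_real_derivative \<eta>\<^sup>2 * x * \<Phi> (?s x)) (at x)" if "0 \<le> x" "x \<le> 1 / sqrt 2" for x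
  proof -
    have 1: "((\<lambda>x. ?s x) has_real_derivative \<eta>\<^sup>2 * (2 * x * m)) (at x)"
      by (auto intro!: derivative_eq_intros)
    have "((\<lambda>x. \<Gamma> (?s x)) has_real_derivative \<Phi> (?s x) / 2 * (\<eta>\<^sup>2 * (2 * x * m))) (at x)"
      by (rule DERIV_chain2[OF D[OF range[OF that]] 1])
    from DERIV_cdivide[OF this, of m] show ?thesis using m by (simp add: mult_ac)
  qed
  have "(1 / sqrt 2)\<^sup>2 * m = m / 2" by (simp add: power_divide)
  then have e: "?s (1 / sqrt 2) = \<eta>\<^sup>2 * (1 + m / 2)" "?s 0 = \<eta>\<^sup>2" by simp_all
  have "isCont ?F 0" "isCont ?F (1 / sqrt 2)" by (rule DERIV_isCont[OF D'], simp, simp)+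
  moreover have "0 \<le> \<eta>\<^sup>2 * x * \<Phi> (?s x)" if "0 < x" "x < 1 / sqrt 2" for x
    using nn[OF range[of x]] that by simp
  ultimately have *: "(LI x. ennreal (\<eta>\<^sup>2 * x * \<Phi> (?s x)) * indicator {0<..<1 / sqrt 2} x) =
      ennreal (?F (1 / sqrt 2) - ?F 0)" "?F 0 \<le> ?F (1 / sqrt 2)"
    using nn_integral_FTC_cont[of 0 "1 / sqrt 2" ?F "\<lambda>x. \<eta>\<^sup>2 * x * \<Phi> (?s x)", OF _ D'] by simp_all
  show "(LI x. ennreal (\<eta>\<^sup>2 * x * \<Phi> (?s x)) * indicator {0<..<1 / sqrt 2} x) =
      ennreal ((\<Gamma> (\<eta>\<^sup>2 * (1 + m / 2)) - \<Gamma> (\<eta>\<^sup>2)) / m)"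
    using *(1) unfolding e by (simp add: diff_divide_distrib)
  show "\<Gamma> (\<eta>\<^sup>2) \<le> \<Gamma> (\<eta>\<^sup>2 * (1 + m / 2))"
    using *(2) m unfolding e by (simp add: divide_le_cancel)
qed

text \<open>Since \<open>\<eta>^2 * (1 + m / 2) = (k * \<eta>)^2\<close>, the previous integration
  leaves values of \<open>\<Gamma>\<close> at two squares, and \<open>\<Lambda>\<close> integrates
  both. The bound \<open>m < 4\<close> keeps \<open>k / sqrt 3\<close> below 1.\<close>

lemma nn_integral_eta:
  fixes \<Phi> \<Gamma> \<Lambda> :: "real \<Rightarrow> real"
  assumes D: "\<And>s. 0 \<le> s \<Longrightarrow> s < 1 \<Longrightarrow> (\<Gamma> has_real_derivative \<Phi> s / 2) (at s)"
    and nn: "\<And>s. 0 \<le> s \<Longrightarrow> s < 1 \<Longrightarrow> 0 \<le> \<Phi> s"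
    and E: "\<And>x. 0 \<le> x \<Longrightarrow> x < 1 \<Longrightarrow> (\<Lambda> has_real_derivative \<Gamma> (x\<^sup>2)) (at x)" and z: "\<Lambda> 0 = 0"
    and m: "0 < m" "m < 4"
  defines "k \<equiv> sqrt (1 + m / 2)"
  shows "(LI \<eta>. (LI x. ennreal (\<eta>\<^sup>2 * x * \<Phi> (\<eta>\<^sup>2 * (1 + x\<^sup>2 * m))) * indicator {0<..<1 / sqrt 2} x)
      * indicator {0<..<1 / sqrt 3} \<eta>) = ennreal ((\<Lambda> (k / sqrt 3) / k - \<Lambda> (1 / sqrt 3)) / m)" (is "?L = ?R")
    and "0 \<le> (\<Lambda> (k / sqrt 3) / k - \<Lambda> (1 / sqrt 3)) / m"
proof -
  have k: "1 < k" "k < sqrt 3" "k\<^sup>2 = 1 + m / 2" using m by (auto simp: k_def real_less_rsqrt)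
  let ?F = "\<lambda>\<eta>. (\<Lambda> (k * \<eta>) / k - \<Lambda> \<eta>) / m"
  let ?f = "\<lambda>\<eta>. (\<Gamma> ((k * \<eta>)\<^sup>2) - \<Gamma> (\<eta>\<^sup>2)) / m"
  have range: "0 \<le> k * \<eta>" "k * \<eta> < 1" "\<eta> < 1" if "0 \<le> \<eta>" "\<eta> \<le> 1 / sqrt 3" for \<eta>
  proof -
    show "0 \<le> k * \<eta>" using that k by simp
    have "k * \<eta> \<le> k * (1 / sqrt 3)" using that k by (intro mult_left_mono) auto
    also have "\<dots> < 1" using k by simp
    finally show "k * \<eta> < 1" .
    have "1 / sqrt 3 < 1" by simp
    then show "\<eta> < 1" using that by linarith
  qed
  have D': "(?F has_real_derivative ?f \<eta>) (at \<eta>)" if "0 \<le> \<eta>" "\<eta> \<le> 1 / sqrt 3" for \<eta>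
  proof -
    have "((\<lambda>\<eta>. \<Lambda> (k * \<eta>)) has_real_derivative \<Gamma> ((k * \<eta>)\<^sup>2) * k) (at \<eta>)"
    proof (rule DERIV_chain2[where f = \<Lambda> and g = "\<lambda>\<eta>. k * \<eta>"])
      show "(\<Lambda> has_real_derivative \<Gamma> ((k * \<eta>)\<^sup>2)) (at (k * \<eta>))"
        by (rule E[OF range(1,2)[OF that]])
    qed (auto intro!: derivative_eq_intros)
    from DERIV_cdivide[OF DERIV_diff[OF DERIV_cdivide[OF this, of k] E[OF that(1) range(3)[OF that]]], of m]
    show ?thesis using k by simp
  qed
  have less: "\<eta>\<^sup>2 * (1 + m / 2) < 1" if "0 \<le> \<eta>" "\<eta> \<le> 1 / sqrt 3" for \<eta>
  proof -
    have "(k * \<eta>)\<^sup>2 < 1\<^sup>2" using range[OF that] by (intro power_strict_mono) auto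
    then show ?thesis using k by (simp add: power_mult_distrib mult.commute)
  qed
  have sq: "(k * \<eta>)\<^sup>2 = \<eta>\<^sup>2 * (1 + m / 2)" for \<eta> using k by (simp add: power_mult_distrib mult.commute)
  have nn': "0 \<le> ?f \<eta>" if "0 < \<eta>" "\<eta> < 1 / sqrt 3" for \<eta>
    using nn_integral_alpha(2)[where \<Phi> = \<Phi>, OF D nn m(1) less[of \<eta>]] that m unfolding sq by simp
  have "?L = (LI \<eta>. ennreal (?f \<eta>) * indicator {0<..<1 / sqrt 3} \<eta>)"
  proof (intro nn_integral_cong)
    fix \<eta> :: real
    show "(LI x. ennreal (\<eta>\<^sup>2 * x * \<Phi> (\<eta>\<^sup>2 * (1 + x\<^sup>2 * m))) * indicator {0<..<1 / sqrt 2} x)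
      * indicator {0<..<1 / sqrt 3} \<eta> = ennreal (?f \<eta>) * indicator {0<..<1 / sqrt 3} \<eta>"
      using nn_integral_alpha(1)[where \<Phi> = \<Phi>, OF D nn m(1) less[of \<eta>]] unfolding sq
      by (cases "\<eta> \<in> {0<..<1 / sqrt 3}") auto
  qed
  also have "\<dots> = ennreal (?F (1 / sqrt 3) - ?F 0)"
    using nn_integral_FTC_cont(1)[of 0 "1 / sqrt 3" ?F ?f, OF _ D' nn' DERIV_isCont[OF D'] DERIV_isCont[OF D']] by simp
  finally show "?L = ?R"
    by (simp add: z)
  have "?F 0 \<le> ?F (1 / sqrt 3)"
    using nn_integral_FTC_cont(2)[of 0 "1 / sqrt 3" ?F ?f, OF _ D' nn' DERIV_isCont[OF D'] DERIV_isCont[OF D']] by simp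
  then show "0 \<le> (\<Lambda> (k / sqrt 3) / k - \<Lambda> (1 / sqrt 3)) / m" by (simp add: z)
qed

definition L_vol :: "real \<Rightarrow> real" where
  "L_vol x = (arctan (sqrt 2 * x / sqrt (1 - x\<^sup>2)) - arctan x) / 3"

lemma arctan_quot_deriv:
  assumes x: "x\<^sup>2 < 1"
  shows "((\<lambda>x. arctan (sqrt 2 * x / sqrt (1 - x\<^sup>2))) has_real_derivative sqrt 2 / (sqrt (1 - x\<^sup>2) * (1 + x\<^sup>2))) (at x)"
proof -
  define q where "q = sqrt (1 - x\<^sup>2)"
  have q: "0 < q" "q\<^sup>2 = 1 - x\<^sup>2" using x by (simp_all add: q_def)
  have "((\<lambda>x. sqrt 2 * x / sqrt (1 - x\<^sup>2)) has_real_derivative sqrt 2 / q ^ 3) (at x)"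
  proof -
    have "((\<lambda>x. sqrt 2 * x / sqrt (1 - x\<^sup>2)) has_real_derivative
        (sqrt 2 * q - sqrt 2 * x * (- (2 * x) / (2 * q))) / q\<^sup>2) (at x)"
      unfolding q_def using x by (auto intro!: derivative_eq_intros simp: field_simps power2_eq_square)
    also have "(sqrt 2 * q - sqrt 2 * x * (- (2 * x) / (2 * q))) / q\<^sup>2 = sqrt 2 * (q\<^sup>2 + x\<^sup>2) / q ^ 3"
      using q(1) by (simp add: field_simps power2_eq_square power3_eq_cube)
    finally show ?thesis using q(2) by simp
  qed
  from DERIV_chain2[OF DERIV_arctan this]
  have "((\<lambda>x. arctan (sqrt 2 * x / sqrt (1 - x\<^sup>2))) has_real_derivative
      inverse (1 + (sqrt 2 * x / q)\<^sup>2) * (sqrt 2 / q ^ 3)) (at x)"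
    by (simp add: q_def)
  also have "inverse (1 + (sqrt 2 * x / q)\<^sup>2) * (sqrt 2 / q ^ 3) = sqrt 2 / (q * (1 + x\<^sup>2))"
  proof -
    have "1 + (sqrt 2 * x / q)\<^sup>2 = (q\<^sup>2 + 2 * x\<^sup>2) / q\<^sup>2" using q(1) by (simp add: power_divide power_mult_distrib field_simps)
    also have "\<dots> = (1 + x\<^sup>2) / q\<^sup>2" by (simp add: q(2))
    finally show ?thesis using q(1) by (simp add: power2_eq_square power3_eq_cube)
  qed
  finally show ?thesis by (simp add: q_def)
qed

lemma L_vol_deriv:
  assumes "0 \<le> x" "x < 1"
  shows "(L_vol has_real_derivative G_vol (x\<^sup>2)) (at x)"
proof -
  have x: "x\<^sup>2 < 1" using power_strict_mono[of x 1 2] assms by simp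
  have "(L_vol has_real_derivative (sqrt 2 / (sqrt (1 - x\<^sup>2) * (1 + x\<^sup>2)) - inverse (1 + x\<^sup>2)) / 3) (at x)"
    unfolding L_vol_def[abs_def] by (rule DERIV_cdivide[OF DERIV_diff[OF arctan_quot_deriv[OF x] DERIV_arctan]])
  also have "(sqrt 2 / (sqrt (1 - x\<^sup>2) * (1 + x\<^sup>2)) - inverse (1 + x\<^sup>2)) / 3 = G_vol (x\<^sup>2)"
  proof -
    have "(a / (q * y) - inverse y) / 3 = (a / q - 1) / (3 * y)" for a q y :: real
      by (simp add: inverse_eq_divide diff_divide_distrib mult_ac)
    then show ?thesis unfolding G_vol_def by blast
  qed
  finally show ?thesis .
qed

text \<open>The Gaussian counterpart of the radial integral; with \<open>y = g * x^2\<close> the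
  integrand becomes a multiple of \<open>y * exp (- y)\<close>.\<close>

lemma nn_integral_radial_gauss:
  assumes g: "0 < g"
  shows "(LI x. ennreal (x ^ 3 * exp (- (g * x\<^sup>2))) * indicator {0<..} x) = ennreal (1 / (2 * g\<^sup>2))"
proof -
  define F where "F x = - (1 + g * x\<^sup>2) * exp (- (g * x\<^sup>2)) / (2 * g\<^sup>2)" for x
  have D: "(F has_real_derivative x ^ 3 * exp (- (g * x\<^sup>2))) (at x)" for x
  proof -
    have "((\<lambda>y. - (1 + y) * exp (- y)) has_real_derivative y * exp (- y)) (at y)" for y :: real
      by (rule derivative_eq_intros refl | simp add: algebra_simps)+
    moreover have "((\<lambda>x. g * x\<^sup>2) has_real_derivative g * (2 * x)) (at x)"
      by (auto intro!: derivative_eq_intros)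
    ultimately have "((\<lambda>x. - (1 + g * x\<^sup>2) * exp (- (g * x\<^sup>2))) has_real_derivative
        g * x\<^sup>2 * exp (- (g * x\<^sup>2)) * (g * (2 * x))) (at x)"
      by (rule DERIV_chain2)
    from DERIV_cdivide[OF this, of "2 * g\<^sup>2"]
    have "(F has_real_derivative g * x\<^sup>2 * exp (- (g * x\<^sup>2)) * (g * (2 * x)) / (2 * g\<^sup>2)) (at x)"
      by (simp only: F_def[abs_def])
    also have "g * x\<^sup>2 * exp (- (g * x\<^sup>2)) * (g * (2 * x)) / (2 * g\<^sup>2) = x ^ 3 * exp (- (g * x\<^sup>2))"
      using g by (simp add: power2_eq_square power3_eq_cube)
    finally show ?thesis .
  qed
  have sq: "filterlim (\<lambda>x::real. g * x\<^sup>2) at_top at_top"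
    using g by (intro filterlim_tendsto_pos_mult_at_top[OF tendsto_const] filterlim_pow_at_top filterlim_ident) auto
  have "((\<lambda>y::real. y / exp y) \<longlongrightarrow> 0) at_top" using tendsto_power_div_exp_0[of 1] by simp
  moreover have "((\<lambda>y::real. exp (- y)) \<longlongrightarrow> 0) at_top"
    by (rule filterlim_compose[OF exp_at_bot filterlim_uminus_at_bot_at_top])
  ultimately have "((\<lambda>y::real. - (exp (- y) + y / exp y) / (2 * g\<^sup>2)) \<longlongrightarrow> - (0 + 0) / (2 * g\<^sup>2)) at_top"
    using g by (intro tendsto_intros) auto
  from filterlim_compose[OF this sq] have "((\<lambda>x. - (exp (- (g * x\<^sup>2)) + g * x\<^sup>2 / exp (g * x\<^sup>2)) / (2 * g\<^sup>2)) \<longlongrightarrow> 0) at_top"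
    by simp
  moreover have "F = (\<lambda>x. - (exp (- (g * x\<^sup>2)) + g * x\<^sup>2 / exp (g * x\<^sup>2)) / (2 * g\<^sup>2))"
  proof
    fix x
    have "- (1 + y) * inverse E = - (inverse E + y / E)" for y E :: real
      by (simp add: divide_inverse algebra_simps)
    then show "F x = - (exp (- (g * x\<^sup>2)) + g * x\<^sup>2 / exp (g * x\<^sup>2)) / (2 * g\<^sup>2)"
      unfolding F_def exp_minus by simp
  qed
  ultimately have lim: "(F \<longlongrightarrow> 0) at_top" by simp
  have "(LI x. ennreal (x ^ 3 * exp (- (g * x\<^sup>2))) * indicator {0<..} x) =
      (LI x. ennreal (x ^ 3 * exp (- (g * x\<^sup>2))) * indicator {0..} x)"
    by (intro nn_integral_cong) (auto simp: indicator_def)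
  also have "\<dots> = ennreal (0 - F 0)"
    by (rule nn_integral_FTC_atLeast[OF _ D _ lim]) auto
  finally show ?thesis by (simp add: F_def)
qed

text \<open>The integrand is expanded by \<open>arctan X = \<integral> X / (1 + X\<^sup>2 u\<^sup>2) du\<close> over \<open>0 < u < 1\<close>; after
  exchanging the integrals both of them are elementary.\<close>

lemma arctan_double_integral:
  defines "q \<equiv> \<lambda>\<tau>::real. sqrt (3 - \<tau>\<^sup>2)" and "k \<equiv> \<lambda>\<tau>::real. sqrt (1 + (1 + \<tau>\<^sup>2) / 2)"
  shows "(LI \<tau>. ennreal (arctan (2 * k \<tau> / q \<tau>) / (k \<tau> * (1 + \<tau>\<^sup>2))) * indicator {0<..<sqrt 3} \<tau>) = ennreal (pi\<^sup>2 / 12)"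
proof -
  \<comment> \<open>With \<open>X = 2 * k \<tau> / q \<tau>\<close> this is
    \<open>X / (1 + X^2 * u^2)\<close> divided by \<open>k \<tau> * (1 + \<tau>^2)\<close>. The
    factor \<open>k \<tau>\<close> cancels and otherwise occurs squared, so \<open>q \<tau>\<close>
    is the only root left.\<close>
  define J where "J \<tau> u = 2 * q \<tau> / ((1 + \<tau>\<^sup>2) * ((q \<tau>)\<^sup>2 + 2 * (3 + \<tau>\<^sup>2) * u\<^sup>2))" for \<tau> u
  have q: "0 < q \<tau>" "(q \<tau>)\<^sup>2 = 3 - \<tau>\<^sup>2" if "0 < \<tau>" "\<tau> < sqrt 3" for \<tau>
  proof -
    have "\<tau>\<^sup>2 < (sqrt 3)\<^sup>2" using that by (intro power_strict_mono) auto
    then show "0 < q \<tau>" "(q \<tau>)\<^sup>2 = 3 - \<tau>\<^sup>2" by (simp_all add: q_def)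
  qed
  have k: "0 < k \<tau>" "(k \<tau>)\<^sup>2 = (3 + \<tau>\<^sup>2) / 2" for \<tau>
  proof -
    have "0 < 1 + (1 + \<tau>\<^sup>2) / 2" by (simp add: add_pos_nonneg)
    then show "0 < k \<tau>" "(k \<tau>)\<^sup>2 = (3 + \<tau>\<^sup>2) / 2" by (simp_all add: k_def field_simps)
  qed
  have m: "0 < 1 + \<tau>\<^sup>2" for \<tau> :: real by (simp add: add_pos_nonneg)
  have 1: "(LI u. ennreal (J \<tau> u) * indicator {0<..<1} u) = ennreal (arctan (2 * k \<tau> / q \<tau>) / (k \<tau> * (1 + \<tau>\<^sup>2)))"
    if \<tau>: "0 < \<tau>" "\<tau> < sqrt 3" for \<tau>
  proof -
    define X where "X = 2 * k \<tau> / q \<tau>"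
    let ?F = "\<lambda>u. arctan (X * u) / (k \<tau> * (1 + \<tau>\<^sup>2))"
    have D: "(?F has_real_derivative J \<tau> u) (at u)" for u
    proof -
      have "((\<lambda>u. arctan (X * u)) has_real_derivative inverse (1 + (X * u)\<^sup>2) * X) (at u)"
        by (rule DERIV_chain2[where f = arctan and g = "\<lambda>u. X * u"]) (auto intro!: derivative_eq_intros)
      from DERIV_cdivide[OF this, of "k \<tau> * (1 + \<tau>\<^sup>2)"]
      have "(?F has_real_derivative inverse (1 + (X * u)\<^sup>2) * X / (k \<tau> * (1 + \<tau>\<^sup>2))) (at u)" .
      also have "inverse (1 + (X * u)\<^sup>2) * X / (k \<tau> * (1 + \<tau>\<^sup>2)) = J \<tau> u"
      proof -
        have "1 + (X * u)\<^sup>2 = ((q \<tau>)\<^sup>2 + 4 * (k \<tau>)\<^sup>2 * u\<^sup>2) / (q \<tau>)\<^sup>2"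
          using q(1)[OF \<tau>] by (simp add: X_def power_mult_distrib power_divide add_divide_distrib)
        also have "4 * (k \<tau>)\<^sup>2 * u\<^sup>2 = 2 * (3 + \<tau>\<^sup>2) * u\<^sup>2" by (simp add: k(2))
        finally have e: "1 + (X * u)\<^sup>2 = ((q \<tau>)\<^sup>2 + 2 * (3 + \<tau>\<^sup>2) * u\<^sup>2) / (q \<tau>)\<^sup>2" .
        have g: "inverse (D / Q\<^sup>2) * (2 * K / Q) / (K * M) = 2 * Q / (M * D)" if "K \<noteq> 0" "Q \<noteq> 0" for D Q K M :: real
          using that by (simp add: power2_eq_square mult.commute)
        show ?thesis unfolding e J_def unfolding X_def
          by (rule g) (use q(1)[OF \<tau>] k(1)[of \<tau>] in auto)
      qed
      finally show ?thesis .
    qed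
    have "0 \<le> J \<tau> u" for u using q(1)[OF \<tau>] m[of \<tau>] by (simp add: J_def)
    then have "(LI u. ennreal (J \<tau> u) * indicator {0<..<1} u) = ennreal (?F 1 - ?F 0)"
      using nn_integral_FTC_cont(1)[of 0 1 ?F "J \<tau>", OF _ D _ DERIV_isCont[OF D] DERIV_isCont[OF D]] by simp
    then show ?thesis by (simp add: X_def)
  qed
  have 2: "(LI \<tau>. ennreal (J \<tau> u) * indicator {0<..<sqrt 3} \<tau>) =
      ennreal (pi / 2 * (1 / (1 + u\<^sup>2) * (1 - u / sqrt (1 + 2 * u\<^sup>2))))" if u: "0 < u" "u < 1" for u
  proof -
    define B where "B = sqrt (1 + 2 * u\<^sup>2)"
    have B: "0 < B" "B\<^sup>2 = 1 + 2 * u\<^sup>2" by (simp_all add: B_def add_pos_nonneg)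
    \<comment> \<open>In the variable \<open>\<tau> / q \<tau>\<close> the integrand is rational,
      and partial fractions split it into two arctangent derivatives.\<close>
    let ?T = "\<lambda>\<tau>. \<tau> / q \<tau>"
    let ?F = "\<lambda>\<tau>. (arctan (2 * ?T \<tau>) - u / B * arctan (2 * u / B * ?T \<tau>)) / (1 + u\<^sup>2)"
    have D: "(?F has_real_derivative J \<tau> u) (at \<tau>)" if \<tau>: "0 < \<tau>" "\<tau> < sqrt 3" for \<tau>
    proof -
      let ?q = "q \<tau>"
      have qd: "(q has_real_derivative - \<tau> / ?q) (at \<tau>)"
        using q[OF \<tau>] unfolding q_def by (auto intro!: derivative_eq_intros simp: field_simps)
      have "(?T has_real_derivative (1 * ?q - \<tau> * (- \<tau> / ?q)) / (?q * ?q)) (at \<tau>)"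
        using q(1)[OF \<tau>] by (intro DERIV_divide DERIV_ident qd) auto
      also have "(1 * ?q - \<tau> * (- \<tau> / ?q)) / (?q * ?q) = (?q\<^sup>2 + \<tau>\<^sup>2) / ?q ^ 3"
        using q(1)[OF \<tau>] by (simp add: field_simps power2_eq_square power3_eq_cube)
      finally have T: "(?T has_real_derivative 3 / ?q ^ 3) (at \<tau>)" using q(2)[OF \<tau>] by simp
      have A: "((\<lambda>\<tau>. arctan (c * ?T \<tau>)) has_real_derivative inverse (1 + (c * ?T \<tau>)\<^sup>2) * (c * (3 / ?q ^ 3))) (at \<tau>)" for c
        by (rule DERIV_chain2[where f = arctan and g = "\<lambda>\<tau>. c * ?T \<tau>", OF DERIV_arctan DERIV_cmult[OF T]])
      have "(?F has_real_derivative (inverse (1 + (2 * ?T \<tau>)\<^sup>2) * (2 * (3 / ?q ^ 3)) -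
          u / B * (inverse (1 + (2 * u / B * ?T \<tau>)\<^sup>2) * (2 * u / B * (3 / ?q ^ 3)))) / (1 + u\<^sup>2)) (at \<tau>)"
        by (rule DERIV_cdivide[OF DERIV_diff[OF A DERIV_cmult[OF A]]])
      also have "(inverse (1 + (2 * ?T \<tau>)\<^sup>2) * (2 * (3 / ?q ^ 3)) -
          u / B * (inverse (1 + (2 * u / B * ?T \<tau>)\<^sup>2) * (2 * u / B * (3 / ?q ^ 3)))) / (1 + u\<^sup>2) = J \<tau> u"
      proof -
        let ?M = "3 * (1 + \<tau>\<^sup>2)" and ?N = "?q\<^sup>2 + 2 * (3 + \<tau>\<^sup>2) * u\<^sup>2"
        have M: "1 + (2 * ?T \<tau>)\<^sup>2 = ?M / ?q\<^sup>2"
        proof -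
          have "1 + (2 * ?T \<tau>)\<^sup>2 = (?q\<^sup>2 + 4 * \<tau>\<^sup>2) / ?q\<^sup>2"
            using q(1)[OF \<tau>] by (simp add: power_mult_distrib power_divide add_divide_distrib)
          also have "?q\<^sup>2 + 4 * \<tau>\<^sup>2 = ?M" using q(2)[OF \<tau>] by simp
          finally show ?thesis .
        qed
        have N: "1 + (2 * u / B * ?T \<tau>)\<^sup>2 = ?N / (B\<^sup>2 * ?q\<^sup>2)"
        proof -
          have "1 + (2 * u / B * ?T \<tau>)\<^sup>2 = (B\<^sup>2 * ?q\<^sup>2 + 4 * u\<^sup>2 * \<tau>\<^sup>2) / (B\<^sup>2 * ?q\<^sup>2)"
            using q(1)[OF \<tau>] B(1) by (simp add: power_mult_distrib power_divide add_divide_distrib)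
          also have "B\<^sup>2 * ?q\<^sup>2 + 4 * u\<^sup>2 * \<tau>\<^sup>2 = ?N" unfolding B(2) q(2)[OF \<tau>] by (simp add: algebra_simps)
          finally show ?thesis .
        qed
        have pos: "0 < ?M" "0 < ?N" "0 < 1 + u\<^sup>2"
          using q(1)[OF \<tau>] m by (simp_all add: add_pos_nonneg)
        \<comment> \<open>The relation between the two denominators that merges the difference of
          the partial fractions into one term.\<close>
        have key: "?N - u\<^sup>2 * ?M = ?q\<^sup>2 * (1 + u\<^sup>2)" unfolding q(2)[OF \<tau>] by (simp add: algebra_simps)
        have g: "(inverse (M / Q\<^sup>2) * (2 * (3 / Q ^ 3)) - u / B * (inverse (N / (B\<^sup>2 * Q\<^sup>2)) * (2 * u / B * (3 / Q ^ 3)))) / E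
            = 6 * Q / (M * N)" if "0 < M" "0 < N" "0 < E" "0 < Q" "0 < B" "N - u\<^sup>2 * M = Q\<^sup>2 * E" for M N E Q B :: real
        proof -
          have eq: "inverse (M / Q\<^sup>2) * (2 * (3 / Q ^ 3)) - u / B * (inverse (N / (B\<^sup>2 * Q\<^sup>2)) * (2 * u / B * (3 / Q ^ 3)))
              = 6 / Q * (N - u\<^sup>2 * M) / (M * N)"
            using that(1-5) by (simp add: field_simps power2_eq_square power3_eq_cube)
          show ?thesis unfolding eq that(6) using that(1-5) by (simp add: power2_eq_square)
        qed
        have "6 * Q / (3 * M * N) = 2 * Q / (M * N)" for Q M N :: real by (simp add: mult.assoc)
        then have "6 * ?q / (?M * ?N) = J \<tau> u" unfolding J_def by blast
        then show ?thesis unfolding M N using g[OF pos q(1)[OF \<tau>] B(1) key] by simp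
      qed
      finally show ?thesis .
    qed
    have nn: "0 \<le> J \<tau> u" if "0 < \<tau>" "\<tau> < sqrt 3" for \<tau> using q(1)[OF that] m[of \<tau>] by (simp add: J_def)
    have qc: "isCont q \<tau>" for \<tau> unfolding q_def by (intro continuous_intros)
    have "isCont ?F 0"
      using qc[of 0] B(1) m[of u] by (intro continuous_intros isCont_arctan) (simp_all add: q_def)
    then have l0: "(?F \<longlongrightarrow> 0) (at_right 0)"
      by (simp add: isCont_def filterlim_at_split)
    \<comment> \<open>Both arctangents thus tend to \<open>pi / 2\<close> at this end and vanish at
      the other, so the result is algebraic in \<open>u\<close> up to the factor
      \<open>pi / 2\<close>.\<close>
    have T: "filterlim ?T at_top (at_left (sqrt 3))"
    proof (rule LIM_at_top_divide)
      show "((\<lambda>\<tau>. \<tau>) \<longlongrightarrow> sqrt 3) (at_left (sqrt 3))" by (rule tendsto_ident_at)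
      have "isCont q (sqrt 3)" by (rule qc)
      then show "(q \<longlongrightarrow> 0) (at_left (sqrt 3))" by (simp add: isCont_def filterlim_at_split q_def)
      show "eventually (\<lambda>\<tau>. 0 < q \<tau>) (at_left (sqrt 3))"
        using q(1) by (intro eventually_at_leftI[of 0]) auto
    qed simp
    have arc: "((\<lambda>\<tau>. arctan (c * ?T \<tau>)) \<longlongrightarrow> pi / 2) (at_left (sqrt 3))" if "0 < c" for c
      by (rule filterlim_compose[OF tendsto_arctan_at_top filterlim_tendsto_pos_mult_at_top[OF tendsto_const that T]])
    have "(?F \<longlongrightarrow> (pi / 2 - u / B * (pi / 2)) / (1 + u\<^sup>2)) (at_left (sqrt 3))"
      using u B(1) m[of u] by (intro tendsto_intros arc) simp_all
    from nn_integral_FTC_open(1)[OF _ D nn l0 this]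
    show ?thesis by (simp add: B_def field_simps)
  qed
  have 3: "(LI u. ennreal (pi / 2 * (1 / (1 + u\<^sup>2) * (1 - u / sqrt (1 + 2 * u\<^sup>2)))) * indicator {0<..<1} u) = ennreal (pi\<^sup>2 / 12)"
  proof -
    let ?B = "\<lambda>u::real. sqrt (1 + 2 * u\<^sup>2)"
    \<comment> \<open>The second term arises because \<open>arctan (sqrt (1 + 2 * u^2))\<close> has
      derivative \<open>u / ((1 + u^2) * sqrt (1 + 2 * u^2))\<close>.\<close>
    let ?F = "\<lambda>u. pi / 2 * (arctan u - arctan (?B u))"
    have pos: "0 < 1 + 2 * u\<^sup>2" for u :: real by (simp add: add_pos_nonneg)
    have D: "(?F has_real_derivative pi / 2 * (1 / (1 + u\<^sup>2) * (1 - u / ?B u))) (at u)" for u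
    proof -
      have "(?B has_real_derivative 2 * u / ?B u) (at u)"
        using pos[of u] by (auto intro!: derivative_eq_intros simp: field_simps)
      from DERIV_chain2[OF DERIV_arctan this]
      have "((\<lambda>u. arctan (?B u)) has_real_derivative inverse (1 + (?B u)\<^sup>2) * (2 * u / ?B u)) (at u)" .
      also have "inverse (1 + (?B u)\<^sup>2) * (2 * u / ?B u) = 1 / (1 + u\<^sup>2) * (u / ?B u)"
      proof -
        have e: "1 + (?B u)\<^sup>2 = 2 * (1 + u\<^sup>2)" using pos[of u] by simp
        have g: "inverse (2 * E) * (2 * u / C) = 1 / E * (u / C)" for E C :: real
          by (cases "E = 0"; cases "C = 0") (simp_all add: field_simps)
        show ?thesis unfolding e by (rule g)
      qed
      finally have b: "((\<lambda>u. arctan (?B u)) has_real_derivative 1 / (1 + u\<^sup>2) * (u / ?B u)) (at u)" .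
      have "(?F has_real_derivative pi / 2 * (inverse (1 + u\<^sup>2) - 1 / (1 + u\<^sup>2) * (u / ?B u))) (at u)"
        by (rule DERIV_cmult[OF DERIV_diff[OF DERIV_arctan b]])
      then show ?thesis by (simp add: inverse_eq_divide right_diff_distrib)
    qed
    have nn: "0 \<le> pi / 2 * (1 / (1 + u\<^sup>2) * (1 - u / ?B u))" for u
    proof -
      have "u \<le> ?B u" by (rule real_le_rsqrt) simp
      then have "u / ?B u \<le> 1" using pos[of u] by simp
      then show ?thesis using m[of u] by simp
    qed
    have "(LI u. ennreal (pi / 2 * (1 / (1 + u\<^sup>2) * (1 - u / ?B u))) * indicator {0<..<1} u) = ennreal (?F 1 - ?F 0)"
      using nn_integral_FTC_cont(1)[of 0 1 ?F, OF _ D nn DERIV_isCont[OF D] DERIV_isCont[OF D]] by simp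
    also have "arctan (sqrt 3) = pi / 3" using arctan_tan[of "pi / 3"] tan_60 by simp
    then have "?F 1 - ?F 0 = pi\<^sup>2 / 12" by (simp add: arctan_one power2_eq_square field_simps)
    finally show ?thesis .
  qed
  have "(LI \<tau>. ennreal (arctan (2 * k \<tau> / q \<tau>) / (k \<tau> * (1 + \<tau>\<^sup>2))) * indicator {0<..<sqrt 3} \<tau>) =
      (LI \<tau>. (LI u. ennreal (J \<tau> u) * indicator {0<..<1} u * indicator {0<..<sqrt 3} \<tau>))"
  proof (intro nn_integral_cong)
    fix \<tau>
    show "ennreal (arctan (2 * k \<tau> / q \<tau>) / (k \<tau> * (1 + \<tau>\<^sup>2))) * indicator {0<..<sqrt 3} \<tau> =
      (LI u. ennreal (J \<tau> u) * indicator {0<..<1} u * indicator {0<..<sqrt 3} \<tau>)"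
      using 1[of \<tau>] by (cases "\<tau> \<in> {0<..<sqrt 3}") simp_all
  qed
  also have "\<dots> = (LI u. (LI \<tau>. ennreal (J \<tau> u) * indicator {0<..<1} u * indicator {0<..<sqrt 3} \<tau>))"
    by (rule lborel_pair.Fubini') (simp add: J_def q_def split_beta', measurable)
  also have "\<dots> = (LI u. ennreal (pi / 2 * (1 / (1 + u\<^sup>2) * (1 - u / sqrt (1 + 2 * u\<^sup>2)))) * indicator {0<..<1} u)"
  proof (intro nn_integral_cong)
    fix u :: real
    show "(LI \<tau>. ennreal (J \<tau> u) * indicator {0<..<1} u * indicator {0<..<sqrt 3} \<tau>) =
       ennreal (pi / 2 * (1 / (1 + u\<^sup>2) * (1 - u / sqrt (1 + 2 * u\<^sup>2)))) * indicator {0<..<1} u"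
      using 2[of u] by (cases "u \<in> {0<..<1}") simp_all
  qed
  also have "\<dots> = ennreal (pi\<^sup>2 / 12)" by (rule 3)
  finally show ?thesis .
qed

section \<open>Symmetric integrals over four variables\<close>

abbreviation "bor2 \<equiv> borel \<Otimes>\<^sub>M (borel :: real measure)"
abbreviation "bor3 \<equiv> (borel :: real measure) \<Otimes>\<^sub>M bor2"
abbreviation "bor4 \<equiv> (borel :: real measure) \<Otimes>\<^sub>M bor3"

lemma nn_integral_swap:
  fixes f :: "real \<Rightarrow> real \<Rightarrow> ennreal"
  assumes "(\<lambda>(x, y). f x y) \<in> borel_measurable (borel \<Otimes>\<^sub>M borel)"
  shows "(LI x. LI y. f x y) = (LI y. LI x. f x y)"
proof -
  have "(\<lambda>(x, y). f x y) \<in> borel_measurable (lborel \<Otimes>\<^sub>M lborel)"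
    using assms by (simp cong: measurable_cong_sets sets_pair_measure_cong)
  then have "(\<lambda>(y, x). f x y) \<in> borel_measurable (lborel \<Otimes>\<^sub>M lborel)" by measurable
  then show ?thesis by (rule lborel_pair.Fubini')
qed

lemma ennreal_add3: "(a :: ennreal) + (a + a) = 3 * a"
proof -
  have "3 * a = (1 + (1 + 1)) * a" by simp
  then show ?thesis by (simp only: distrib_right mult_1_left)
qed

lemma ennreal_add4: "(a :: ennreal) + (a + (a + a)) = 4 * a"
proof -
  have "4 * a = (1 + (1 + (1 + 1))) * a" by simp
  then show ?thesis by (simp only: distrib_right mult_1_left)
qed

lemma nn_integral_order2:
  fixes h :: "real \<times> real \<Rightarrow> ennreal"
  assumes h[measurable]: "h \<in> borel_measurable bor2" and sym: "\<And>x y. h (x, y) = h (y, x)"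
  shows "(LI x. LI y. h (x, y)) =
    2 * (LI x. LI y. (if y < x then h (x, y) else 0))"
proof -
  let ?J = "LI x. LI y. (if y < x then h (x, y) else 0)"
  have "(LI x. LI y. h (x, y)) = (LI x. LI y. (if y < x then h (x, y) else 0) + (if x < y then h (x, y) else 0))"
  proof (rule nn_integral_cong, rule nn_integral_cong_AE)
    fix x :: real
    show "AE y in lborel. h (x, y) = (if y < x then h (x, y) else 0) + (if x < y then h (x, y) else 0)"
      using AE_lborel_singleton[of x] by eventually_elim auto
  qed
  also have "\<dots> = ?J + (LI x. LI y. (if x < y then h (x, y) else 0))"
    by (simp add: nn_integral_add)
  also have "(LI x. LI y. (if x < y then h (x, y) else 0)) = (LI y. LI x. (if x < y then h (x, y) else 0))"
    by (rule nn_integral_swap) measurable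
  also have "\<dots> = ?J" by (simp add: sym[of _ "_ :: real"] cong: if_cong)
  finally show ?thesis by (simp add: mult_2)
qed

text \<open>The variable \<open>x\<close> takes one of three places relative to the ordered pair,
  and by symmetry all three contribute equally. Inserting one variable at a time avoids
  distinguishing all 24 orders of four variables.\<close>

lemma nn_integral_insert3:
  fixes h :: "real \<times> real \<times> real \<Rightarrow> ennreal"
  assumes h[measurable]: "h \<in> borel_measurable bor3"
    and s1: "\<And>x y z. h (x, y, z) = h (y, x, z)" and s2: "\<And>x y z. h (x, y, z) = h (x, z, y)"
  shows "(LI x. LI y. LI z. (if z < y then h (x, y, z) else 0)) =
    3 * (LI x. LI y. LI z. (if z < y \<and> y < x then h (x, y, z) else 0))"
proof -
  let ?J = "LI x. LI y. LI z. (if z < y \<and> y < x then h (x, y, z) else 0)"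
  let ?K2 = "LI x. LI y. LI z. (if z < x \<and> x < y then h (x, y, z) else 0)"
  let ?K3 = "LI x. LI y. LI z. (if x < z \<and> z < y then h (x, y, z) else 0)"
  have "(LI x. LI y. LI z. (if z < y then h (x, y, z) else 0)) =
    (LI x. LI y. LI z. (if z < y \<and> y < x then h (x, y, z) else 0) + ((if z < x \<and> x < y then h (x, y, z) else 0)
      + (if x < z \<and> z < y then h (x, y, z) else 0)))"
  proof (rule nn_integral_cong)
    fix x :: real
    have ne: "AE y in lborel. y \<noteq> x" by (rule AE_lborel_singleton)
    show "(LI y. LI z. (if z < y then h (x, y, z) else 0)) =
      (LI y. LI z. (if z < y \<and> y < x then h (x, y, z) else 0) + ((if z < x \<and> x < y then h (x, y, z) else 0)
      + (if x < z \<and> z < y then h (x, y, z) else 0)))"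
    proof (rule nn_integral_cong_AE, use ne in eventually_elim)
      case (elim y)
      show ?case
        by (rule nn_integral_cong_AE, use ne in eventually_elim) (use elim in auto)
    qed
  qed
  also have "\<dots> = ?J + (?K2 + ?K3)"
    by (simp add: nn_integral_add)
  also have "?K2 = (LI y. LI x. LI z. (if z < x \<and> x < y then h (x, y, z) else 0))"
    by (rule nn_integral_swap) measurable
  also have "\<dots> = ?J" by (intro nn_integral_cong if_cong refl s1)
  also have "?K3 = (LI y. LI x. LI z. (if x < z \<and> z < y then h (x, y, z) else 0))"
    by (rule nn_integral_swap) measurable
  also have "\<dots> = (LI y. LI z. LI x. (if x < z \<and> z < y then h (x, y, z) else 0))"
    by (intro nn_integral_cong nn_integral_swap) measurable
  also have "\<dots> = ?J"
  proof (intro nn_integral_cong if_cong refl)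
    show "h (z, x, y) = h (x, y, z)" for x y z using s1[of z x y] s2[of x z y] by simp
  qed
  finally show ?thesis unfolding ennreal_add3 .
qed

lemma nn_integral_insert4:
  fixes h :: "real \<times> real \<times> real \<times> real \<Rightarrow> ennreal"
  assumes h[measurable]: "h \<in> borel_measurable bor4"
    and s1: "\<And>x y z w. h (x, y, z, w) = h (y, x, z, w)" and s2: "\<And>x y z w. h (x, y, z, w) = h (x, z, y, w)"
    and s3: "\<And>x y z w. h (x, y, z, w) = h (x, y, w, z)"
  shows "(LI x. LI y. LI z. LI w. (if w < z \<and> z < y then h (x, y, z, w) else 0)) =
    4 * (LI x. LI y. LI z. LI w. (if w < z \<and> z < y \<and> y < x then h (x, y, z, w) else 0))"
proof -
  let ?J = "LI x. LI y. LI z. LI w. (if w < z \<and> z < y \<and> y < x then h (x, y, z, w) else 0)"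
  let ?k = "\<lambda>x y z w. (if w < z \<and> z < y \<and> y < x then h (x, y, z, w) else 0) + ((if w < z \<and> z < x \<and> x < y then h (x, y, z, w) else 0)
      + ((if w < x \<and> x < z \<and> z < y then h (x, y, z, w) else 0) + (if x < w \<and> w < z \<and> z < y then h (x, y, z, w) else 0)))"
  let ?K2 = "LI x. LI y. LI z. LI w. (if w < z \<and> z < x \<and> x < y then h (x, y, z, w) else 0)"
  let ?K3 = "LI x. LI y. LI z. LI w. (if w < x \<and> x < z \<and> z < y then h (x, y, z, w) else 0)"
  let ?K4 = "LI x. LI y. LI z. LI w. (if x < w \<and> w < z \<and> z < y then h (x, y, z, w) else 0)"
  have "(LI x. LI y. LI z. LI w. (if w < z \<and> z < y then h (x, y, z, w) else 0)) =
      (LI x. LI y. LI z. LI w. ?k x y z w)"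
  proof (rule nn_integral_cong)
    fix x :: real
    have ne: "AE y in lborel. y \<noteq> x" by (rule AE_lborel_singleton)
    show "(LI y. LI z. LI w. (if w < z \<and> z < y then h (x, y, z, w) else 0)) =
      (LI y. LI z. LI w. ?k x y z w)"
    proof (rule nn_integral_cong_AE, use ne in eventually_elim)
      case y: (elim y)
      show ?case
      proof (rule nn_integral_cong_AE, use ne in eventually_elim)
        case z: (elim z)
        show ?case
          by (rule nn_integral_cong_AE, use ne in eventually_elim) (use y z in auto)
      qed
    qed
  qed
  also have "\<dots> = ?J + (?K2 + (?K3 + ?K4))"
    by (simp add: nn_integral_add)
  also have "?K2 = (LI y. LI x. LI z. LI w. (if w < z \<and> z < x \<and> x < y then h (x, y, z, w) else 0))"
    by (rule nn_integral_swap) measurable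
  also have "\<dots> = ?J" by (intro nn_integral_cong if_cong refl s1)
  also have "?K3 = (LI y. LI x. LI z. LI w. (if w < x \<and> x < z \<and> z < y then h (x, y, z, w) else 0))"
    by (rule nn_integral_swap) measurable
  also have "\<dots> = (LI y. LI z. LI x. LI w. (if w < x \<and> x < z \<and> z < y then h (x, y, z, w) else 0))"
    by (intro nn_integral_cong nn_integral_swap) measurable
  also have "\<dots> = ?J"
  proof (intro nn_integral_cong if_cong refl)
    show "h (z, x, y, w) = h (x, y, z, w)" for x y z w using s1[of z x y w] s2[of x z y w] by simp
  qed
  also have "?K4 = (LI y. LI x. LI z. LI w. (if x < w \<and> w < z \<and> z < y then h (x, y, z, w) else 0))"
    by (rule nn_integral_swap) measurable
  also have "\<dots> = (LI y. LI z. LI x. LI w. (if x < w \<and> w < z \<and> z < y then h (x, y, z, w) else 0))"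
    by (intro nn_integral_cong nn_integral_swap) measurable
  also have "\<dots> = (LI y. LI z. LI w. LI x. (if x < w \<and> w < z \<and> z < y then h (x, y, z, w) else 0))"
    by (intro nn_integral_cong nn_integral_swap) measurable
  also have "\<dots> = ?J"
  proof (intro nn_integral_cong if_cong refl)
    show "h (w, x, y, z) = h (x, y, z, w)" for x y z w
      using s1[of w x y z] s2[of x w y z] s3[of x y w z] by simp
  qed
  finally show ?thesis unfolding ennreal_add4 .
qed

lemma nn_integral_order4:
  fixes h :: "real \<times> real \<times> real \<times> real \<Rightarrow> ennreal"
  assumes h[measurable]: "h \<in> borel_measurable bor4"
    and s1: "\<And>x y z w. h (x, y, z, w) = h (y, x, z, w)" and s2: "\<And>x y z w. h (x, y, z, w) = h (x, z, y, w)"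
    and s3: "\<And>x y z w. h (x, y, z, w) = h (x, y, w, z)"
  shows "(LI x. LI y. LI z. LI w. h (x, y, z, w)) =
    24 * (LI x. LI y. LI z. LI w. (if w < z \<and> z < y \<and> y < x then h (x, y, z, w) else 0))"
proof -
  have "(LI z. LI w. h (x, y, z, w)) = 2 * (LI z. LI w. (if w < z then h (x, y, z, w) else 0))" for x y
  proof -
    have "(\<lambda>(z, w). h (x, y, z, w)) \<in> borel_measurable bor2" by measurable
    from nn_integral_order2[OF this, unfolded prod.case] show ?thesis using s3 by blast
  qed
  moreover have "(LI y. LI z. LI w. (if w < z then h (x, y, z, w) else 0)) =
      3 * (LI y. LI z. LI w. (if w < z \<and> z < y then h (x, y, z, w) else 0))" for x
  proof -
    have "(\<lambda>(y, z, w). h (x, y, z, w)) \<in> borel_measurable bor3" by measurable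
    from nn_integral_insert3[OF this, unfolded prod.case] show ?thesis using s2 s3 by blast
  qed
  ultimately have "(LI x. LI y. LI z. LI w. h (x, y, z, w)) =
      2 * (3 * (LI x. LI y. LI z. LI w. (if w < z \<and> z < y then h (x, y, z, w) else 0)))"
    by (simp add: nn_integral_cmult)
  then show ?thesis unfolding nn_integral_insert4[OF assms]
    by (simp add: mult.assoc[symmetric])
qed

text \<open>An orthogonal change of two variables, carried out as two one-dimensional affine
  substitutions whose factors \<open>1 / c\<close> and \<open>c\<close> cancel. In this
  orientation-reversing form the map is its own inverse.\<close>

lemma nn_integral_rotate:
  fixes h :: "real \<times> real \<Rightarrow> ennreal"
  assumes h[measurable]: "h \<in> borel_measurable bor2" and c: "0 < c" "c\<^sup>2 + s\<^sup>2 = 1"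
  shows "(LI x. LI y. h (x, y)) = (LI u. LI v. h (c * u + s * v, s * u - c * v))"
proof -
  have "(LI x. LI y. h (x, y)) = (LI x. LI v. ennreal (1 / c) * h (x, (s * x - v) / c))"
  proof (rule nn_integral_cong)
    fix x
    have "(LI y. h (x, y)) = ennreal \<bar>- 1 / c\<bar> * (LI v. h (x, s * x / c + (- 1 / c) * v))"
      using c by (intro nn_integral_real_affine) auto
    also have "\<dots> = (LI v. ennreal (1 / c) * h (x, (s * x - v) / c))"
      using c by (subst nn_integral_cmult) (auto simp: diff_divide_distrib)
    finally show "(LI y. h (x, y)) = (LI v. ennreal (1 / c) * h (x, (s * x - v) / c))" .
  qed
  also have "\<dots> = (LI v. LI x. ennreal (1 / c) * h (x, (s * x - v) / c))"
    by (rule nn_integral_swap) measurable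
  also have "\<dots> = (LI v. LI u. h (c * u + s * v, s * u - c * v))"
  proof (rule nn_integral_cong)
    fix v
    have e: "(s * (s * v + c * u) - v) / c = s * u - c * v" for u
    proof -
      have "s * (s * v + c * u) - v = c * (s * u) - (1 - s\<^sup>2) * v" by (simp add: power2_eq_square algebra_simps)
      also have "1 - s\<^sup>2 = c * c" using c(2) by (simp add: power2_eq_square)
      finally show ?thesis using c(1) by (simp add: field_simps)
    qed
    have "(LI x. ennreal (1 / c) * h (x, (s * x - v) / c)) =
        ennreal \<bar>c\<bar> * (LI u. ennreal (1 / c) * h (s * v + c * u, (s * (s * v + c * u) - v) / c))"
      using c by (intro nn_integral_real_affine) auto
    also have "\<dots> = ennreal c * (ennreal (1 / c) * (LI u. h (c * u + s * v, s * u - c * v)))"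
      unfolding e using c by (simp add: nn_integral_cmult add.commute)
    also have "\<dots> = (LI u. h (c * u + s * v, s * u - c * v))"
      using c(1) by (simp add: mult.assoc[symmetric] ennreal_mult'[symmetric])
    finally show "(LI x. ennreal (1 / c) * h (x, (s * x - v) / c)) = (LI u. h (c * u + s * v, s * u - c * v))" .
  qed
  also have "\<dots> = (LI u. LI v. h (c * u + s * v, s * u - c * v))"
    by (rule nn_integral_swap) measurable
  finally show ?thesis .
qed


text \<open>The factor \<open>c\<close> will be built from other integration variables and may be
  nonpositive; there the integrand vanishes and both sides are 0.\<close>

lemma nn_integral_scale_pos:
  fixes f :: "real \<Rightarrow> ennreal"
  assumes f[measurable]: "f \<in> borel_measurable borel" and nonpos: "\<And>x. x \<le> 0 \<Longrightarrow> f x = 0"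
    and zero: "c \<le> 0 \<Longrightarrow> \<forall>x. f x = 0"
  shows "(LI x. f x) = (LI y. ennreal c * f (c * y))"
proof (cases "0 < c")
  case True
  then show ?thesis
    using nn_integral_real_affine[of f c 0] by (simp add: nn_integral_cmult)
next
  case False
  then have "f = (\<lambda>_. 0)" using zero by auto
  then show ?thesis by simp
qed

text \<open>The simplex \<open>0 < b < sqrt 3 * a\<close>, \<open>sqrt 2 * a < h\<close>, \<open>sqrt 3 * h < \<xi>\<close> is a fundamental domain of the
  Weyl group of type \<open>F\<^sub>4\<close> of order 1152 = 16 * 72.\<close>

lemma nn_integral_F4:
  fixes h :: "real \<times> real \<times> real \<times> real \<Rightarrow> ennreal" and F :: "real \<times> real \<Rightarrow> ennreal"
  assumes h[measurable]: "h \<in> borel_measurable bor4" and F[measurable]: "F \<in> borel_measurable bor2"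
    and s1: "\<And>x y z w. h (x, y, z, w) = h (y, x, z, w)" and s2: "\<And>x y z w. h (x, y, z, w) = h (x, z, y, w)"
    and s3: "\<And>x y z w. h (x, y, z, w) = h (x, y, w, z)"
    and val: "\<And>a b c d. 0 < d \<Longrightarrow> d < c \<Longrightarrow> c < b \<Longrightarrow> b < a \<Longrightarrow> h (a, b, c, d) = F (a\<^sup>2 + b\<^sup>2 + c\<^sup>2 + d\<^sup>2, a + b)"
    and neg: "\<And>a b c d. d < 0 \<Longrightarrow> h (a, b, c, d) = 0"
  shows "(LI x. LI y. LI z. LI w. h (x, y, z, w)) =
    72 * (LI \<xi>. LI h. LI a. LI b. (if 0 < b \<and> b < sqrt 3 * a \<and> sqrt 2 * a < h \<and> sqrt 3 * h < \<xi>
        then F (\<xi>\<^sup>2 + h\<^sup>2 + a\<^sup>2 + b\<^sup>2, sqrt 2 * \<xi>) else 0))"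
proof -
  define K where "K p = (case p of (a, b, c, d) \<Rightarrow>
      if 0 < d \<and> d < c \<and> c < b \<and> b < a then F (a\<^sup>2 + b\<^sup>2 + c\<^sup>2 + d\<^sup>2, a + b) else 0)" for p :: "real \<times> real \<times> real \<times> real"
  have [measurable]: "K \<in> borel_measurable bor4" unfolding K_def by measurable
  define H where "H \<xi> p = (case p of (z1, z2, z3) \<Rightarrow> if 0 < z1 \<and> 0 < z2 \<and> 0 < z3 \<and> z1 + z2 + z3 < \<xi>
      then F (\<xi>\<^sup>2 + z1\<^sup>2 + z2\<^sup>2 + z3\<^sup>2, sqrt 2 * \<xi>) else 0)" for \<xi> :: real and p :: "real \<times> real \<times> real"
  have Hm[measurable]: "H \<xi> \<in> borel_measurable bor3" for \<xi> unfolding H_def by measurable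
  define L where "L \<xi> p = (case p of (z1, z2, z3) \<Rightarrow> if z3 < z2 \<and> z2 < z1 then H \<xi> (z1, z2, z3) else 0)"
    for \<xi> :: real and p :: "real \<times> real \<times> real"
  have Lm[measurable]: "L \<xi> \<in> borel_measurable bor3" for \<xi> unfolding L_def by measurable
  let ?c = "1 / sqrt 2 :: real"
  have c: "0 < ?c" "?c\<^sup>2 + ?c\<^sup>2 = 1" by (simp_all add: power_divide)
  have sq: "(?c * u + ?c * v)\<^sup>2 + (?c * u - ?c * v)\<^sup>2 = u\<^sup>2 + v\<^sup>2" for u v :: real
  proof -
    have "(?c * u + ?c * v)\<^sup>2 + (?c * u - ?c * v)\<^sup>2 = (?c\<^sup>2 + ?c\<^sup>2) * (u\<^sup>2 + v\<^sup>2)"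
      by (simp add: power2_eq_square algebra_simps)
    then show ?thesis using c(2) by simp
  qed
  have lin: "?c * u + ?c * v + (?c * u - ?c * v) = sqrt 2 * u" for u v :: real
    by (simp add: field_simps)
  have "(LI x. LI y. LI z. LI w. h (x, y, z, w)) =
    24 * (LI x. LI y. LI z. LI w. (if w < z \<and> z < y \<and> y < x then h (x, y, z, w) else 0))"
    by (rule nn_integral_order4[OF h s1 s2 s3])
  also have "(LI x. LI y. LI z. LI w. (if w < z \<and> z < y \<and> y < x then h (x, y, z, w) else 0)) =
    (LI x. LI y. LI z. LI w. K (x, y, z, w))"
  proof (rule nn_integral_cong, rule nn_integral_cong, rule nn_integral_cong, rule nn_integral_cong_AE)
    fix x y z :: real
    show "AE w in lborel. (if w < z \<and> z < y \<and> y < x then h (x, y, z, w) else 0) = K (x, y, z, w)"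
      using AE_lborel_singleton[of 0]
    proof eventually_elim
      case (elim w)
      then show ?case using val[of w z y x] neg[of w x y z] by (cases "w < 0") (auto simp: K_def)
    qed
  qed
  also have "\<dots> = (LI x. LI y. LI u. LI v. K (x, y, ?c * u + ?c * v, ?c * u - ?c * v))"
  proof (rule nn_integral_cong, rule nn_integral_cong)
    fix x y :: real
    have "(\<lambda>(z, w). K (x, y, z, w)) \<in> borel_measurable bor2" by measurable
    from nn_integral_rotate[OF this c, unfolded prod.case]
    show "(LI z. LI w. K (x, y, z, w)) = (LI u. LI v. K (x, y, ?c * u + ?c * v, ?c * u - ?c * v))" .
  qed
  also have "\<dots> = (LI \<xi>. LI z. LI u. LI v. K (?c * \<xi> + ?c * z, ?c * \<xi> - ?c * z, ?c * u + ?c * v, ?c * u - ?c * v))"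
  proof -
    have "(\<lambda>(x, y). LI u. LI v. K (x, y, ?c * u + ?c * v, ?c * u - ?c * v)) \<in> borel_measurable bor2" by measurable
    from nn_integral_rotate[OF this c, unfolded prod.case] show ?thesis .
  qed
  \<comment> \<open>A symmetry beyond permutations of the original coordinates appears: apart from
    the order of \<open>z2\<close> and \<open>z3\<close>, the domain given by positivity and
    \<open>z1 + z2 + z3 < \<xi>\<close> is symmetric in the new coordinates. Placing
    \<open>z1\<close> above \<open>z2\<close> gives the extra factor 3, and
    \<open>72 = 24 * 3\<close>.\<close>
  also have "\<dots> = (LI \<xi>. LI z1. LI z2. LI z3. (if z3 < z2 then H \<xi> (z1, z2, z3) else 0))"
  proof (intro nn_integral_cong)
    fix \<xi> z u v :: real
    have gen: "r * \<xi> - r * z < r * \<xi> + r * z \<longleftrightarrow> 0 < z" "r * u - r * v < r * u + r * v \<longleftrightarrow> 0 < v"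
      "0 < r * u - r * v \<longleftrightarrow> v < u" "r * u + r * v < r * \<xi> - r * z \<longleftrightarrow> z + u + v < \<xi>" if "0 < r" for r
    proof -
      have "r * \<xi> - r * z < r * \<xi> + r * z \<longleftrightarrow> 0 < r * z" "r * u - r * v < r * u + r * v \<longleftrightarrow> 0 < r * v" by linarith+
      then show "r * \<xi> - r * z < r * \<xi> + r * z \<longleftrightarrow> 0 < z" "r * u - r * v < r * u + r * v \<longleftrightarrow> 0 < v"
        using that by (simp_all add: zero_less_mult_iff)
      show "0 < r * u - r * v \<longleftrightarrow> v < u" using that by simp
      have "r * u + r * v < r * \<xi> - r * z \<longleftrightarrow> r * (z + u + v) < r * \<xi>" by (simp add: algebra_simps)
      then show "r * u + r * v < r * \<xi> - r * z \<longleftrightarrow> z + u + v < \<xi>" using that by simp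
    qed
    note gen[OF c(1)]
    moreover have "(?c * \<xi> + ?c * z)\<^sup>2 + (?c * \<xi> - ?c * z)\<^sup>2 + (?c * u + ?c * v)\<^sup>2 + (?c * u - ?c * v)\<^sup>2 = \<xi>\<^sup>2 + z\<^sup>2 + u\<^sup>2 + v\<^sup>2"
      using sq[of \<xi> z] sq[of u v] by linarith
    ultimately show "K (?c * \<xi> + ?c * z, ?c * \<xi> - ?c * z, ?c * u + ?c * v, ?c * u - ?c * v) =
        (if v < u then H \<xi> (z, u, v) else 0)"
      unfolding K_def H_def prod.case lin by auto
  qed
  also have "\<dots> = (LI \<xi>. 3 * (LI z1. LI z2. LI z3. L \<xi> (z1, z2, z3)))"
  proof (rule nn_integral_cong)
    fix \<xi> :: real
    have "H \<xi> (x, y, z) = H \<xi> (y, x, z)" "H \<xi> (x, y, z) = H \<xi> (x, z, y)" for x y z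
      by (auto simp: H_def ac_simps)
    from nn_integral_insert3[OF Hm this]
    show "(LI z1. LI z2. LI z3. (if z3 < z2 then H \<xi> (z1, z2, z3) else 0)) =
        3 * (LI z1. LI z2. LI z3. L \<xi> (z1, z2, z3))"
      unfolding L_def prod.case .
  qed
  also have "\<dots> = (LI \<xi>. 3 * (LI h. LI a. LI b. (if 0 < b \<and> b < sqrt 3 * a \<and> sqrt 2 * a < h \<and> sqrt 3 * h < \<xi>
        then F (\<xi>\<^sup>2 + h\<^sup>2 + a\<^sup>2 + b\<^sup>2, sqrt 2 * \<xi>) else 0)))"
  proof (rule nn_integral_cong, rule arg_cong[where f = "(*) 3"])
    fix \<xi> :: real
    \<comment> \<open>After a turn of \<open>z1\<close>, \<open>z2\<close> by 45 degrees, this angle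
      makes \<open>h\<close> the coordinate in direction \<open>(1, 1, 1)\<close>, so that
      \<open>z1 + z2 + z3 = sqrt 3 * h\<close> and the conditions form a chain, each relating two
      neighbouring coordinates.\<close>
    let ?d = "sqrt 2 / sqrt 3 :: real" and ?e = "1 / sqrt 3 :: real"
    have de: "0 < ?d" "?d\<^sup>2 + ?e\<^sup>2 = 1" by (simp_all add: power_divide)
    have "(\<lambda>(z1, z2). LI z3. L \<xi> (z1, z2, z3)) \<in> borel_measurable bor2" by measurable
    from nn_integral_rotate[OF this c, unfolded prod.case]
    have "(LI z1. LI z2. LI z3. L \<xi> (z1, z2, z3)) =
      (LI p. LI b. LI z3. L \<xi> (?c * p + ?c * b, ?c * p - ?c * b, z3))" .
    also have "\<dots> = (LI p. LI z3. LI b. L \<xi> (?c * p + ?c * b, ?c * p - ?c * b, z3))"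
      by (rule nn_integral_cong, rule nn_integral_swap) measurable
    also have "\<dots> = (LI h. LI a. LI b. L \<xi> (?c * (?d * h + ?e * a) + ?c * b, ?c * (?d * h + ?e * a) - ?c * b, ?e * h - ?d * a))"
    proof -
      have "(\<lambda>(p, z3). LI b. L \<xi> (?c * p + ?c * b, ?c * p - ?c * b, z3)) \<in> borel_measurable bor2" by measurable
      from nn_integral_rotate[OF this de, unfolded prod.case] show ?thesis .
    qed
    also have "\<dots> = (LI h. LI a. LI b. (if 0 < b \<and> b < sqrt 3 * a \<and> sqrt 2 * a < h \<and> sqrt 3 * h < \<xi>
        then F (\<xi>\<^sup>2 + h\<^sup>2 + a\<^sup>2 + b\<^sup>2, sqrt 2 * \<xi>) else 0))"
    proof (intro nn_integral_cong)
      fix h a b :: real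
      define p where "p = ?d * h + ?e * a"
      define z1 where "z1 = ?c * p + ?c * b"
      define z2 where "z2 = ?c * p - ?c * b"
      define z3 where "z3 = ?e * h - ?d * a"
      have s33: "sqrt 3 * sqrt 3 = (3::real)" and s22: "sqrt 2 * sqrt 2 = (2::real)" by simp_all
      have p3: "sqrt 3 * p = sqrt 2 * h + a" and z33: "sqrt 3 * z3 = h - sqrt 2 * a"
        by (simp_all add: p_def z3_def algebra_simps)
      have z2': "sqrt 2 * z2 = p - b" and z1': "sqrt 2 * z1 = p + b"
        by (simp_all add: z1_def z2_def algebra_simps)
      have "sqrt 3 * (p - sqrt 2 * z3) = sqrt 3 * (sqrt 3 * a)"
      proof -
        have "sqrt 3 * (p - sqrt 2 * z3) = sqrt 3 * p - sqrt 2 * (sqrt 3 * z3)" by (simp add: algebra_simps)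
        also have "\<dots> = 3 * a" unfolding p3 z33 using s22 by (simp add: algebra_simps)
        finally show ?thesis using s33 by (simp add: mult.assoc[symmetric])
      qed
      then have A: "p - sqrt 2 * z3 = sqrt 3 * a" by simp
      have "sqrt 3 * (sqrt 2 * p + z3) = sqrt 3 * (sqrt 3 * h)"
      proof -
        have "sqrt 3 * (sqrt 2 * p + z3) = sqrt 2 * (sqrt 3 * p) + sqrt 3 * z3" by (simp add: algebra_simps)
        also have "\<dots> = 3 * h" unfolding p3 z33 using s22 by (simp add: algebra_simps mult.assoc[symmetric])
        finally show ?thesis using s33 by (simp add: mult.assoc[symmetric])
      qed
      then have B: "sqrt 2 * p + z3 = sqrt 3 * h" by simp
      have zz: "z1 + z2 = sqrt 2 * p" unfolding z1_def z2_def by (rule lin)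
      have c1: "z2 < z1 \<longleftrightarrow> 0 < b"
      proof -
        have "z2 < z1 \<longleftrightarrow> sqrt 2 * z2 < sqrt 2 * z1" by simp
        then show ?thesis unfolding z2' z1' by linarith
      qed
      have c2: "z3 < z2 \<longleftrightarrow> b < sqrt 3 * a"
      proof -
        have "z3 < z2 \<longleftrightarrow> sqrt 2 * z3 < sqrt 2 * z2" by simp
        also have "\<dots> \<longleftrightarrow> b < sqrt 3 * a" unfolding z2' A[symmetric] by linarith
        finally show ?thesis .
      qed
      have c3: "0 < z3 \<longleftrightarrow> sqrt 2 * a < h"
      proof -
        have "0 < z3 \<longleftrightarrow> 0 < sqrt 3 * z3" by (simp add: zero_less_mult_iff)
        then show ?thesis unfolding z33 by simp
      qed
      have c4: "z1 + z2 + z3 < \<xi> \<longleftrightarrow> sqrt 3 * h < \<xi>" unfolding zz B ..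
      have q: "z1\<^sup>2 + z2\<^sup>2 + z3\<^sup>2 = h\<^sup>2 + a\<^sup>2 + b\<^sup>2"
      proof -
        have "z1\<^sup>2 + z2\<^sup>2 = p\<^sup>2 + b\<^sup>2" unfolding z1_def z2_def by (rule sq)
        moreover have "p\<^sup>2 + z3\<^sup>2 = (?d\<^sup>2 + ?e\<^sup>2) * (h\<^sup>2 + a\<^sup>2)"
          unfolding p_def z3_def by (simp add: power2_eq_square algebra_simps)
        ultimately show ?thesis using de(2) by simp
      qed
      have q': "\<xi>\<^sup>2 + z1\<^sup>2 + z2\<^sup>2 + z3\<^sup>2 = \<xi>\<^sup>2 + h\<^sup>2 + a\<^sup>2 + b\<^sup>2" using q by linarith
      have "L \<xi> (z1, z2, z3) = (if 0 < b \<and> b < sqrt 3 * a \<and> sqrt 2 * a < h \<and> sqrt 3 * h < \<xi>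
        then F (\<xi>\<^sup>2 + h\<^sup>2 + a\<^sup>2 + b\<^sup>2, sqrt 2 * \<xi>) else 0)"
        unfolding L_def H_def prod.case q' c1[symmetric] c2[symmetric] c3[symmetric] c4[symmetric] by auto
      then show "L \<xi> (?c * (?d * h + ?e * a) + ?c * b, ?c * (?d * h + ?e * a) - ?c * b, ?e * h - ?d * a) =
        (if 0 < b \<and> b < sqrt 3 * a \<and> sqrt 2 * a < h \<and> sqrt 3 * h < \<xi>
        then F (\<xi>\<^sup>2 + h\<^sup>2 + a\<^sup>2 + b\<^sup>2, sqrt 2 * \<xi>) else 0)"
        unfolding z1_def z2_def z3_def p_def .
    qed
    finally show "(LI z1. LI z2. LI z3. L \<xi> (z1, z2, z3)) =
      (LI h. LI a. LI b. (if 0 < b \<and> b < sqrt 3 * a \<and> sqrt 2 * a < h \<and> sqrt 3 * h < \<xi>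
        then F (\<xi>\<^sup>2 + h\<^sup>2 + a\<^sup>2 + b\<^sup>2, sqrt 2 * \<xi>) else 0))" .
  qed
  also have "\<dots> = 3 * (LI \<xi>. LI h. LI a. LI b. (if 0 < b \<and> b < sqrt 3 * a \<and> sqrt 2 * a < h \<and> sqrt 3 * h < \<xi>
        then F (\<xi>\<^sup>2 + h\<^sup>2 + a\<^sup>2 + b\<^sup>2, sqrt 2 * \<xi>) else 0))"
    by (rule nn_integral_cmult) measurable
  finally show ?thesis by (simp add: mult.assoc[symmetric])
qed

text \<open>In the coordinates \<open>b = \<tau> a\<close>, \<open>a = \<alpha> h\<close>, \<open>h = \<eta> \<xi>\<close> the simplex becomes a box.\<close>

lemma nn_integral_simplex_box:
  fixes F :: "real \<times> real \<Rightarrow> ennreal"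
  assumes F[measurable]: "F \<in> borel_measurable bor2"
  shows "(LI \<xi>. LI h. LI a. LI b. (if 0 < b \<and> b < sqrt 3 * a \<and> sqrt 2 * a < h \<and> sqrt 3 * h < \<xi>
        then F (\<xi>\<^sup>2 + h\<^sup>2 + a\<^sup>2 + b\<^sup>2, sqrt 2 * \<xi>) else 0)) =
    (LI \<tau>. LI \<eta>. LI \<alpha>. LI \<xi>. (if 0 < \<tau> \<and> \<tau> < sqrt 3 \<and> 0 < \<eta> \<and> \<eta> < 1 / sqrt 3 \<and> 0 < \<alpha> \<and> \<alpha> < 1 / sqrt 2 \<and> 0 < \<xi>
        then ennreal (\<xi> ^ 3 * \<eta>\<^sup>2 * \<alpha>) * F (\<xi>\<^sup>2 * (1 + \<eta>\<^sup>2 * (1 + \<alpha>\<^sup>2 * (1 + \<tau>\<^sup>2))), sqrt 2 * \<xi>) else 0))"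
proof -
  define f where "f p = (case p of (\<xi>, h, a, b) \<Rightarrow> (if 0 < b \<and> b < sqrt 3 * a \<and> sqrt 2 * a < h \<and> sqrt 3 * h < \<xi>
        then F (\<xi>\<^sup>2 + h\<^sup>2 + a\<^sup>2 + b\<^sup>2, sqrt 2 * \<xi>) else 0))" for p :: "real \<times> real \<times> real \<times> real"
  have [measurable]: "f \<in> borel_measurable bor4" unfolding f_def by measurable
  define W where "W p = (case p of (\<xi>, \<eta>, \<alpha>, \<tau>) \<Rightarrow> (if 0 < \<tau> \<and> \<tau> < sqrt 3 \<and> 0 < \<eta> \<and> \<eta> < 1 / sqrt 3 \<and> 0 < \<alpha> \<and> \<alpha> < 1 / sqrt 2 \<and> 0 < \<xi>
        then ennreal (\<xi> ^ 3 * \<eta>\<^sup>2 * \<alpha>) * F (\<xi>\<^sup>2 * (1 + \<eta>\<^sup>2 * (1 + \<alpha>\<^sup>2 * (1 + \<tau>\<^sup>2))), sqrt 2 * \<xi>) else 0))" for p :: "real \<times> real \<times> real \<times> real"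
  have [measurable]: "W \<in> borel_measurable bor4" unfolding W_def by measurable
  have fz: "f (\<xi>, h, a, b) = 0" if "b \<le> 0 \<or> a \<le> 0 \<or> h \<le> 0 \<or> \<xi> \<le> 0" for \<xi> h a b
  proof -
    have "\<not> (0 < b \<and> b < sqrt 3 * a \<and> sqrt 2 * a < h \<and> sqrt 3 * h < \<xi>)"
    proof
      assume *: "0 < b \<and> b < sqrt 3 * a \<and> sqrt 2 * a < h \<and> sqrt 3 * h < \<xi>"
      then have "0 < sqrt 3 * a" by linarith
      then have a: "0 < a" by (simp add: zero_less_mult_iff)
      then have "0 < sqrt 2 * a" by simp
      then have h: "0 < h" using * by linarith
      then have "0 < sqrt 3 * h" by simp
      then have "0 < \<xi>" using * by linarith
      then show False using that * a h by linarith
    qed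
    then show ?thesis by (auto simp: f_def)
  qed
  have "(LI \<xi>. LI h. LI a. LI b. f (\<xi>, h, a, b)) =
      (LI \<xi>. LI h. LI a. LI \<tau>. ennreal a * f (\<xi>, h, a, a * \<tau>))"
    by (intro nn_integral_cong nn_integral_scale_pos) (measurable, simp_all add: fz)
  also have "\<dots> = (LI \<xi>. LI h. LI \<alpha>. ennreal h * (LI \<tau>. ennreal (h * \<alpha>) * f (\<xi>, h, h * \<alpha>, h * \<alpha> * \<tau>)))"
    by (rule nn_integral_cong, rule nn_integral_cong, rule nn_integral_scale_pos) (measurable, simp_all add: fz)
  also have "\<dots> = (LI \<xi>. LI \<eta>. ennreal \<xi> * (LI \<alpha>. ennreal (\<xi> * \<eta>) * (LI \<tau>. ennreal (\<xi> * \<eta> * \<alpha>) * f (\<xi>, \<xi> * \<eta>, \<xi> * \<eta> * \<alpha>, \<xi> * \<eta> * \<alpha> * \<tau>))))"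
    by (rule nn_integral_cong, rule nn_integral_scale_pos) (measurable, simp_all add: fz)
  also have "\<dots> = (LI \<xi>. LI \<eta>. LI \<alpha>. LI \<tau>. ennreal \<xi> * (ennreal (\<xi> * \<eta>) * (ennreal (\<xi> * \<eta> * \<alpha>) * f (\<xi>, \<xi> * \<eta>, \<xi> * \<eta> * \<alpha>, \<xi> * \<eta> * \<alpha> * \<tau>))))"
    by (simp add: nn_integral_cmult)
  also have "\<dots> = (LI \<xi>. LI \<eta>. LI \<alpha>. LI \<tau>. W (\<xi>, \<eta>, \<alpha>, \<tau>))"
  proof (intro nn_integral_cong)
    fix \<xi> \<eta> \<alpha> \<tau> :: real
    let ?l = "ennreal \<xi> * (ennreal (\<xi> * \<eta>) * (ennreal (\<xi> * \<eta> * \<alpha>) * f (\<xi>, \<xi> * \<eta>, \<xi> * \<eta> * \<alpha>, \<xi> * \<eta> * \<alpha> * \<tau>)))"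
    show "?l = W (\<xi>, \<eta>, \<alpha>, \<tau>)"
    proof (cases "0 < \<xi> \<and> 0 < \<eta> \<and> 0 < \<alpha> \<and> 0 < \<tau>")
      case True
      then have pos: "0 < \<xi>" "0 < \<xi> * \<eta>" "0 < \<xi> * \<eta> * \<alpha>" "0 < \<tau>" by simp_all
      have "\<xi> * \<eta> * \<alpha> * \<tau> < sqrt 3 * (\<xi> * \<eta> * \<alpha>) \<longleftrightarrow> \<tau> < sqrt 3"
        using pos(3) by (metis mult.commute mult_less_cancel_left_pos)
      moreover have "sqrt 2 * (\<xi> * \<eta> * \<alpha>) < \<xi> * \<eta> \<longleftrightarrow> \<alpha> < 1 / sqrt 2"
        using mult_less_cancel_left_pos[OF pos(2), of "sqrt 2 * \<alpha>" 1] by (simp add: mult_ac pos_less_divide_eq)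
      moreover have "sqrt 3 * (\<xi> * \<eta>) < \<xi> \<longleftrightarrow> \<eta> < 1 / sqrt 3"
        using mult_less_cancel_left_pos[OF pos(1), of "sqrt 3 * \<eta>" 1] by (simp add: mult_ac pos_less_divide_eq)
      moreover have "\<xi>\<^sup>2 + (\<xi> * \<eta>)\<^sup>2 + (\<xi> * \<eta> * \<alpha>)\<^sup>2 + (\<xi> * \<eta> * \<alpha> * \<tau>)\<^sup>2 = \<xi>\<^sup>2 * (1 + \<eta>\<^sup>2 * (1 + \<alpha>\<^sup>2 * (1 + \<tau>\<^sup>2)))"
        by (simp add: power2_eq_square algebra_simps)
      moreover have "ennreal \<xi> * (ennreal (\<xi> * \<eta>) * (ennreal (\<xi> * \<eta> * \<alpha>) * z)) = ennreal (\<xi> ^ 3 * \<eta>\<^sup>2 * \<alpha>) * z" for z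
      proof -
        have eq: "\<xi> ^ 3 * \<eta>\<^sup>2 * \<alpha> = \<xi> * ((\<xi> * \<eta>) * (\<xi> * \<eta> * \<alpha>))" by (simp add: power2_eq_square power3_eq_cube)
        have "ennreal a * (ennreal b * (ennreal c * z)) = ennreal (a * (b * c)) * z" if "0 \<le> a" "0 \<le> b" "0 \<le> c" for a b c
          using that by (simp add: ennreal_mult mult.assoc)
        then show ?thesis unfolding eq using pos by simp
      qed
      ultimately show ?thesis using True pos unfolding f_def W_def prod.case by auto
    next
      case False
      then have "W (\<xi>, \<eta>, \<alpha>, \<tau>) = 0" by (auto simp: W_def)
      moreover have "?l = 0"
      proof -
        have "\<xi> \<le> 0 \<or> \<xi> * \<eta> \<le> 0 \<or> \<xi> * \<eta> * \<alpha> \<le> 0 \<or> \<xi> * \<eta> * \<alpha> * \<tau> \<le> 0"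
          using False by (metis mult_nonneg_nonpos not_less less_imp_le)
        then show ?thesis using fz by auto
      qed
      ultimately show ?thesis by simp
    qed
  qed
  \<comment> \<open>The reordering puts \<open>\<xi>\<close> innermost and \<open>\<tau>\<close>
    outermost: the integrals over \<open>\<xi>\<close>, \<open>\<alpha>\<close> and
    \<open>\<eta>\<close> have explicit antiderivatives, the one over \<open>\<tau>\<close> is the
    hard one.\<close>
  also have "\<dots> = (LI \<xi>. LI \<eta>. LI \<tau>. LI \<alpha>. W (\<xi>, \<eta>, \<alpha>, \<tau>))"
    by (rule nn_integral_cong, rule nn_integral_cong, rule nn_integral_swap) measurable
  also have "\<dots> = (LI \<xi>. LI \<tau>. LI \<eta>. LI \<alpha>. W (\<xi>, \<eta>, \<alpha>, \<tau>))"
    by (rule nn_integral_cong, rule nn_integral_swap) measurable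
  also have "\<dots> = (LI \<tau>. LI \<xi>. LI \<eta>. LI \<alpha>. W (\<xi>, \<eta>, \<alpha>, \<tau>))"
    by (rule nn_integral_swap) measurable
  also have "\<dots> = (LI \<tau>. LI \<eta>. LI \<xi>. LI \<alpha>. W (\<xi>, \<eta>, \<alpha>, \<tau>))"
    by (rule nn_integral_cong, rule nn_integral_swap) measurable
  also have "\<dots> = (LI \<tau>. LI \<eta>. LI \<alpha>. LI \<xi>. W (\<xi>, \<eta>, \<alpha>, \<tau>))"
    by (rule nn_integral_cong, rule nn_integral_cong, rule nn_integral_swap) measurable
  finally show ?thesis unfolding f_def W_def prod.case .
qed

section \<open>The volume of the polytope\<close>

text \<open>Common evaluation for the volume and the Gaussian weight: \<open>xi\<close> supplies the
  radial integral as a function of \<open>s\<close>, then \<open>nn_integral_eta\<close> applies.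
  Nonnegativity of the result is recorded because \<open>ennreal\<close> would turn a negative value
  into 0.\<close>

lemma nn_integral_box:
  fixes F :: "real \<times> real \<Rightarrow> ennreal" and \<Phi> \<Gamma> \<Lambda> :: "real \<Rightarrow> real"
  assumes F[measurable]: "F \<in> borel_measurable bor2"
    and D: "\<And>s. 0 \<le> s \<Longrightarrow> s < 1 \<Longrightarrow> (\<Gamma> has_real_derivative \<Phi> s / 2) (at s)"
    and nn: "\<And>s. 0 \<le> s \<Longrightarrow> s < 1 \<Longrightarrow> 0 \<le> \<Phi> s"
    and E: "\<And>x. 0 \<le> x \<Longrightarrow> x < 1 \<Longrightarrow> (\<Lambda> has_real_derivative \<Gamma> (x\<^sup>2)) (at x)" and z: "\<Lambda> 0 = 0"
    and xi: "\<And>s. 0 \<le> s \<Longrightarrow> s < 1 \<Longrightarrow>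
      (LI \<xi>. (if 0 < \<xi> then ennreal (\<xi> ^ 3) * F (\<xi>\<^sup>2 * (1 + s), sqrt 2 * \<xi>) else 0)) = ennreal (\<Phi> s)"
  defines "k \<equiv> \<lambda>\<tau>. sqrt (1 + (1 + \<tau>\<^sup>2) / 2)"
  shows "(LI \<tau>. LI \<eta>. LI \<alpha>. LI \<xi>. (if 0 < \<tau> \<and> \<tau> < sqrt 3 \<and> 0 < \<eta> \<and> \<eta> < 1 / sqrt 3 \<and> 0 < \<alpha> \<and> \<alpha> < 1 / sqrt 2 \<and> 0 < \<xi>
        then ennreal (\<xi> ^ 3 * \<eta>\<^sup>2 * \<alpha>) * F (\<xi>\<^sup>2 * (1 + \<eta>\<^sup>2 * (1 + \<alpha>\<^sup>2 * (1 + \<tau>\<^sup>2))), sqrt 2 * \<xi>) else 0)) =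
    (LI \<tau>. ennreal ((\<Lambda> (k \<tau> / sqrt 3) / k \<tau> - \<Lambda> (1 / sqrt 3)) / (1 + \<tau>\<^sup>2)) * indicator {0<..<sqrt 3} \<tau>)" (is "?L = ?R")
    and "\<And>\<tau>. 0 < \<tau> \<Longrightarrow> \<tau> < sqrt 3 \<Longrightarrow> 0 \<le> (\<Lambda> (k \<tau> / sqrt 3) / k \<tau> - \<Lambda> (1 / sqrt 3)) / (1 + \<tau>\<^sup>2)"
proof -
  have m: "0 < 1 + \<tau>\<^sup>2" "1 + \<tau>\<^sup>2 < 4" if "0 < \<tau>" "\<tau> < sqrt 3" for \<tau> :: real
  proof -
    have "\<tau>\<^sup>2 < (sqrt 3)\<^sup>2" using that by (intro power_strict_mono) auto
    then show "1 + \<tau>\<^sup>2 < 4" by simp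
  qed (simp add: add_pos_nonneg)
  note eta = nn_integral_eta[where \<Phi> = \<Phi> and \<Gamma> = \<Gamma> and \<Lambda> = \<Lambda>, OF D nn E z]
  show "0 \<le> (\<Lambda> (k \<tau> / sqrt 3) / k \<tau> - \<Lambda> (1 / sqrt 3)) / (1 + \<tau>\<^sup>2)" if "0 < \<tau>" "\<tau> < sqrt 3" for \<tau>
    unfolding k_def by (rule eta(2)[OF _ _ _ _ _ _ m[OF that]])
  show "?L = ?R"
  proof (rule nn_integral_cong)
    fix \<tau> :: real
    let ?w = "\<lambda>\<eta> \<alpha> \<xi>. (if 0 < \<tau> \<and> \<tau> < sqrt 3 \<and> 0 < \<eta> \<and> \<eta> < 1 / sqrt 3 \<and> 0 < \<alpha> \<and> \<alpha> < 1 / sqrt 2 \<and> 0 < \<xi>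
        then ennreal (\<xi> ^ 3 * \<eta>\<^sup>2 * \<alpha>) * F (\<xi>\<^sup>2 * (1 + \<eta>\<^sup>2 * (1 + \<alpha>\<^sup>2 * (1 + \<tau>\<^sup>2))), sqrt 2 * \<xi>) else 0)"
    show "(LI \<eta>. LI \<alpha>. LI \<xi>. ?w \<eta> \<alpha> \<xi>) =
      ennreal ((\<Lambda> (k \<tau> / sqrt 3) / k \<tau> - \<Lambda> (1 / sqrt 3)) / (1 + \<tau>\<^sup>2)) * indicator {0<..<sqrt 3} \<tau>"
    proof (cases "0 < \<tau> \<and> \<tau> < sqrt 3")
      case True
      then have m': "0 < 1 + \<tau>\<^sup>2" "1 + \<tau>\<^sup>2 < 4" using m by auto
      have "(LI \<eta>. LI \<alpha>. LI \<xi>. ?w \<eta> \<alpha> \<xi>) =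
        (LI \<eta>. (LI x. ennreal (\<eta>\<^sup>2 * x * \<Phi> (\<eta>\<^sup>2 * (1 + x\<^sup>2 * (1 + \<tau>\<^sup>2)))) * indicator {0<..<1 / sqrt 2} x)
          * indicator {0<..<1 / sqrt 3} \<eta>)"
      proof (rule nn_integral_cong)
        fix \<eta> :: real
        show "(LI \<alpha>. LI \<xi>. ?w \<eta> \<alpha> \<xi>) =
          (LI x. ennreal (\<eta>\<^sup>2 * x * \<Phi> (\<eta>\<^sup>2 * (1 + x\<^sup>2 * (1 + \<tau>\<^sup>2)))) * indicator {0<..<1 / sqrt 2} x)
          * indicator {0<..<1 / sqrt 3} \<eta>"
        proof (cases "0 < \<eta> \<and> \<eta> < 1 / sqrt 3")
          case eta: True
          have "(LI \<xi>. ?w \<eta> \<alpha> \<xi>) =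
            ennreal (\<eta>\<^sup>2 * \<alpha> * \<Phi> (\<eta>\<^sup>2 * (1 + \<alpha>\<^sup>2 * (1 + \<tau>\<^sup>2)))) * indicator {0<..<1 / sqrt 2} \<alpha>" for \<alpha>
          proof (cases "0 < \<alpha> \<and> \<alpha> < 1 / sqrt 2")
            case al: True
            let ?s = "\<eta>\<^sup>2 * (1 + \<alpha>\<^sup>2 * (1 + \<tau>\<^sup>2))"
            have "\<eta>\<^sup>2 < (1 / sqrt 3)\<^sup>2" using eta by (intro power_strict_mono) auto
            then have e: "\<eta>\<^sup>2 < 1 / 3" by (simp add: power_divide)
            have "\<alpha>\<^sup>2 < (1 / sqrt 2)\<^sup>2" using al by (intro power_strict_mono) auto
            then have "\<alpha>\<^sup>2 < 1 / 2" by (simp add: power_divide)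
            \<comment> \<open>On the box \<open>?s\<close> is thus at most
              \<open>3 * \<eta>^2\<close>, which is below 1, as \<open>xi\<close> demands.\<close>
            then have "\<alpha>\<^sup>2 * (1 + \<tau>\<^sup>2) \<le> 1 / 2 * 4" using m' by (intro mult_mono) auto
            then have "?s \<le> \<eta>\<^sup>2 * 3" by (intro mult_left_mono) auto
            then have s: "?s < 1" using e by linarith
            have s0: "0 \<le> ?s" using m' by (intro mult_nonneg_nonneg add_nonneg_nonneg) auto
            have "(LI \<xi>. ?w \<eta> \<alpha> \<xi>) =
              (LI \<xi>. ennreal (\<eta>\<^sup>2 * \<alpha>) * (if 0 < \<xi> then ennreal (\<xi> ^ 3) * F (\<xi>\<^sup>2 * (1 + ?s), sqrt 2 * \<xi>) else 0))"
            proof (rule nn_integral_cong)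
              fix \<xi> :: real
              have "ennreal (\<xi> ^ 3 * \<eta>\<^sup>2 * \<alpha>) = ennreal (\<eta>\<^sup>2 * \<alpha>) * ennreal (\<xi> ^ 3)" if "0 < \<xi>"
                using that al by (subst ennreal_mult[symmetric]) (auto simp: mult_ac)
              then show "?w \<eta> \<alpha> \<xi> = ennreal (\<eta>\<^sup>2 * \<alpha>) * (if 0 < \<xi> then ennreal (\<xi> ^ 3) * F (\<xi>\<^sup>2 * (1 + ?s), sqrt 2 * \<xi>) else 0)"
                using True eta al by (auto simp: mult.assoc)
            qed
            also have "\<dots> = ennreal (\<eta>\<^sup>2 * \<alpha>) * ennreal (\<Phi> ?s)"
              by (subst nn_integral_cmult) (measurable, simp only: xi[OF s0 s])
            also have "\<dots> = ennreal (\<eta>\<^sup>2 * \<alpha> * \<Phi> ?s)"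
              using al by (subst ennreal_mult'[symmetric]) auto
            finally show ?thesis using al by simp
          qed auto
          then show ?thesis using eta by simp
        qed auto
      qed
      also have "\<dots> = ennreal ((\<Lambda> (k \<tau> / sqrt 3) / k \<tau> - \<Lambda> (1 / sqrt 3)) / (1 + \<tau>\<^sup>2))"
        unfolding k_def by (rule eta(1)[OF _ _ _ _ _ _ m'])
      finally show ?thesis using True by simp
    qed auto
  qed
qed

lemma gaussian_orthant:
  "(LI a. LI b. LI c. LI d. (if 0 \<le> a \<and> 0 \<le> b \<and> 0 \<le> c \<and> 0 \<le> d then ennreal (exp (- (a\<^sup>2 + b\<^sup>2 + c\<^sup>2 + d\<^sup>2))) else 0)) = ennreal (pi\<^sup>2 / 16)"
proof -
  define e where "e x = (if 0 \<le> x then ennreal (exp (- x\<^sup>2)) else 0)" for x :: real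
  have [measurable]: "e \<in> borel_measurable borel" unfolding e_def by measurable
  have "(LI x. ennreal (indicator {0..} x *\<^sub>R exp (- x\<^sup>2))) = ennreal (sqrt pi / 2)"
    using gaussian_moment_0 by (subst nn_integral_eq_integral) (auto simp: has_bochner_integral_iff)
  moreover have "ennreal (indicator {0..} x *\<^sub>R exp (- x\<^sup>2)) = e x" for x
    by (simp add: e_def indicator_def)
  ultimately have g: "(LI x. e x) = ennreal (sqrt pi / 2)" by simp
  have "(LI a. LI b. LI c. LI d. (if 0 \<le> a \<and> 0 \<le> b \<and> 0 \<le> c \<and> 0 \<le> d then ennreal (exp (- (a\<^sup>2 + b\<^sup>2 + c\<^sup>2 + d\<^sup>2))) else 0)) = (LI a. LI b. LI c. LI d. e a * (e b * (e c * e d)))"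
  proof (intro nn_integral_cong)
    fix a b c d :: real
    have "exp (- (a\<^sup>2 + b\<^sup>2 + c\<^sup>2 + d\<^sup>2)) = exp (- a\<^sup>2) * (exp (- b\<^sup>2) * (exp (- c\<^sup>2) * exp (- d\<^sup>2)))"
      by (simp flip: exp_add)
    then have "ennreal (exp (- (a\<^sup>2 + b\<^sup>2 + c\<^sup>2 + d\<^sup>2))) =
        ennreal (exp (- a\<^sup>2)) * (ennreal (exp (- b\<^sup>2)) * (ennreal (exp (- c\<^sup>2)) * ennreal (exp (- d\<^sup>2))))"
      by (simp add: ennreal_mult'')
    then show "(if 0 \<le> a \<and> 0 \<le> b \<and> 0 \<le> c \<and> 0 \<le> d then ennreal (exp (- (a\<^sup>2 + b\<^sup>2 + c\<^sup>2 + d\<^sup>2))) else 0) = e a * (e b * (e c * e d))"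
      by (auto simp: e_def)
  qed
  also have "\<dots> = ennreal (sqrt pi / 2) * (ennreal (sqrt pi / 2) * (ennreal (sqrt pi / 2) * ennreal (sqrt pi / 2)))"
    by (simp add: nn_integral_cmult nn_integral_multc g)
  also have "\<dots> = ennreal (sqrt pi / 2 * (sqrt pi / 2 * (sqrt pi / 2 * (sqrt pi / 2))))"
    by (simp only: ennreal_mult' real_sqrt_ge_zero pi_ge_zero divide_nonneg_pos zero_less_numeral)
  also have "sqrt pi / 2 * (sqrt pi / 2 * (sqrt pi / 2 * (sqrt pi / 2))) = pi\<^sup>2 / 16"
    by (simp add: power2_eq_square)
  finally show ?thesis .
qed

definition k4 :: "real \<Rightarrow> real" where
  "k4 \<tau> = sqrt (1 + (1 + \<tau>\<^sup>2) / 2)"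

text \<open>The integral over \<open>\<tau>\<close> is found indirectly: the Gaussian integral over
  the orthant is \<open>pi^2 / 16\<close>, and the same substitutions express it as 72 times the
  integral sought.\<close>

lemma nn_integral_gauss_remainder:
  "(LI \<tau>. ennreal ((- arctan (k4 \<tau> / sqrt 3) / 4 / k4 \<tau> + arctan (1 / sqrt 3) / 4) / (1 + \<tau>\<^sup>2)) * indicator {0<..<sqrt 3} \<tau>)
    = ennreal (pi\<^sup>2 / 1152)"
  "\<And>\<tau>. 0 < \<tau> \<Longrightarrow> \<tau> < sqrt 3 \<Longrightarrow> 0 \<le> (- arctan (k4 \<tau> / sqrt 3) / 4 / k4 \<tau> + arctan (1 / sqrt 3) / 4) / (1 + \<tau>\<^sup>2)"
proof -
  let ?F = "\<lambda>(q, s::real). ennreal (exp (- q))"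
  let ?h = "\<lambda>(a, b, c, d). if 0 \<le> a \<and> 0 \<le> b \<and> 0 \<le> c \<and> 0 \<le> d then ennreal (exp (- (a\<^sup>2 + b\<^sup>2 + c\<^sup>2 + d\<^sup>2))) else 0"
  let ?\<Phi> = "\<lambda>s::real. 1 / (2 * (1 + s)\<^sup>2)" and ?\<Gamma> = "\<lambda>s::real. - 1 / (4 * (1 + s))" and ?\<Lambda> = "\<lambda>x::real. - arctan x / 4"
  have F: "?F \<in> borel_measurable bor2" by measurable
  have h: "?h \<in> borel_measurable bor4" by measurable
  have D: "(?\<Gamma> has_real_derivative ?\<Phi> s / 2) (at s)" if "0 \<le> s" "s < 1" for s
  proof -
    have "(?\<Gamma> has_real_derivative (0 * (4 * (1 + s)) - (- 1) * 4) / ((4 * (1 + s)) * (4 * (1 + s)))) (at s)"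
      using that by (intro DERIV_divide DERIV_const) (auto intro!: derivative_eq_intros)
    also have "(0 * (4 * (1 + s)) - (- 1) * 4) / ((4 * (1 + s)) * (4 * (1 + s))) = ?\<Phi> s / 2"
    proof -
      have "(0 * (4 * y) - (- 1) * 4) / ((4 * y) * (4 * y)) = 1 / (2 * y\<^sup>2) / 2" for y :: real
        by (simp add: power2_eq_square)
      then show ?thesis by blast
    qed
    finally show ?thesis .
  qed
  have E: "(?\<Lambda> has_real_derivative ?\<Gamma> (x\<^sup>2)) (at x)" for x
  proof -
    have D0: "(?\<Lambda> has_real_derivative - inverse (1 + x\<^sup>2) / 4) (at x)"
      by (intro DERIV_cdivide DERIV_minus DERIV_arctan)
    have "- inverse y / 4 = - 1 / (4 * y)" for y :: real by (simp add: inverse_eq_divide)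
    from D0[unfolded this] show ?thesis .
  qed
  have xi: "(LI \<xi>. (if 0 < \<xi> then ennreal (\<xi> ^ 3) * ?F (\<xi>\<^sup>2 * (1 + s), sqrt 2 * \<xi>) else 0)) = ennreal (?\<Phi> s)"
    if "0 \<le> s" "s < 1" for s :: real
  proof -
    have "(LI \<xi>. (if 0 < \<xi> then ennreal (\<xi> ^ 3) * ?F (\<xi>\<^sup>2 * (1 + s), sqrt 2 * \<xi>) else 0)) =
        (LI x. ennreal (x ^ 3 * exp (- ((1 + s) * x\<^sup>2))) * indicator {0<..} x)"
      by (intro nn_integral_cong) (auto simp: ennreal_mult mult.commute)
    then show ?thesis using nn_integral_radial_gauss[of "1 + s"] that by simp
  qed
  note box = nn_integral_box[where F = ?F and \<Phi> = ?\<Phi> and \<Gamma> = ?\<Gamma> and \<Lambda> = ?\<Lambda>, OF F D _ E _ xi, folded k4_def]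
  have alg: "(- arctan (k4 \<tau> / sqrt 3) / 4 / k4 \<tau> - - arctan (1 / sqrt 3) / 4) / (1 + \<tau>\<^sup>2) =
      (- arctan (k4 \<tau> / sqrt 3) / 4 / k4 \<tau> + arctan (1 / sqrt 3) / 4) / (1 + \<tau>\<^sup>2)" for \<tau> by simp
  show "0 \<le> (- arctan (k4 \<tau> / sqrt 3) / 4 / k4 \<tau> + arctan (1 / sqrt 3) / 4) / (1 + \<tau>\<^sup>2)" if "0 < \<tau>" "\<tau> < sqrt 3" for \<tau>
    using box(2)[of \<tau>] that unfolding alg by simp
  define V where "V = (LI \<tau>. ennreal ((- arctan (k4 \<tau> / sqrt 3) / 4 / k4 \<tau> + arctan (1 / sqrt 3) / 4) / (1 + \<tau>\<^sup>2)) * indicator {0<..<sqrt 3} \<tau>)"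
  have "ennreal (pi\<^sup>2 / 16) = (LI x. LI y. LI z. LI w. ?h (x, y, z, w))"
    unfolding prod.case by (rule gaussian_orthant[symmetric])
  also have "\<dots> = 72 * V"
  proof (subst nn_integral_F4[OF h F])
    show "?h (x, y, z, w) = ?h (y, x, z, w)" "?h (x, y, z, w) = ?h (x, z, y, w)" "?h (x, y, z, w) = ?h (x, y, w, z)" for x y z w
      by (auto simp: ac_simps)
    show "?h (a, b, c, d) = ?F (a\<^sup>2 + b\<^sup>2 + c\<^sup>2 + d\<^sup>2, a + b)" if "0 < d" "d < c" "c < b" "b < a" for a b c d using that by simp
    show "?h (a, b, c, d) = 0" if "d < 0" for a b c d using that by simp
  qed (unfold nn_integral_simplex_box[OF F], subst box(1), simp_all add: V_def)
  finally have V: "72 * V = ennreal (pi\<^sup>2 / 16)" ..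
  have "V = ennreal (1 / 72) * (72 * V)"
    by (simp add: mult.assoc[symmetric] ennreal_mult'[symmetric] flip: ennreal_numeral)
  also have "\<dots> = ennreal (pi\<^sup>2 / 1152)" unfolding V by (subst ennreal_mult'[symmetric]) auto
  finally show "(LI \<tau>. ennreal ((- arctan (k4 \<tau> / sqrt 3) / 4 / k4 \<tau> + arctan (1 / sqrt 3) / 4) / (1 + \<tau>\<^sup>2)) * indicator {0<..<sqrt 3} \<tau>)
    = ennreal (pi\<^sup>2 / 1152)" unfolding V_def .
qed

section \<open>The volume integral in coordinates\<close>

definition vol_density :: "real \<times> real \<times> real \<times> real \<Rightarrow> ennreal" where
  "vol_density p = (case p of (a, b, c, d) \<Rightarrow> let t = sqrt (1 + (a\<^sup>2 + b\<^sup>2 + c\<^sup>2 + d\<^sup>2)) in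
     if 0 \<le> a \<and> 0 \<le> b \<and> 0 \<le> c \<and> 0 \<le> d \<and> a + b \<le> t \<and> a + c \<le> t \<and> a + d \<le> t \<and> b + c \<le> t \<and> b + d \<le> t \<and> c + d \<le> t
     then ennreal (1 / t) else 0)"

lemma vol_density_total:
  "(LI a. LI b. LI c. LI d. vol_density (a, b, c, d)) = ennreal (pi\<^sup>2 / 12)"
proof -
  \<comment> \<open>For decreasing coordinates the largest pair sum is \<open>a + b\<close>, so the
    six conditions on pairs reduce to one on \<open>s\<close>.\<close>
  let ?F = "\<lambda>(q, s). if s \<le> sqrt (1 + q) then ennreal (1 / sqrt (1 + q)) else 0"
  have F: "?F \<in> borel_measurable bor2" by measurable
  have h: "vol_density \<in> borel_measurable bor4" unfolding vol_density_def Let_def by measurable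
  have D: "(G_vol has_real_derivative H_vol s / 2) (at s)" if "0 \<le> s" "s < 1" for s
    using G_vol_deriv that by simp
  have xi: "(LI \<xi>. (if 0 < \<xi> then ennreal (\<xi> ^ 3) * ?F (\<xi>\<^sup>2 * (1 + s), sqrt 2 * \<xi>) else 0)) = ennreal (H_vol s)"
    if s: "0 \<le> s" "s < 1" for s
  proof -
    have "(LI \<xi>. (if 0 < \<xi> then ennreal (\<xi> ^ 3) * ?F (\<xi>\<^sup>2 * (1 + s), sqrt 2 * \<xi>) else 0)) =
        (LI x. ennreal (x ^ 3 / sqrt (1 + (1 + s) * x\<^sup>2)) * indicator {0<..<1 / sqrt (1 - s)} x)"
    proof (rule nn_integral_cong_AE, use AE_lborel_singleton[of "1 / sqrt (1 - s)"] in eventually_elim)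
      case (elim x)
      have iff: "sqrt 2 * x \<le> sqrt (1 + x\<^sup>2 * (1 + s)) \<longleftrightarrow> x \<le> 1 / sqrt (1 - s)" if "0 < x"
      proof -
        have "sqrt 2 * x \<le> sqrt (1 + x\<^sup>2 * (1 + s)) \<longleftrightarrow> (sqrt 2 * x)\<^sup>2 \<le> (sqrt (1 + x\<^sup>2 * (1 + s)))\<^sup>2"
          using that s by (intro power_mono_iff[symmetric]) (auto simp: add_nonneg_nonneg)
        also have "\<dots> \<longleftrightarrow> (sqrt (1 - s) * x)\<^sup>2 \<le> 1\<^sup>2"
          using s by (simp add: power_mult_distrib add_nonneg_nonneg algebra_simps)
        also have "\<dots> \<longleftrightarrow> sqrt (1 - s) * x \<le> 1"
          using that s by (intro power_mono_iff) auto
        also have "\<dots> \<longleftrightarrow> x \<le> 1 / sqrt (1 - s)" using s by (simp add: field_simps)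
        finally show ?thesis .
      qed
      show ?case
      proof (cases "0 < x")
        case True
        then have "ennreal (x ^ 3) * ennreal (1 / sqrt (1 + x\<^sup>2 * (1 + s))) = ennreal (x ^ 3 / sqrt (1 + (1 + s) * x\<^sup>2))"
          by (subst ennreal_mult'[symmetric]) (auto simp: mult.commute)
        then show ?thesis using True elim iff by (auto simp: indicator_def)
      qed simp
    qed
    then show ?thesis using nn_integral_radial_vol[OF s] by simp
  qed
  have L0: "L_vol 0 = 0" by (simp add: L_vol_def)
  note box = nn_integral_box[OF F D H_vol_nonneg L_vol_deriv L0 xi, folded k4_def]
  define e where "e \<tau> = 1 / (1 + \<tau>\<^sup>2)" for \<tau> :: real
  define v where "v \<tau> = (L_vol (k4 \<tau> / sqrt 3) / k4 \<tau> - L_vol (1 / sqrt 3)) / (1 + \<tau>\<^sup>2)" for \<tau>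
  define w where "w \<tau> = (- arctan (k4 \<tau> / sqrt 3) / 4 / k4 \<tau> + arctan (1 / sqrt 3) / 4) / (1 + \<tau>\<^sup>2)" for \<tau>
  define a where "a \<tau> = arctan (2 * k4 \<tau> / sqrt (3 - \<tau>\<^sup>2)) / (k4 \<tau> * (1 + \<tau>\<^sup>2))" for \<tau>
  let ?I = "\<lambda>f::real \<Rightarrow> real. LI \<tau>. ennreal (f \<tau>) * indicator {0<..<sqrt 3} \<tau>"
  have [measurable]: "e \<in> borel_measurable borel" "v \<in> borel_measurable borel" "w \<in> borel_measurable borel" "a \<in> borel_measurable borel"
    unfolding e_def v_def w_def a_def k4_def L_vol_def by measurable
  have Ie: "?I e = ennreal (pi / 3)"
  proof -
    have "?I e = ennreal (arctan (sqrt 3) - arctan 0)"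
      unfolding e_def
      by (rule nn_integral_FTC_cont(1))
        (auto intro!: derivative_eq_intros DERIV_isCont[OF DERIV_arctan] simp: inverse_eq_divide add_nonneg_nonneg)
    moreover have "arctan (sqrt 3) = pi / 3" using arctan_tan[of "pi / 3"] tan_60 by simp
    ultimately show ?thesis by simp
  qed
  have Iw: "?I w = ennreal (pi\<^sup>2 / 1152)" unfolding w_def by (rule nn_integral_gauss_remainder(1))
  have Ia: "?I a = ennreal (pi\<^sup>2 / 12)" unfolding a_def k4_def by (rule arctan_double_integral)
  have nn: "0 \<le> e \<tau>" "0 \<le> v \<tau>" "0 \<le> w \<tau>" "0 \<le> a \<tau>" if "\<tau> \<in> {0<..<sqrt 3}" for \<tau>
  proof -
    show "0 \<le> v \<tau>" unfolding v_def using box(2)[of \<tau>] that by simp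
    show "0 \<le> w \<tau>" unfolding w_def using nn_integral_gauss_remainder(2) that by simp
    have "\<tau>\<^sup>2 < (sqrt 3)\<^sup>2" using that by (intro power_strict_mono) auto
    then show "0 \<le> a \<tau>" by (auto simp: a_def k4_def intro!: divide_nonneg_nonneg mult_nonneg_nonneg add_nonneg_nonneg)
  qed (simp add: e_def)
  \<comment> \<open>Both \<open>v\<close> and \<open>w\<close> contain
    \<open>arctan (k4 \<tau> / sqrt 3) / (k4 \<tau> * (1 + \<tau>^2))\<close>, with coefficients
    -1/3 and -1/4, and this combination removes it; the constant is
    \<open>pi / 4 = pi / 12 + pi / 6\<close>. Only sums occur because subtraction in
    \<open>ennreal\<close> truncates.\<close>
  have rel: "3 * v \<tau> + pi / 4 * e \<tau> = a \<tau> + 4 * w \<tau>" if "\<tau> \<in> {0<..<sqrt 3}" for \<tau>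
  proof -
    have t: "\<tau>\<^sup>2 < 3" using power_strict_mono[of \<tau> "sqrt 3" 2] that by simp
    have k: "0 < k4 \<tau>" "(k4 \<tau>)\<^sup>2 = (3 + \<tau>\<^sup>2) / 2" by (simp_all add: k4_def add_pos_nonneg field_simps)
    have k1: "1 - (k4 \<tau> / sqrt 3)\<^sup>2 = (3 - \<tau>\<^sup>2) / 6" using k(2) by (simp add: power_divide field_simps)
    have "sqrt 2 * (k4 \<tau> / sqrt 3) / sqrt (1 - (k4 \<tau> / sqrt 3)\<^sup>2) = 2 * k4 \<tau> / sqrt (3 - \<tau>\<^sup>2)"
    proof -
      have "sqrt 6 * sqrt 2 = 2 * sqrt (3::real)"
        using real_sqrt_mult[of 4 3] by (simp add: real_sqrt_mult[symmetric])
      then have "sqrt 2 * sqrt 6 / sqrt 3 = (2 :: real)" by (simp add: mult.commute)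
      then have "sqrt 2 * (K / sqrt 3) / (Q / sqrt 6) = 2 * K / Q" for K Q :: real
        by (metis (no_types, opaque_lifting) divide_divide_eq_right mult.commute times_divide_eq_left times_divide_eq_right)
      then show ?thesis unfolding k1 real_sqrt_divide .
    qed
    then have L1: "L_vol (k4 \<tau> / sqrt 3) = (arctan (2 * k4 \<tau> / sqrt (3 - \<tau>\<^sup>2)) - arctan (k4 \<tau> / sqrt 3)) / 3"
      unfolding L_vol_def by simp
    have a6: "arctan (1 / sqrt 3) = pi / 6" using arctan_tan[of "pi / 6"] tan_30 by simp
    have "sqrt 2 * (1 / sqrt 3) / sqrt (1 - (1 / sqrt 3)\<^sup>2) = 1"
      by (simp add: power_divide real_sqrt_divide)
    then have L2: "L_vol (1 / sqrt 3) = (pi / 4 - pi / 6) / 3"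
      unfolding L_vol_def by (simp add: a6 arctan_one)
    have gen: "3 * (((A - B) / 3 / K - (pi / 4 - pi / 6) / 3) / M) + pi / 4 * (1 / M) = A / (K * M) + 4 * ((- B / 4 / K + pi / 6 / 4) / M)"
      if "0 < K" "0 < M" for A B K M :: real
      using that by (simp add: field_simps)
    show ?thesis unfolding v_def e_def a_def w_def L1 L2 a6
      by (rule gen[OF k(1)]) (simp add: add_pos_nonneg)
  qed
  have "3 * ?I v + ennreal (pi / 4) * ?I e = (LI \<tau>. 3 * (ennreal (v \<tau>) * indicator {0<..<sqrt 3} \<tau>)
      + ennreal (pi / 4) * (ennreal (e \<tau>) * indicator {0<..<sqrt 3} \<tau>))"
    by (subst nn_integral_add) (measurable, simp add: nn_integral_cmult)
  also have "\<dots> = (LI \<tau>. (ennreal (a \<tau>) * indicator {0<..<sqrt 3} \<tau>)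
      + 4 * (ennreal (w \<tau>) * indicator {0<..<sqrt 3} \<tau>))"
  proof (rule nn_integral_cong)
    fix \<tau> :: real
    show "3 * (ennreal (v \<tau>) * indicator {0<..<sqrt 3} \<tau>) + ennreal (pi / 4) * (ennreal (e \<tau>) * indicator {0<..<sqrt 3} \<tau>) =
        ennreal (a \<tau>) * indicator {0<..<sqrt 3} \<tau> + 4 * (ennreal (w \<tau>) * indicator {0<..<sqrt 3} \<tau>)"
    proof (cases "\<tau> \<in> {0<..<sqrt 3}")
      case True
      have lin: "ennreal (c * x + d * y) = ennreal c * ennreal x + ennreal d * ennreal y"
        if "0 \<le> c" "0 \<le> x" "0 \<le> d" "0 \<le> y" for c d x y
        using that by (simp add: ennreal_mult)
      have "3 * ennreal (v \<tau>) + ennreal (pi / 4) * ennreal (e \<tau>) = ennreal (3 * v \<tau> + pi / 4 * e \<tau>)"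
        by (subst lin) (use nn[OF True] in simp_all)
      also have "3 * v \<tau> + pi / 4 * e \<tau> = 1 * a \<tau> + 4 * w \<tau>" using rel[OF True] by simp
      also have "ennreal (1 * a \<tau> + 4 * w \<tau>) = ennreal (a \<tau>) + 4 * ennreal (w \<tau>)"
        by (subst lin) (use nn[OF True] in simp_all)
      finally show ?thesis using True by simp
    qed simp
  qed
  also have "\<dots> = ?I a + 4 * ?I w"
    by (subst nn_integral_add) (measurable, simp add: nn_integral_cmult)
  finally have sum: "3 * ?I v + ennreal (pi / 4) * ennreal (pi / 3) = ennreal (pi\<^sup>2 / 12) + 4 * ennreal (pi\<^sup>2 / 1152)"
    unfolding Ie Ia Iw .
  \<comment> \<open>The contribution of \<open>e\<close> cancels exactly against that of
    \<open>a\<close>, so the volume is a rational multiple of the Gaussian value.\<close>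
  have "ennreal (pi / 4) * ennreal (pi / 3) = ennreal (pi\<^sup>2 / 12)"
    by (subst ennreal_mult'[symmetric]) (simp_all add: power2_eq_square)
  with sum have "3 * ?I v = 4 * ennreal (pi\<^sup>2 / 1152)"
    by (simp add: add.commute[of "3 * _"] ennreal_add_left_cancel)
  then have "24 * (3 * ?I v) = 24 * (4 * ennreal (pi\<^sup>2 / 1152))" by simp
  also have "\<dots> = ennreal (96 * (pi\<^sup>2 / 1152))"
    by (simp only: ennreal_mult' mult.assoc[symmetric] ennreal_numeral zero_le_numeral) simp
  finally have V: "72 * ?I v = ennreal (pi\<^sup>2 / 12)" by (simp add: mult.assoc[symmetric])
  have "(LI x. LI y. LI z. LI w. vol_density (x, y, z, w)) = 72 * ?I v"
  proof (subst nn_integral_F4[OF h F])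
    show "vol_density (x, y, z, w) = vol_density (y, x, z, w)" "vol_density (x, y, z, w) = vol_density (x, z, y, w)"
      "vol_density (x, y, z, w) = vol_density (x, y, w, z)" for x y z w
      by (auto simp: vol_density_def Let_def ac_simps)
    show "vol_density (a, b, c, d) = ?F (a\<^sup>2 + b\<^sup>2 + c\<^sup>2 + d\<^sup>2, a + b)" if "0 < d" "d < c" "c < b" "b < a" for a b c d
      using that by (auto simp: vol_density_def Let_def)
    show "vol_density (a, b, c, d) = 0" if "d < 0" for a b c d using that by (simp add: vol_density_def)
  qed (unfold nn_integral_simplex_box[OF F], subst box(1), simp_all add: v_def)
  then show ?thesis using V by simp
qed

section \<open>Lebesgue measure on \<open>real^4\<close> as an iterated integral, and the volume of
  \<open>P\<close>\<close>

lemma measurable_vec4: "(\<lambda>(a, b, c, d). vec4 a b c d) \<in> borel_measurable borel"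
proof (rule borel_measurable_continuous_onI)
  have "continuous_on UNIV (\<lambda>p. if i = 1 then fst p else if i = 2 then fst (snd p) else if i = 3 then fst (snd (snd p)) else snd (snd (snd p)))"
    for i :: 4
    by (cases "i = 1"; cases "i = 2"; cases "i = 3") (simp_all add: continuous_intros)
  then show "continuous_on UNIV (\<lambda>(a, b, c, d). vec4 a b c d)"
    unfolding split_beta' by (intro continuous_on_vec_lambda)
qed

lemma emeasure_lborel_Times:
  fixes A :: "'a::euclidean_space set" and B :: "'b::euclidean_space set"
  assumes "A \<in> sets borel" "B \<in> sets borel"
  shows "emeasure lborel (A \<times> B) = emeasure lborel A * emeasure lborel B"
  using assms by (simp add: lborel_prod[symmetric] lborel.emeasure_pair_measure_Times)

lemma lborel_vec4:
  "(lborel :: (real^4) measure) = distr (lborel :: (real \<times> real \<times> real \<times> real) measure) borel (\<lambda>(a, b, c, d). vec4 a b c d)"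
proof (rule lborel_eqI)
  let ?V = "\<lambda>(a, b, c, d). vec4 a b c d"
  note m = measurable_vec4
  fix l u :: "real^4" assume lu: "\<And>b. b \<in> Basis \<Longrightarrow> l \<bullet> b \<le> u \<bullet> b"
  then have le: "l $ i \<le> u $ i" for i by (metis axis_in_Basis_iff inner_axis mult.right_neutral inner_real_def insertI1 Basis_real_def)
  let ?l = "(l $ 1, l $ 2, l $ 3, l $ 4)" and ?u = "(u $ 1, u $ 2, u $ 3, u $ 4)"
  have "?V -` box l u = {l $ 1<..<u $ 1} \<times> {l $ 2<..<u $ 2} \<times> {l $ 3<..<u $ 3} \<times> {l $ 4<..<u $ 4}"
    by (auto simp: mem_box_cart forall_4)
  then have "emeasure (distr lborel borel ?V) (box l u) =
      emeasure lborel ({l $ 1<..<u $ 1} \<times> {l $ 2<..<u $ 2} \<times> {l $ 3<..<u $ 3} \<times> {l $ 4<..<u $ 4})"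
    using m by (subst emeasure_distr) auto
  also have "\<dots> = ennreal (u $ 1 - l $ 1) * (ennreal (u $ 2 - l $ 2) * (ennreal (u $ 3 - l $ 3) * ennreal (u $ 4 - l $ 4)))"
    using le by (simp add: emeasure_lborel_Times borel_Times)
  also have "\<dots> = ennreal (\<Prod>i\<in>UNIV. u $ i - l $ i)"
    using le unfolding UNIV_4 by (simp add: ennreal_mult)
  also have "(\<Prod>i\<in>UNIV. u $ i - l $ i) = (\<Prod>b\<in>Basis. (u - l) \<bullet> b)"
  proof -
    have B: "(Basis :: (real^4) set) = (\<lambda>i. axis i 1) ` UNIV" by (auto simp: Basis_vec_def)
    have inj: "inj (\<lambda>i. axis i 1 :: real^4)" by (auto simp: inj_on_def axis_eq_axis)
    show ?thesis unfolding B prod.reindex[OF inj] by (simp add: inner_axis)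
  qed
  finally show "emeasure (distr lborel borel ?V) (box l u) = (\<Prod>b\<in>Basis. (u - l) \<bullet> b)" .
qed simp

lemma nn_integral_vec4:
  fixes f :: "real^4 \<Rightarrow> ennreal"
  assumes f[measurable]: "f \<in> borel_measurable borel"
  shows "(LI x. f x) = (LI a. LI b. LI c. LI d. f (vec4 a b c d))"
proof -
  let ?V = "\<lambda>(a, b, c, d). vec4 a b c d"
  note measurable_vec4[measurable]
  have fV: "(\<lambda>p. f (?V p)) \<in> borel_measurable borel" by measurable
  have f1: "(\<lambda>p. f (?V (a, p))) \<in> borel_measurable borel" for a
    by (rule measurable_compose[OF _ fV]) (intro borel_measurable_continuous_onI continuous_intros)
  have f2: "(\<lambda>p. f (?V (a, b, p))) \<in> borel_measurable borel" for a b
    by (rule measurable_compose[OF _ fV]) (intro borel_measurable_continuous_onI continuous_intros)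
  have "(LI x. f x) = (LI p. f (?V p))"
    by (subst lborel_vec4) (simp add: nn_integral_distr)
  also have "\<dots> = (LI a. LI p. f (?V (a, p)))"
    by (rule nn_integral_lborel_prod_measurable(1)[OF fV])
  also have "\<dots> = (LI a. LI b. LI p. f (?V (a, b, p)))"
    by (rule nn_integral_cong, rule nn_integral_lborel_prod_measurable(1)[OF f1])
  also have "\<dots> = (LI a. LI b. LI c. LI d. f (?V (a, b, c, d)))"
    by (rule nn_integral_cong, rule nn_integral_cong, rule nn_integral_lborel_prod_measurable(1)[OF f2])
  finally show ?thesis by simp
qed

lemma emeasure_P:
  assumes P: "W.P \<in> sets borel"
  shows "emeasure hyp_measure W.P = ennreal (pi\<^sup>2 / 12)"
proof -
  let ?f = "\<lambda>x. ennreal (1 / sqrt (1 + (norm x)\<^sup>2)) * indicator W.P (lift x)"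
  have [measurable]: "?f \<in> borel_measurable borel"
    using P by measurable
  have "?f (vec4 a b c d) = vol_density (a, b, c, d)" for a b c d
  proof -
    have n: "(norm (vec4 a b c d))\<^sup>2 = a\<^sup>2 + b\<^sup>2 + c\<^sup>2 + d\<^sup>2"
      unfolding power2_norm_eq_inner by (simp add: inner_vec_def sum_4 power2_eq_square)
    let ?t = "sqrt (1 + (a\<^sup>2 + b\<^sup>2 + c\<^sup>2 + d\<^sup>2))"
    have l: "lift (vec4 a b c d) = pt a b c d ?t" unfolding n by (simp add: pt.simps)
    have H: "pt a b c d ?t \<in> H4" unfolding l[symmetric] H4_eq_lift by blast
    have "(\<forall>s. 0 \<le> lorentz (pt a b c d ?t) (root s)) \<longleftrightarrow> (\<forall>s\<in>{X1, X2, X3, X4, Y12, Y13, Y14, Y23, Y24, Y34}. 0 \<le> lorentz (pt a b c d ?t) (root s))"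
      using UNIV_wall by blast
    also have "\<dots> \<longleftrightarrow> 0 \<le> a \<and> 0 \<le> b \<and> 0 \<le> c \<and> 0 \<le> d \<and> a + b \<le> ?t \<and> a + c \<le> ?t \<and> a + d \<le> ?t \<and> b + c \<le> ?t \<and> b + d \<le> ?t \<and> c + d \<le> ?t"
      by (simp add: lorentz_pt) linarith
    finally show ?thesis unfolding l unfolding n W.P_def vol_density_def Let_def prod.case using H by (simp add: indicator_def)
  qed
  then show ?thesis
    using vol_density_total by (simp add: emeasure_hyp_measure[OF P] nn_integral_vec4)
qed

section \<open>Assembly of the concrete system\<close>

lemma lebesgue_preserving_root:
  assumes f: "f \<in> borel_measurable borel"
  shows "(LI p. f (reflect (root s) p)) = (LI p. f p)"
proof -
  have X: "root X1 = (axis 1 1, 0)" "root X2 = (axis 2 1, 0)" "root X3 = (axis 3 1, 0)" "root X4 = (axis 4 1, 0)"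
    by (simp_all add: pt.simps vec_eq_iff forall_4 axis_def)
  show ?thesis
  proof (cases "snd (root s) = 0")
    case True
    then have "s \<in> {X1, X2, X3, X4}" by (cases s) (simp_all add: pt.simps)
    then show ?thesis using nn_integral_reflect_axis[OF f] X by auto
  qed (rule nn_integral_reflect[OF f norm_root])
qed

lemma measured_system:
  assumes N: "even N" "0 < N"
  shows "measured_reflection_system root (step N) (labels N) (0, False, False, False)"
proof (unfold_locales, goal_cases)
  case (1 x s) then show ?case by (rule step_invol[OF N(1)])
next
  case (2 x s t) from 2(2) show ?case by (rule step_com)
next
  case (3 x s) then show ?case by (rule step_labels[OF N(2)])
next
  case 4 show ?case by (simp add: labels_def)
next
  case 5 show ?case using N by (simp add: labels_def)
next
  case (6 x) then show ?case by (rule step_transitive[OF N])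
next
  case (7 w x) from 7(1-3) show ?case by (rule step_free[OF N(1)])
next
  case (8 q) then show ?case by (rule chambers_cover)
next
  case 9 show ?case by (rule P_int_nonempty)
next
  case (10 f s) then show ?case by (rule lebesgue_preserving_root)
qed

theorem theoremB:
  fixes n :: nat
  assumes "0 < n"
  shows "\<exists>M. complete_hyperbolic_4_manifold M \<and> hyp_volume M < \<infinity> \<and>
             hyp_volume M = ennreal (2 * real n * (4 * pi\<^sup>2 / 3))"
proof -
  \<comment> \<open>This gives \<open>8 * N = 32 * n\<close> labels, and
    \<open>32 * n * pi^2 / 12 = 2 * n * (4 * pi^2 / 3)\<close>.\<close>
  define N where "N = 4 * int n"
  have N: "even N" "0 < N" using assms by (simp_all add: N_def)
  interpret S: measured_reflection_system root "step N" "labels N" "(0, False, False, False)"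
    by (rule measured_system[OF N])
  have "hyp_volume (orbit_space S.G) = of_nat (card (labels N)) * ennreal (pi\<^sup>2 / 12)"
    using S.hyp_volume_eq emeasure_P[OF S.P_measurable(1)] by simp
  also have "\<dots> = ennreal (real (card (labels N)) * (pi\<^sup>2 / 12))"
    unfolding ennreal_of_nat_eq_real_of_nat by (rule ennreal_mult[symmetric]) simp_all
  also have "real (card (labels N)) * (pi\<^sup>2 / 12) = 2 * real n * (4 * pi\<^sup>2 / 3)"
    unfolding card_labels[OF N(2)] by (simp add: N_def)
  finally have "hyp_volume (orbit_space S.G) = ennreal (2 * real n * (4 * pi\<^sup>2 / 3))" .
  then show ?thesis using S.complete_manifold by (intro exI[of _ "orbit_space S.G"]) simp
qed

end
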